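(* Let $\Gamma$ be a discrete group having only finitely many finite subgroups up to conjugacy, and let $S$ be any commutative ring with unit satisfying the minimal condition on ideals (the descending chain condition). Then for any family $\mathcal{F}$ of finite subgroups of $\Gamma$, $G_{\mathcal{F}}(S[\Gamma])$ is a free abelian group of finite rank.
   Context: A family $\mathcal{F}$ of finite subgroups of $\Gamma$ is a non-empty collection of finite subgroups of $\Gamma$ closed under conjugation and under taking subgroups. For a ring $A$, $G(A)$ is the Grothendieck group of finitely generated left $A$-modules: generators $[M]$ and relations $[M]=[M']+[M'']$ for each short exact sequence $0\to M'\to M\to M''\to 0$. For a commutative ring $R$, $G_{\mathcal{F}}(R[\Gamma])=\varprojlim_{H\in\mathcal{F}} G(R[H])$ is the subgroup of those $(x_H)\in\prod_{H\in\mathcal{F}}G(R[H])$ such that (1) $\mathrm{res}^K_H(x_K)=x_H$ whenever $H\subseteq K$ are in $\mathcal{F}$, and (2) $C_\gamma^*(x_K)=x_H$ whenever $K=\gamma H\gamma^{-1}$, where $C_\gamma^*:G(R[\gamma H\gamma^{-1}])\to G(R[H])$ is induced by the conjugation homomorphism $C_\gamma:H\to\gamma H\gamma^{-1}$, $h\mapsto \gamma h\gamma^{-1}$. *)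

theory Defs
  imports "HOL-Algebra.Algebra"
begin

section \<open>Group rings\<close>

text \<open>Elements of \<open>R[G]\<close> are the finitely supported functions on \<open>G\<close> with values in \<open>R\<close>, extended
  by zero outside \<open>carrier G\<close>.  In particular \<open>R[H]\<close> and \<open>R[K]\<close> have the same element type for
  subgroups \<open>H\<close>, \<open>K\<close> of a common group.\<close>

definition group_ring :: "('r, 'm) ring_scheme \<Rightarrow> ('g, 'n) monoid_scheme \<Rightarrow> ('g \<Rightarrow> 'r) ring" where
  "group_ring R G =
    \<lparr>carrier = {a. (\<forall>x. a x \<in> carrier R) \<and> (\<forall>x. x \<notin> carrier G \<longrightarrow> a x = \<zero>\<^bsub>R\<^esub>)
                  \<and> finite {x. a x \<noteq> \<zero>\<^bsub>R\<^esub>}},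
     monoid.mult = (\<lambda>a b x. if x \<in> carrier G
        then (\<Oplus>\<^bsub>R\<^esub>y\<in>{y \<in> carrier G. a y \<noteq> \<zero>\<^bsub>R\<^esub>}. a y \<otimes>\<^bsub>R\<^esub> b (inv\<^bsub>G\<^esub> y \<otimes>\<^bsub>G\<^esub> x)) else \<zero>\<^bsub>R\<^esub>),
     one = (\<lambda>x. if x = \<one>\<^bsub>G\<^esub> then \<one>\<^bsub>R\<^esub> else \<zero>\<^bsub>R\<^esub>),
     ring.zero = (\<lambda>x. \<zero>\<^bsub>R\<^esub>),
     add = (\<lambda>a b x. a x \<oplus>\<^bsub>R\<^esub> b x)\<rparr>"

lemma group_ring_mult_eq:
  assumes "ring R" "group G" "finite (carrier G)"
    and a: "a \<in> carrier (group_ring R G)" and b: "b \<in> carrier (group_ring R G)"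
    and x: "x \<in> carrier G"
  shows "(a \<otimes>\<^bsub>group_ring R G\<^esub> b) x =
    (\<Oplus>\<^bsub>R\<^esub>y\<in>carrier G. a y \<otimes>\<^bsub>R\<^esub> b (inv\<^bsub>G\<^esub> y \<otimes>\<^bsub>G\<^esub> x))"
proof -
  interpret ring R by fact
  have ab: "\<And>z. a z \<in> carrier R" "\<And>z. b z \<in> carrier R" using a b by (auto simp: group_ring_def)
  show ?thesis using x assms(3) ab
    by (simp add: group_ring_def) (rule add.finprod_mono_neutral_cong_left, auto)
qed

lemma (in group) finsum_left_translate:
  assumes "abelian_monoid R" "f \<in> carrier G \<rightarrow> carrier R" "y \<in> carrier G"
  shows "(\<Oplus>\<^bsub>R\<^esub>z\<in>carrier G. f z) = (\<Oplus>\<^bsub>R\<^esub>z\<in>carrier G. f (y \<otimes> z))"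
proof -
  interpret abelian_monoid R by fact
  have "(\<lambda>z. y \<otimes> z) ` carrier G = carrier G" "inj_on (\<lambda>z. y \<otimes> z) (carrier G)"
    using assms(3) by (simp_all add: surj_const_mult inj_on_cmult)
  then show ?thesis using add.finprod_reindex[of f "\<lambda>z. y \<otimes> z" "carrier G"] assms(2) by simp
qed

lemma ring_group_ring:
  fixes R :: "('r, 'm) ring_scheme" and G :: "('g, 'n) monoid_scheme"
  assumes R: "ring R" and G: "group G" and fin: "finite (carrier G)"
  shows "ring (group_ring R G)"
proof -
  interpret R: ring R by fact
  interpret G: group G by fact
  let ?A = "group_ring R G"
  note mult = group_ring_mult_eq[OF R G fin]
  have carr: "a \<in> carrier ?A \<longleftrightarrow> (\<forall>x. a x \<in> carrier R) \<and> (\<forall>x. x \<notin> carrier G \<longrightarrow> a x = \<zero>\<^bsub>R\<^esub>)" for a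
  proof -
    have "(\<forall>x. x \<notin> carrier G \<longrightarrow> a x = \<zero>\<^bsub>R\<^esub>) \<Longrightarrow> {x. a x \<noteq> \<zero>\<^bsub>R\<^esub>} \<subseteq> carrier G" by auto
    then show ?thesis using fin by (auto simp: group_ring_def intro: finite_subset)
  qed
  have out: "x \<notin> carrier G \<Longrightarrow> (a \<otimes>\<^bsub>?A\<^esub> b) x = \<zero>\<^bsub>R\<^esub>" for a b x by (simp add: group_ring_def)
  have [simp]: "(a \<oplus>\<^bsub>?A\<^esub> b) x = a x \<oplus>\<^bsub>R\<^esub> b x" for a b x by (simp add: group_ring_def)
  have zero: "\<zero>\<^bsub>?A\<^esub> = (\<lambda>x. \<zero>\<^bsub>R\<^esub>)" by (simp add: group_ring_def)
  have one: "\<one>\<^bsub>?A\<^esub> = (\<lambda>x. if x = \<one>\<^bsub>G\<^esub> then \<one>\<^bsub>R\<^esub> else \<zero>\<^bsub>R\<^esub>)" by (simp add: group_ring_def)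
  have mcl: "a \<otimes>\<^bsub>?A\<^esub> b \<in> carrier ?A" if "a \<in> carrier ?A" "b \<in> carrier ?A" for a b
  proof -
    have "(a \<otimes>\<^bsub>?A\<^esub> b) x \<in> carrier R" for x
      using that by (cases "x \<in> carrier G") (auto simp: mult out carr intro!: R.add.finprod_closed)
    then show ?thesis using out by (auto simp: carr)
  qed
  have acl: "a \<oplus>\<^bsub>?A\<^esub> b \<in> carrier ?A" if "a \<in> carrier ?A" "b \<in> carrier ?A" for a b
    using that by (auto simp: carr)
  have ocl: "\<one>\<^bsub>?A\<^esub> \<in> carrier ?A" by (auto simp: carr one)
  show ?thesis
  proof (rule ringI)
    show "abelian_group ?A"
    proof (rule abelian_groupI)
      fix a assume a: "a \<in> carrier ?A"
      have "(\<lambda>x. \<ominus>\<^bsub>R\<^esub> a x) \<in> carrier ?A" "(\<lambda>x. \<ominus>\<^bsub>R\<^esub> a x) \<oplus>\<^bsub>?A\<^esub> a = \<zero>\<^bsub>?A\<^esub>"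
        using a by (auto simp: carr zero fun_eq_iff R.l_neg)
      then show "\<exists>y\<in>carrier ?A. y \<oplus>\<^bsub>?A\<^esub> a = \<zero>\<^bsub>?A\<^esub>" by blast
    qed (auto simp: carr zero fun_eq_iff R.a_ac)
    show "Group.monoid ?A"
    proof (rule monoidI)
      fix a assume a: "a \<in> carrier ?A"
      show "\<one>\<^bsub>?A\<^esub> \<otimes>\<^bsub>?A\<^esub> a = a"
      proof
        fix x show "(\<one>\<^bsub>?A\<^esub> \<otimes>\<^bsub>?A\<^esub> a) x = a x"
        proof (cases "x \<in> carrier G")
          case True
          have "(\<one>\<^bsub>?A\<^esub> \<otimes>\<^bsub>?A\<^esub> a) x =
              (\<Oplus>\<^bsub>R\<^esub>y\<in>carrier G. if \<one>\<^bsub>G\<^esub> = y then a x else \<zero>\<^bsub>R\<^esub>)"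
            unfolding mult[OF ocl a True]
            by (rule R.add.finprod_cong') (use a True in \<open>auto simp: one carr\<close>)
          also have "\<dots> = a x" using R.add.finprod_singleton[of "\<one>\<^bsub>G\<^esub>" "carrier G" "\<lambda>y. a x"] fin a
            by (simp add: carr)
          finally show ?thesis .
        qed (use a in \<open>auto simp: out carr\<close>)
      qed
      show "a \<otimes>\<^bsub>?A\<^esub> \<one>\<^bsub>?A\<^esub> = a"
      proof
        fix x show "(a \<otimes>\<^bsub>?A\<^esub> \<one>\<^bsub>?A\<^esub>) x = a x"
        proof (cases "x \<in> carrier G")
          case True
          have *: "inv\<^bsub>G\<^esub> y \<otimes>\<^bsub>G\<^esub> x = \<one>\<^bsub>G\<^esub> \<longleftrightarrow> x = y" if "y \<in> carrier G" for y
            using that True by (simp add: G.inv_solve_left')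
          have "(a \<otimes>\<^bsub>?A\<^esub> \<one>\<^bsub>?A\<^esub>) x =
              (\<Oplus>\<^bsub>R\<^esub>y\<in>carrier G. if x = y then a y else \<zero>\<^bsub>R\<^esub>)"
            unfolding mult[OF a ocl True]
            by (rule R.add.finprod_cong') (use a True in \<open>auto simp: one carr *\<close>)
          also have "\<dots> = a x" using R.add.finprod_singleton[of x "carrier G" a] fin a True
            by (simp add: carr)
          finally show ?thesis .
        qed (use a in \<open>auto simp: out carr\<close>)
      qed
    next
      fix a b c assume a: "a \<in> carrier ?A" and b: "b \<in> carrier ?A" and c: "c \<in> carrier ?A"
      note cl = a[unfolded carr, THEN conjunct1, rule_format]
        b[unfolded carr, THEN conjunct1, rule_format] c[unfolded carr, THEN conjunct1, rule_format]
      show "a \<otimes>\<^bsub>?A\<^esub> b \<otimes>\<^bsub>?A\<^esub> c = a \<otimes>\<^bsub>?A\<^esub> (b \<otimes>\<^bsub>?A\<^esub> c)"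
      proof
        fix x show "(a \<otimes>\<^bsub>?A\<^esub> b \<otimes>\<^bsub>?A\<^esub> c) x = (a \<otimes>\<^bsub>?A\<^esub> (b \<otimes>\<^bsub>?A\<^esub> c)) x"
        proof (cases "x \<in> carrier G")
          case x: True
          have "(a \<otimes>\<^bsub>?A\<^esub> b \<otimes>\<^bsub>?A\<^esub> c) x =
            (\<Oplus>\<^bsub>R\<^esub>z\<in>carrier G. (\<Oplus>\<^bsub>R\<^esub>y\<in>carrier G. a y \<otimes>\<^bsub>R\<^esub> b (inv\<^bsub>G\<^esub> y \<otimes>\<^bsub>G\<^esub> z)) \<otimes>\<^bsub>R\<^esub> c (inv\<^bsub>G\<^esub> z \<otimes>\<^bsub>G\<^esub> x))"
            unfolding mult[OF mcl[OF a b] c x]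
            by (rule R.add.finprod_cong') (auto simp: mult[OF a b] cl intro!: R.add.finprod_closed R.m_closed)
          also have "\<dots> = (\<Oplus>\<^bsub>R\<^esub>z\<in>carrier G. \<Oplus>\<^bsub>R\<^esub>y\<in>carrier G.
              a y \<otimes>\<^bsub>R\<^esub> b (inv\<^bsub>G\<^esub> y \<otimes>\<^bsub>G\<^esub> z) \<otimes>\<^bsub>R\<^esub> c (inv\<^bsub>G\<^esub> z \<otimes>\<^bsub>G\<^esub> x))"
            by (rule R.add.finprod_cong') (auto simp: cl fin R.finsum_ldistr intro!: R.add.finprod_closed)
          also have "\<dots> = (\<Oplus>\<^bsub>R\<^esub>y\<in>carrier G. \<Oplus>\<^bsub>R\<^esub>z\<in>carrier G.
              a y \<otimes>\<^bsub>R\<^esub> b (inv\<^bsub>G\<^esub> y \<otimes>\<^bsub>G\<^esub> z) \<otimes>\<^bsub>R\<^esub> c (inv\<^bsub>G\<^esub> z \<otimes>\<^bsub>G\<^esub> x))"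
          proof -
            have swap: "finite A \<Longrightarrow> finite B \<Longrightarrow> (\<And>z y. z \<in> A \<Longrightarrow> y \<in> B \<Longrightarrow> f z y \<in> carrier R) \<Longrightarrow>
               (\<Oplus>\<^bsub>R\<^esub>z\<in>A. \<Oplus>\<^bsub>R\<^esub>y\<in>B. f z y) = (\<Oplus>\<^bsub>R\<^esub>y\<in>B. \<Oplus>\<^bsub>R\<^esub>z\<in>A. f z y)" for A B :: "'g set" and f
            proof (induction A rule: finite_induct)
              case (insert u A)
              have "(\<Oplus>\<^bsub>R\<^esub>y\<in>B. \<Oplus>\<^bsub>R\<^esub>z\<in>insert u A. f z y) = (\<Oplus>\<^bsub>R\<^esub>y\<in>B. f u y \<oplus>\<^bsub>R\<^esub> (\<Oplus>\<^bsub>R\<^esub>z\<in>A. f z y))"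
                by (rule R.add.finprod_cong')
                   (use insert in \<open>auto intro!: R.add.finprod_closed R.add.m_closed R.finsum_insert\<close>)
              also have "\<dots> = (\<Oplus>\<^bsub>R\<^esub>y\<in>B. f u y) \<oplus>\<^bsub>R\<^esub> (\<Oplus>\<^bsub>R\<^esub>y\<in>B. \<Oplus>\<^bsub>R\<^esub>z\<in>A. f z y)"
                by (rule R.add.finprod_multf) (use insert in \<open>auto intro!: R.add.finprod_closed\<close>)
              finally show ?case using insert
                by (subst R.finsum_insert) (auto intro!: R.add.finprod_closed)
            qed simp
            show ?thesis by (rule swap) (use fin cl in simp_all)
          qed
          also have "\<dots> = (\<Oplus>\<^bsub>R\<^esub>y\<in>carrier G. \<Oplus>\<^bsub>R\<^esub>z\<in>carrier G.
              a y \<otimes>\<^bsub>R\<^esub> (b z \<otimes>\<^bsub>R\<^esub> c (inv\<^bsub>G\<^esub> z \<otimes>\<^bsub>G\<^esub> (inv\<^bsub>G\<^esub> y \<otimes>\<^bsub>G\<^esub> x))))"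
          proof (rule R.add.finprod_cong'[OF refl])
            fix y assume y: "y \<in> carrier G"
            have *: "inv\<^bsub>G\<^esub> y \<otimes>\<^bsub>G\<^esub> (y \<otimes>\<^bsub>G\<^esub> z) = z" if "z \<in> carrier G" for z
              using y that by (simp add: G.m_assoc[symmetric])
            show "(\<Oplus>\<^bsub>R\<^esub>z\<in>carrier G. a y \<otimes>\<^bsub>R\<^esub> b (inv\<^bsub>G\<^esub> y \<otimes>\<^bsub>G\<^esub> z) \<otimes>\<^bsub>R\<^esub> c (inv\<^bsub>G\<^esub> z \<otimes>\<^bsub>G\<^esub> x)) =
              (\<Oplus>\<^bsub>R\<^esub>z\<in>carrier G. a y \<otimes>\<^bsub>R\<^esub> (b z \<otimes>\<^bsub>R\<^esub> c (inv\<^bsub>G\<^esub> z \<otimes>\<^bsub>G\<^esub> (inv\<^bsub>G\<^esub> y \<otimes>\<^bsub>G\<^esub> x))))"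
              apply (subst G.finsum_left_translate[OF R.abelian_monoid_axioms _ y])
               apply (simp add: cl)
              apply (rule R.add.finprod_cong')
              using x y by (auto simp: cl * R.m_assoc G.inv_mult_group G.m_assoc)
          qed (auto simp: cl intro!: R.add.finprod_closed)
          also have "\<dots> = (\<Oplus>\<^bsub>R\<^esub>y\<in>carrier G. a y \<otimes>\<^bsub>R\<^esub> (b \<otimes>\<^bsub>?A\<^esub> c) (inv\<^bsub>G\<^esub> y \<otimes>\<^bsub>G\<^esub> x))"
            by (rule R.add.finprod_cong')
              (use x in \<open>auto simp: mult[OF b c] cl fin R.finsum_rdistr intro!: R.add.finprod_closed R.m_closed\<close>)
          also have "\<dots> = (a \<otimes>\<^bsub>?A\<^esub> (b \<otimes>\<^bsub>?A\<^esub> c)) x" using mult[OF a mcl[OF b c] x] by simp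
          finally show ?thesis .
        qed (simp add: out)
      qed
    qed (auto intro: mcl ocl)
  next
    fix a b c assume a: "a \<in> carrier ?A" and b: "b \<in> carrier ?A" and c: "c \<in> carrier ?A"
    note cl = a[unfolded carr, THEN conjunct1, rule_format]
      b[unfolded carr, THEN conjunct1, rule_format] c[unfolded carr, THEN conjunct1, rule_format]
    show "(a \<oplus>\<^bsub>?A\<^esub> b) \<otimes>\<^bsub>?A\<^esub> c = a \<otimes>\<^bsub>?A\<^esub> c \<oplus>\<^bsub>?A\<^esub> b \<otimes>\<^bsub>?A\<^esub> c"
    proof
      fix x show "((a \<oplus>\<^bsub>?A\<^esub> b) \<otimes>\<^bsub>?A\<^esub> c) x = (a \<otimes>\<^bsub>?A\<^esub> c \<oplus>\<^bsub>?A\<^esub> b \<otimes>\<^bsub>?A\<^esub> c) x"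
        by (cases "x \<in> carrier G")
          (simp_all add: out mult[OF acl[OF a b] c] mult[OF a c] mult[OF b c] cl R.l_distr)
    qed
    show "c \<otimes>\<^bsub>?A\<^esub> (a \<oplus>\<^bsub>?A\<^esub> b) = c \<otimes>\<^bsub>?A\<^esub> a \<oplus>\<^bsub>?A\<^esub> c \<otimes>\<^bsub>?A\<^esub> b"
    proof
      fix x show "(c \<otimes>\<^bsub>?A\<^esub> (a \<oplus>\<^bsub>?A\<^esub> b)) x = (c \<otimes>\<^bsub>?A\<^esub> a \<oplus>\<^bsub>?A\<^esub> c \<otimes>\<^bsub>?A\<^esub> b) x"
        by (cases "x \<in> carrier G")
          (simp_all add: out mult[OF c acl[OF a b]] mult[OF c a] mult[OF c b] cl R.r_distr)
    qed
  qed
qed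

text \<open>The map \<open>R[G] \<rightarrow> R[H]\<close>, \<open>\<Sum> a\<^sub>x x \<mapsto> \<Sum> a\<^sub>x \<phi>(x)\<close>, induced by \<open>\<phi> : G \<rightarrow> H\<close>.\<close>

definition group_ring_map ::
  "('r, 'm) ring_scheme \<Rightarrow> ('g, 'n) monoid_scheme \<Rightarrow> ('h, 'k) monoid_scheme
    \<Rightarrow> ('g \<Rightarrow> 'h) \<Rightarrow> ('g \<Rightarrow> 'r) \<Rightarrow> ('h \<Rightarrow> 'r)" where
  "group_ring_map R G H \<phi> a = (\<lambda>y. if y \<in> carrier H
     then (\<Oplus>\<^bsub>R\<^esub>x\<in>{x \<in> carrier G. a x \<noteq> \<zero>\<^bsub>R\<^esub> \<and> \<phi> x = y}. a x) else \<zero>\<^bsub>R\<^esub>)"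


section \<open>Left modules\<close>

text \<open>The library's locale \<open>module\<close> requires a commutative ring of scalars.  As there, the
  multiplication and unit fields of the record \<open>M\<close> carry no information.\<close>

locale left_module = A?: ring A + M?: abelian_group M
  for A :: "('a, 'k) ring_scheme" (structure) and M :: "('a, 'c, 'l) module_scheme" (structure) +
  assumes smult_closed [simp, intro]:
      "\<lbrakk>a \<in> carrier A; x \<in> carrier M\<rbrakk> \<Longrightarrow> a \<odot>\<^bsub>M\<^esub> x \<in> carrier M"
    and smult_l_distr:
      "\<lbrakk>a \<in> carrier A; b \<in> carrier A; x \<in> carrier M\<rbrakk> \<Longrightarrow>
        (a \<oplus> b) \<odot>\<^bsub>M\<^esub> x = a \<odot>\<^bsub>M\<^esub> x \<oplus>\<^bsub>M\<^esub> b \<odot>\<^bsub>M\<^esub> x"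
    and smult_r_distr:
      "\<lbrakk>a \<in> carrier A; x \<in> carrier M; y \<in> carrier M\<rbrakk> \<Longrightarrow>
        a \<odot>\<^bsub>M\<^esub> (x \<oplus>\<^bsub>M\<^esub> y) = a \<odot>\<^bsub>M\<^esub> x \<oplus>\<^bsub>M\<^esub> a \<odot>\<^bsub>M\<^esub> y"
    and smult_assoc1:
      "\<lbrakk>a \<in> carrier A; b \<in> carrier A; x \<in> carrier M\<rbrakk> \<Longrightarrow>
        (a \<otimes> b) \<odot>\<^bsub>M\<^esub> x = a \<odot>\<^bsub>M\<^esub> (b \<odot>\<^bsub>M\<^esub> x)"
    and smult_one [simp]:
      "x \<in> carrier M \<Longrightarrow> \<one> \<odot>\<^bsub>M\<^esub> x = x"

definition finitely_generated_module :: "('a, 'k) ring_scheme \<Rightarrow> ('a, 'c, 'l) module_scheme \<Rightarrow> bool" where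
  "finitely_generated_module A M \<longleftrightarrow>
     (\<exists>B. finite B \<and> B \<subseteq> carrier M \<and>
          carrier M = {(\<Oplus>\<^bsub>M\<^esub>x\<in>B. a x \<odot>\<^bsub>M\<^esub> x) | a. a \<in> B \<rightarrow> carrier A})"

definition left_module_hom ::
  "('a, 'k) ring_scheme \<Rightarrow> ('a, 'c, 'l) module_scheme \<Rightarrow> ('a, 'd, 'm) module_scheme \<Rightarrow> ('c \<Rightarrow> 'd) set" where
  "left_module_hom A M N =
     {f \<in> carrier M \<rightarrow> carrier N.
        (\<forall>x\<in>carrier M. \<forall>y\<in>carrier M. f (x \<oplus>\<^bsub>M\<^esub> y) = f x \<oplus>\<^bsub>N\<^esub> f y) \<and>
        (\<forall>a\<in>carrier A. \<forall>x\<in>carrier M. f (a \<odot>\<^bsub>M\<^esub> x) = a \<odot>\<^bsub>N\<^esub> f x)}"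

definition short_exact ::
  "('a, 'k) ring_scheme \<Rightarrow> ('a, 'c, 'l) module_scheme \<Rightarrow> ('a, 'd, 'm) module_scheme
    \<Rightarrow> ('a, 'e, 'n) module_scheme \<Rightarrow> bool" where
  "short_exact A M' M M'' \<longleftrightarrow>
     (\<exists>f \<in> left_module_hom A M' M. \<exists>g \<in> left_module_hom A M M''.
        inj_on f (carrier M') \<and> f ` carrier M' = {x \<in> carrier M. g x = \<zero>\<^bsub>M''\<^esub>} \<and>
        g ` carrier M = carrier M'')"

definition restrict_scalars :: "('a \<Rightarrow> 'b) \<Rightarrow> ('b, 'c) module \<Rightarrow> ('a, 'c) module" where
  "restrict_scalars \<phi> M =
     \<lparr>carrier = carrier M, monoid.mult = monoid.mult M, one = one M,
      ring.zero = ring.zero M, add = add M, smult = (\<lambda>a x. \<phi> a \<odot>\<^bsub>M\<^esub> x)\<rparr>"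


section \<open>The Grothendieck group of finitely generated left modules\<close>

text \<open>Finitely generated modules over \<open>A\<close> form a proper class; we take those whose elements are
  sets of sequences in \<open>A\<close>.  Every finitely generated left \<open>A\<close>-module is isomorphic to one of these,
  namely to a quotient of some \<open>A\<^sup>n\<close> (lemma \<open>fg_modules_complete\<close>), and isomorphic modules have
  the same class because of the short exact sequences \<open>0 \<rightarrow> 0 \<rightarrow> M \<rightarrow> M'' \<rightarrow> 0\<close>.\<close>

definition fg_modules :: "('a, 'k) ring_scheme \<Rightarrow> ('a, (nat \<Rightarrow> 'a) set) module set" where
  "fg_modules A = {M. left_module A M \<and> finitely_generated_module A M}"

lemma fg_modules_complete:
  fixes A :: "('a, 'k) ring_scheme" and N :: "('a, 'd, 'l) module_scheme"
  assumes "left_module A N" and "finitely_generated_module A N"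
  shows "\<exists>M\<in>fg_modules A. \<exists>f\<in>left_module_hom A N M. bij_betw f (carrier N) (carrier M)"
proof -
  interpret N: left_module A N by fact
  obtain B where B: "finite B" "B \<subseteq> carrier N"
    and gen: "carrier N = {(\<Oplus>\<^bsub>N\<^esub>x\<in>B. a x \<odot>\<^bsub>N\<^esub> x) | a. a \<in> B \<rightarrow> carrier A}"
    using assms(2) unfolding finitely_generated_module_def by blast
  obtain e :: "'d \<Rightarrow> nat" where e: "inj_on e B"
    using finite_imp_inj_to_nat_seg[OF B(1)] by blast
  define i where "i m = {c :: nat \<Rightarrow> 'a. (\<forall>x\<in>B. c (e x) \<in> carrier A) \<and> (\<Oplus>\<^bsub>N\<^esub>x\<in>B. c (e x) \<odot>\<^bsub>N\<^esub> x) = m}" for m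
  have ne: "i m \<noteq> {}" if m: "m \<in> carrier N" for m
  proof -
    obtain a where a: "a \<in> B \<rightarrow> carrier A" "m = (\<Oplus>\<^bsub>N\<^esub>x\<in>B. a x \<odot>\<^bsub>N\<^esub> x)" using m gen by blast
    have "(\<Oplus>\<^bsub>N\<^esub>x\<in>B. a (inv_into B e (e x)) \<odot>\<^bsub>N\<^esub> x) = m"
      unfolding a(2) by (rule N.M.finsum_cong') (use a B e in auto)
    then have "(\<lambda>k. a (inv_into B e k)) \<in> i m" using a(1) e by (auto simp: i_def)
    then show ?thesis by blast
  qed
  have inj: "inj_on i (carrier N)"
  proof (rule inj_onI)
    fix m m' assume "m \<in> carrier N" "i m = i m'"
    then obtain c where "c \<in> i m" "c \<in> i m'" using ne by blast
    then show "m = m'" by (simp add: i_def)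
  qed
  define j where "j = inv_into (carrier N) i"
  have j [simp]: "j (i m) = m" if "m \<in> carrier N" for m using inj that by (simp add: j_def)
  define M :: "('a, (nat \<Rightarrow> 'a) set) module" where
    "M = \<lparr>carrier = i ` carrier N, monoid.mult = (\<lambda>u v. u), one = {}, ring.zero = i \<zero>\<^bsub>N\<^esub>,
          add = (\<lambda>u v. i (j u \<oplus>\<^bsub>N\<^esub> j v)), smult = (\<lambda>a u. i (a \<odot>\<^bsub>N\<^esub> j u))\<rparr>"
  have [simp]: "carrier M = i ` carrier N" "\<zero>\<^bsub>M\<^esub> = i \<zero>\<^bsub>N\<^esub>"
    "u \<oplus>\<^bsub>M\<^esub> v = i (j u \<oplus>\<^bsub>N\<^esub> j v)" "a \<odot>\<^bsub>M\<^esub> u = i (a \<odot>\<^bsub>N\<^esub> j u)" for u v a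
    by (simp_all add: M_def)
  have ab: "abelian_group M"
  proof (rule abelian_groupI)
    fix u assume "u \<in> carrier M"
    then obtain m where m: "m \<in> carrier N" "u = i m" by auto
    then have "i (\<ominus>\<^bsub>N\<^esub> m) \<in> carrier M" "i (\<ominus>\<^bsub>N\<^esub> m) \<oplus>\<^bsub>M\<^esub> u = \<zero>\<^bsub>M\<^esub>" by (simp_all add: N.M.l_neg)
    then show "\<exists>y\<in>carrier M. y \<oplus>\<^bsub>M\<^esub> u = \<zero>\<^bsub>M\<^esub>" by blast
  qed (auto simp: N.M.a_ac)
  interpret M: abelian_group M by (rule ab)
  have lm: "left_module A M"
    by unfold_locales (auto simp: N.smult_l_distr N.smult_r_distr N.smult_assoc1)
  have isum: "i (\<Oplus>\<^bsub>N\<^esub>x\<in>C. h x) = (\<Oplus>\<^bsub>M\<^esub>x\<in>C. i (h x))" if "finite C" "h \<in> C \<rightarrow> carrier N" for C :: "'d set" and h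
    using that
  proof (induction C rule: finite_induct)
    case (insert y C)
    then have "(\<Oplus>\<^bsub>N\<^esub>x\<in>C. h x) \<in> carrier N" by (intro N.M.finsum_closed) auto
    then show ?case using insert.hyps insert.prems insert.IH[symmetric] by (simp add: Pi_iff)
  qed simp
  have lin: "i (\<Oplus>\<^bsub>N\<^esub>x\<in>B. a x \<odot>\<^bsub>N\<^esub> x) = (\<Oplus>\<^bsub>M\<^esub>u\<in>i ` B. a (j u) \<odot>\<^bsub>M\<^esub> u)" if a: "a \<in> B \<rightarrow> carrier A" for a
  proof -
    have cl: "a x \<odot>\<^bsub>N\<^esub> x \<in> carrier N" "j (i x) = x" if "x \<in> B" for x using that a B by auto
    have "(\<Oplus>\<^bsub>M\<^esub>u\<in>i ` B. a (j u) \<odot>\<^bsub>M\<^esub> u) = (\<Oplus>\<^bsub>M\<^esub>x\<in>B. a (j (i x)) \<odot>\<^bsub>M\<^esub> i x)"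
      by (rule M.finsum_reindex) (use cl inj_on_subset[OF inj B(2)] in auto)
    also have "\<dots> = (\<Oplus>\<^bsub>M\<^esub>x\<in>B. i (a x \<odot>\<^bsub>N\<^esub> x))"
      by (rule M.finsum_cong') (use cl in auto)
    finally show ?thesis using isum[OF B(1), of "\<lambda>x. a x \<odot>\<^bsub>N\<^esub> x"] cl by auto
  qed
  have "finitely_generated_module A M" unfolding finitely_generated_module_def
  proof (intro exI[of _ "i ` B"] conjI equalityI subsetI)
    fix u assume "u \<in> carrier M"
    then obtain a where a: "a \<in> B \<rightarrow> carrier A" "u = i (\<Oplus>\<^bsub>N\<^esub>x\<in>B. a x \<odot>\<^bsub>N\<^esub> x)" using gen by auto
    have "(\<lambda>u. a (j u)) \<in> i ` B \<rightarrow> carrier A" using a(1) B(2) by (auto simp: Pi_iff subset_iff)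
    then show "u \<in> {(\<Oplus>\<^bsub>M\<^esub>x\<in>i ` B. a x \<odot>\<^bsub>M\<^esub> x) | a. a \<in> i ` B \<rightarrow> carrier A}"
      unfolding a(2) lin[OF a(1)] by (intro CollectI exI[of _ "\<lambda>u. a (j u)"] conjI refl)
  next
    fix u assume "u \<in> {(\<Oplus>\<^bsub>M\<^esub>x\<in>i ` B. a x \<odot>\<^bsub>M\<^esub> x) | a. a \<in> i ` B \<rightarrow> carrier A}"
    then obtain a where a: "a \<in> i ` B \<rightarrow> carrier A" "u = (\<Oplus>\<^bsub>M\<^esub>x\<in>i ` B. a x \<odot>\<^bsub>M\<^esub> x)" by blast
    have "a x \<odot>\<^bsub>M\<^esub> x \<in> carrier M" if "x \<in> i ` B" for x
      using a(1) B(2) that left_module.smult_closed[OF lm] by (auto simp: Pi_iff)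
    then show "u \<in> carrier M" unfolding a(2) by (intro M.finsum_closed) blast
  qed (use B in auto)
  then have "M \<in> fg_modules A" using lm by (simp add: fg_modules_def)
  moreover have "i \<in> left_module_hom A N M" by (simp add: left_module_hom_def)
  moreover have "bij_betw i (carrier N) (carrier M)" using inj by (simp add: bij_betw_def)
  ultimately show ?thesis by blast
qed

definition groth_relations ::
  "('a, 'k) ring_scheme \<Rightarrow> (('a, (nat \<Rightarrow> 'a) set) module \<Rightarrow>\<^sub>0 int) set" where
  "groth_relations A = generate (free_Abelian_group (fg_modules A))
     {frag_of M - (frag_of M' + frag_of M'') | M' M M''.
        M' \<in> fg_modules A \<and> M \<in> fg_modules A \<and> M'' \<in> fg_modules A \<and> short_exact A M' M M''}"

definition groth_group ::
  "('a, 'k) ring_scheme \<Rightarrow> (('a, (nat \<Rightarrow> 'a) set) module \<Rightarrow>\<^sub>0 int) set monoid" where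
  "groth_group A = free_Abelian_group (fg_modules A) Mod groth_relations A"

definition groth_class ::
  "('a, 'k) ring_scheme \<Rightarrow> ('a, (nat \<Rightarrow> 'a) set) module
    \<Rightarrow> (('a, (nat \<Rightarrow> 'a) set) module \<Rightarrow>\<^sub>0 int) set" where
  "groth_class A M = groth_relations A #>\<^bsub>free_Abelian_group (fg_modules A)\<^esub> frag_of M"

text \<open>The map \<open>G(B) \<rightarrow> G(A)\<close> that sends \<open>[M]\<close> to the class of \<open>M\<close> restricted along \<open>\<phi> : A \<rightarrow> B\<close>.  An
  element of \<open>G(B)\<close> is a coset; the union below collects the cosets of the images of its
  representatives, which all coincide (lemma \<open>groth_pullback_hom\<close>).\<close>

definition groth_pullback ::
  "('a, 'k) ring_scheme \<Rightarrow> ('a \<Rightarrow> 'a)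
    \<Rightarrow> (('a, (nat \<Rightarrow> 'a) set) module \<Rightarrow>\<^sub>0 int) set
    \<Rightarrow> (('a, (nat \<Rightarrow> 'a) set) module \<Rightarrow>\<^sub>0 int) set" where
  "groth_pullback A \<phi> C =
     (\<Union>c\<in>C. groth_relations A #>\<^bsub>free_Abelian_group (fg_modules A)\<^esub>
               frag_extend (\<lambda>M. frag_of (restrict_scalars \<phi> M)) c)"

lemma normal_groth_relations: "groth_relations A \<lhd> free_Abelian_group (fg_modules A)"
proof -
  let ?F = "free_Abelian_group (fg_modules A)"
  have "subgroup (groth_relations A) ?F"
    unfolding groth_relations_def
  proof (rule group.generate_is_subgroup[OF group_free_Abelian_group], rule subsetI, clarify)
    fix M' M M'' assume *: "M' \<in> fg_modules A" "M \<in> fg_modules A" "M'' \<in> fg_modules A"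
    have "Poly_Mapping.keys (frag_of M - (frag_of M' + frag_of M'')) \<subseteq> {M} \<union> ({M'} \<union> {M''})"
      by (intro order_trans[OF keys_diff] Un_mono order_trans[OF keys_add]) simp_all
    then show "frag_of M - (frag_of M' + frag_of M'') \<in> carrier ?F" using * by auto
  qed
  then show ?thesis by (rule comm_group.subgroup_imp_normal[OF abelian_free_Abelian_group])
qed

lemma groth_pullback_hom:
  fixes A :: "('a, 'k) ring_scheme" and B :: "('a, 'l) ring_scheme"
  assumes \<phi>: "\<phi> \<in> carrier A \<rightarrow> carrier B"
    and fg: "\<And>M. M \<in> fg_modules B \<Longrightarrow> restrict_scalars \<phi> M \<in> fg_modules A"
  shows "groth_pullback A \<phi> \<in> hom (groth_group B) (groth_group A)"
    and "M \<in> fg_modules B \<Longrightarrow> groth_pullback A \<phi> (groth_class B M) = groth_class A (restrict_scalars \<phi> M)"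
proof -
  let ?FA = "free_Abelian_group (fg_modules A)" and ?FB = "free_Abelian_group (fg_modules B)"
  let ?RA = "groth_relations A" and ?RB = "groth_relations B"
  interpret A: normal ?RA ?FA by (rule normal_groth_relations)
  interpret B: normal ?RB ?FB by (rule normal_groth_relations)
  define T where "T = frag_extend (\<lambda>M :: ('a, (nat \<Rightarrow> 'a) set) module. frag_of (restrict_scalars \<phi> M))"
  have Tcl: "T c \<in> carrier ?FA" if "c \<in> carrier ?FB" for c
    using that fg keys_frag_extend[of "\<lambda>M :: ('a, (nat \<Rightarrow> 'a) set) module. frag_of (restrict_scalars \<phi> M)" c]
    by (fastforce simp: T_def)
  have Tadd: "T (c + d) = T c + T d" for c d by (simp add: T_def frag_extend_add)
  have se: "short_exact A (restrict_scalars \<phi> M') (restrict_scalars \<phi> M) (restrict_scalars \<phi> M'')"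
    if exact: "short_exact B M' M M''" for M' M M'' :: "('a, (nat \<Rightarrow> 'a) set) module"
  proof -
    have *: "f \<in> left_module_hom A (restrict_scalars \<phi> M) (restrict_scalars \<phi> N)"
      if "f \<in> left_module_hom B M N" for f and M N :: "('a, (nat \<Rightarrow> 'a) set) module"
      using that \<phi> by (simp add: left_module_hom_def restrict_scalars_def Pi_iff)
    from exact[unfolded short_exact_def] obtain f where f: "f \<in> left_module_hom B M' M"
      and "\<exists>g \<in> left_module_hom B M M''. inj_on f (carrier M') \<and>
        f ` carrier M' = {x \<in> carrier M. g x = \<zero>\<^bsub>M''\<^esub>} \<and> g ` carrier M = carrier M''"
      by (rule bexE)
    from this(2) obtain g where g: "g \<in> left_module_hom B M M''" and
      "inj_on f (carrier M') \<and> f ` carrier M' = {x \<in> carrier M. g x = \<zero>\<^bsub>M''\<^esub>} \<and>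
        g ` carrier M = carrier M''" by (rule bexE)
    then show ?thesis unfolding short_exact_def
      by (intro bexI[OF _ *[OF f]] bexI[OF _ *[OF g]]) (simp add: restrict_scalars_def)
  qed
  have Trel: "T r \<in> ?RA" if "r \<in> ?RB" for r
    using that[unfolded groth_relations_def]
  proof (induction r rule: generate.induct)
    case one
    then show ?case using subgroup.one_closed[OF A.subgroup_axioms] by (simp add: T_def)
  next
    case (incl h)
    then obtain M' M M'' where h: "h = frag_of M - (frag_of M' + frag_of M'')"
      and m: "M' \<in> fg_modules B" "M \<in> fg_modules B" "M'' \<in> fg_modules B" "short_exact B M' M M''" by blast
    have "T h = frag_of (restrict_scalars \<phi> M) - (frag_of (restrict_scalars \<phi> M') + frag_of (restrict_scalars \<phi> M''))"
      by (simp add: h T_def frag_extend_add frag_extend_diff)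
    also have "\<dots> \<in> ?RA" unfolding groth_relations_def
      by (rule generate.incl, rule CollectI, intro exI conjI, rule refl) (simp_all add: m fg se)
    finally show ?case .
  next
    case (inv h)
    then obtain M' M M'' where h: "h = frag_of M - (frag_of M' + frag_of M'')"
      and m: "M' \<in> fg_modules B" "M \<in> fg_modules B" "M'' \<in> fg_modules B" "short_exact B M' M M''" by blast
    have "T h = frag_of (restrict_scalars \<phi> M) - (frag_of (restrict_scalars \<phi> M') + frag_of (restrict_scalars \<phi> M''))"
      by (simp add: h T_def frag_extend_add frag_extend_diff)
    also have "\<dots> \<in> ?RA" unfolding groth_relations_def
      by (rule generate.incl, rule CollectI, intro exI conjI, rule refl) (simp_all add: m fg se)
    finally have Th: "T h \<in> ?RA" .
    have "h \<in> ?RB" unfolding groth_relations_def by (rule generate.incl) (rule inv)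
    then have "Poly_Mapping.keys h \<subseteq> fg_modules B" using subsetD[OF B.subset] carrier_free_Abelian_group_iff by metis
    moreover have "Poly_Mapping.keys (T h) \<subseteq> fg_modules A" using Th subsetD[OF A.subset] carrier_free_Abelian_group_iff by metis
    ultimately show ?case using subgroup.m_inv_closed[OF A.subgroup_axioms Th] by (simp add: T_def frag_extend_minus)
  next
    case (eng h k)
    then show ?case using subgroup.m_closed[OF A.subgroup_axioms, of "T h" "T k"] by (simp add: Tadd)
  qed
  have key: "groth_pullback A \<phi> (?RB #>\<^bsub>?FB\<^esub> c) = ?RA #>\<^bsub>?FA\<^esub> T c" if c: "c \<in> carrier ?FB" for c
  proof -
    have "?RA #>\<^bsub>?FA\<^esub> T d = ?RA #>\<^bsub>?FA\<^esub> T c" if d: "d \<in> ?RB #>\<^bsub>?FB\<^esub> c" for d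
    proof -
      obtain r where r: "r \<in> ?RB" "d = r + c" using d by (auto simp: r_coset_def)
      have "T d \<in> ?RA #>\<^bsub>?FA\<^esub> T c" using Trel[OF r(1)] by (auto simp: r_coset_def r(2) Tadd)
      then show ?thesis using A.repr_independence[OF _ Tcl[OF c] A.subgroup_axioms] by simp
    qed
    moreover have "c \<in> ?RB #>\<^bsub>?FB\<^esub> c" using B.rcos_self[OF c B.subgroup_axioms] .
    ultimately show ?thesis unfolding groth_pullback_def T_def[symmetric] by blast
  qed
  show "groth_pullback A \<phi> \<in> hom (groth_group B) (groth_group A)"
  proof (rule homI)
    fix C assume "C \<in> carrier (groth_group B)"
    then obtain c where c: "c \<in> carrier ?FB" "C = ?RB #>\<^bsub>?FB\<^esub> c"
      unfolding groth_group_def carrier_FactGroup by blast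
    show "groth_pullback A \<phi> C \<in> carrier (groth_group A)"
      unfolding groth_group_def carrier_FactGroup c(2) key[OF c(1)] using Tcl[OF c(1)] by blast
  next
    fix C D assume "C \<in> carrier (groth_group B)" "D \<in> carrier (groth_group B)"
    then obtain c d where c: "c \<in> carrier ?FB" "C = ?RB #>\<^bsub>?FB\<^esub> c"
      and d: "d \<in> carrier ?FB" "D = ?RB #>\<^bsub>?FB\<^esub> d"
      unfolding groth_group_def carrier_FactGroup by blast
    show "groth_pullback A \<phi> (C \<otimes>\<^bsub>groth_group B\<^esub> D) =
      groth_pullback A \<phi> C \<otimes>\<^bsub>groth_group A\<^esub> groth_pullback A \<phi> D"
      using B.rcos_sum[OF c(1) d(1)] A.rcos_sum[OF Tcl[OF c(1)] Tcl[OF d(1)]] key[OF B.m_closed[OF c(1) d(1)]]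
      by (simp add: groth_group_def c(2) d(2) key[OF c(1)] key[OF d(1)] Tadd)
  qed
  show "groth_pullback A \<phi> (groth_class B M) = groth_class A (restrict_scalars \<phi> M)" if "M \<in> fg_modules B"
    using key[of "frag_of M"] that by (simp add: groth_class_def T_def)
qed


section \<open>Families of finite subgroups and the inverse limit\<close>

definition finite_subgroups :: "('g, 'n) monoid_scheme \<Rightarrow> 'g set set" where
  "finite_subgroups \<Gamma> = {H. subgroup H \<Gamma> \<and> finite H}"

definition conj_map :: "('g, 'n) monoid_scheme \<Rightarrow> 'g \<Rightarrow> 'g \<Rightarrow> 'g" where
  "conj_map \<Gamma> \<gamma> h = \<gamma> \<otimes>\<^bsub>\<Gamma>\<^esub> h \<otimes>\<^bsub>\<Gamma>\<^esub> inv\<^bsub>\<Gamma>\<^esub> \<gamma>"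

definition finitely_many_finite_subgroups_up_to_conj :: "('g, 'n) monoid_scheme \<Rightarrow> bool" where
  "finitely_many_finite_subgroups_up_to_conj \<Gamma> \<longleftrightarrow>
     finite ((\<lambda>H. {conj_map \<Gamma> \<gamma> ` H | \<gamma>. \<gamma> \<in> carrier \<Gamma>}) ` finite_subgroups \<Gamma>)"

definition family_of_finite_subgroups :: "('g, 'n) monoid_scheme \<Rightarrow> 'g set set \<Rightarrow> bool" where
  "family_of_finite_subgroups \<Gamma> F \<longleftrightarrow>
     F \<noteq> {} \<and> F \<subseteq> finite_subgroups \<Gamma> \<and>
     (\<forall>H\<in>F. \<forall>\<gamma>\<in>carrier \<Gamma>. conj_map \<Gamma> \<gamma> ` H \<in> F) \<and>
     (\<forall>K\<in>F. \<forall>H. subgroup H \<Gamma> \<and> H \<subseteq> K \<longrightarrow> H \<in> F)"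

abbreviation subgroup_ring ::
  "('r, 'm) ring_scheme \<Rightarrow> ('g, 'n) monoid_scheme \<Rightarrow> 'g set \<Rightarrow> ('g \<Rightarrow> 'r) ring" where
  "subgroup_ring R \<Gamma> H \<equiv> group_ring R (\<Gamma>\<lparr>carrier := H\<rparr>)"

text \<open>For a homomorphism \<open>\<phi> : H \<rightarrow> K\<close> between subgroups of \<open>\<Gamma>\<close>, the map \<open>\<phi>\<^sup>* : G(R[K]) \<rightarrow> G(R[H])\<close>.\<close>

definition subgroup_groth_pullback ::
  "('r, 'm) ring_scheme \<Rightarrow> ('g, 'n) monoid_scheme \<Rightarrow> 'g set \<Rightarrow> 'g set \<Rightarrow> ('g \<Rightarrow> 'g)
    \<Rightarrow> (('g \<Rightarrow> 'r, (nat \<Rightarrow> 'g \<Rightarrow> 'r) set) module \<Rightarrow>\<^sub>0 int) set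
    \<Rightarrow> (('g \<Rightarrow> 'r, (nat \<Rightarrow> 'g \<Rightarrow> 'r) set) module \<Rightarrow>\<^sub>0 int) set" where
  "subgroup_groth_pullback R \<Gamma> H K \<phi> =
     groth_pullback (subgroup_ring R \<Gamma> H)
       (group_ring_map R (\<Gamma>\<lparr>carrier := H\<rparr>) (\<Gamma>\<lparr>carrier := K\<rparr>) \<phi>)"

definition family_groth_group ::
  "('r, 'm) ring_scheme \<Rightarrow> ('g, 'n) monoid_scheme \<Rightarrow> 'g set set
    \<Rightarrow> ('g set \<Rightarrow> (('g \<Rightarrow> 'r, (nat \<Rightarrow> 'g \<Rightarrow> 'r) set) module \<Rightarrow>\<^sub>0 int) set) monoid" where
  "family_groth_group R \<Gamma> F =
     (let P = product_group F (\<lambda>H. groth_group (subgroup_ring R \<Gamma> H)) in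
      P\<lparr>carrier := {x \<in> carrier P.
        (\<forall>H\<in>F. \<forall>K\<in>F. H \<subseteq> K \<longrightarrow> subgroup_groth_pullback R \<Gamma> H K (\<lambda>h. h) (x K) = x H) \<and>
        (\<forall>H\<in>F. \<forall>K\<in>F. \<forall>\<gamma>\<in>carrier \<Gamma>. K = conj_map \<Gamma> \<gamma> ` H \<longrightarrow>
            subgroup_groth_pullback R \<Gamma> H K (conj_map \<Gamma> \<gamma>) (x K) = x H)}\<rparr>)"

definition minimal_condition_on_ideals :: "('r, 'm) ring_scheme \<Rightarrow> bool" where
  "minimal_condition_on_ideals R \<longleftrightarrow>
     (\<forall>\<I>. \<I> \<noteq> {} \<and> (\<forall>I\<in>\<I>. ideal I R) \<longrightarrow> (\<exists>I\<in>\<I>. \<forall>J\<in>\<I>. J \<subseteq> I \<longrightarrow> J = I))"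

lemma minimal_condition_iff_no_descending_chain:
  "minimal_condition_on_ideals R \<longleftrightarrow>
     \<not> (\<exists>I :: nat \<Rightarrow> 'r set. \<forall>n. ideal (I n) R \<and> I (Suc n) \<subset> I n)" for R :: "('r, 'm) ring_scheme"
proof
  assume m: "minimal_condition_on_ideals R"
  show "\<not> (\<exists>I :: nat \<Rightarrow> 'r set. \<forall>n. ideal (I n) R \<and> I (Suc n) \<subset> I n)"
  proof
    assume "\<exists>I :: nat \<Rightarrow> 'r set. \<forall>n. ideal (I n) R \<and> I (Suc n) \<subset> I n"
    then obtain I :: "nat \<Rightarrow> 'r set" where I: "\<And>n. ideal (I n) R" "\<And>n. I (Suc n) \<subset> I n" by blast
    have "\<exists>K\<in>range I. \<forall>J\<in>range I. J \<subseteq> K \<longrightarrow> J = K"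
      using m[unfolded minimal_condition_on_ideals_def, rule_format, of "range I"] I(1) by simp
    then obtain n where n: "\<And>k. I k \<subseteq> I n \<Longrightarrow> I k = I n" by auto
    show False using I(2)[of n] n[of "Suc n"] by (simp add: psubset_eq)
  qed
next
  assume nc: "\<not> (\<exists>I :: nat \<Rightarrow> 'r set. \<forall>n. ideal (I n) R \<and> I (Suc n) \<subset> I n)"
  show "minimal_condition_on_ideals R"
    unfolding minimal_condition_on_ideals_def
  proof (intro allI impI, elim conjE, rule ccontr)
    fix Q :: "'r set set" assume Q: "Q \<noteq> {}" and i: "\<forall>I\<in>Q. ideal I R"
      and n: "\<not> (\<exists>I\<in>Q. \<forall>J\<in>Q. J \<subseteq> I \<longrightarrow> J = I)"
    have "\<exists>f :: nat \<Rightarrow> 'r set. \<forall>n. f n \<in> Q \<and> f (Suc n) \<subset> f n"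
    proof (rule dependent_nat_choice)
      show "\<exists>x. x \<in> Q" using Q by (simp add: ex_in_conv)
      show "\<exists>y. y \<in> Q \<and> y \<subset> x" if xQ: "x \<in> Q" for x and k :: nat
      proof -
        obtain J where "J \<in> Q" "J \<subseteq> x" "J \<noteq> x" using xQ n by blast
        then show ?thesis by (intro exI[of _ J]) (simp add: psubset_eq)
      qed
    qed
    then obtain f where "\<And>n :: nat. f n \<in> Q" "\<And>n. f (Suc n) \<subset> f n" by metis
    then have "\<forall>n. ideal (f n) R \<and> f (Suc n) \<subset> f n" using i by simp
    then show False using nc by metis
  qed
qed

definition free_abelian_of_finite_rank :: "('a, 'm) monoid_scheme \<Rightarrow> bool" where
  "free_abelian_of_finite_rank G \<longleftrightarrow> (\<exists>n::nat. G \<cong> free_Abelian_group {..<n})"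

end

theory Submission
  imports Defs
begin

text \<open>
  By Akizuki's theorem \<open>S\<close> has finite length as a module over itself, hence so has every finitely
  generated \<open>S\<close>-module, in particular every finitely generated \<open>S[H]\<close>-module for a finite group \<open>H\<close>.
  By Jordan--Hoelder the multiplicities of the finitely many simple \<open>S[H]\<close>-modules embed \<open>G(S[H])\<close>
  into some \<open>\<int>\<^sup>n\<close>.  The conjugation condition makes a compatible family determined by its
  components at finitely many \<open>H\<close>, so that the inverse limit is a subgroup of some \<open>\<int>\<^sup>N\<close>.
\<close>

section \<open>Submodules and chain conditions\<close>

text \<open>Composition series need both chain conditions: the ascending one provides a maximal
  proper submodule, hence a simple quotient, and the descending one makes the descent through such
  submodules end. The hypothesis on \<open>S\<close> gives only the second, which is why Akizuki's
  theorem has to come in. Chain conditions are expressed as well-foundedness of strict inclusion of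
  submodules. A module built from a submodule and a remaining piece of data is then handled by a
  lexicographic product of well-founded relations, and no quotient module is formed for that
  purpose. The embeddings of the groups \<open>G(S[H])\<close> enter only through additivity and
  injectivity: the transition maps are homomorphisms, so that the limit is a subgroup of the
  product, and subgroups of free abelian groups of finite rank are again free of finite rank. What
  restriction and conjugation do to the individual simple modules is never computed.\<close>

definition submod :: "('a, 'k) ring_scheme \<Rightarrow> ('a, 'c, 'l) module_scheme \<Rightarrow> 'c set \<Rightarrow> bool" where
  "submod A M N \<longleftrightarrow> N \<subseteq> carrier M \<and> \<zero>\<^bsub>M\<^esub> \<in> N \<and>
     (\<forall>x\<in>N. \<forall>y\<in>N. x \<oplus>\<^bsub>M\<^esub> y \<in> N) \<and> (\<forall>a\<in>carrier A. \<forall>x\<in>N. a \<odot>\<^bsub>M\<^esub> x \<in> N)"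

lemma submodI:
  assumes "N \<subseteq> carrier M" "\<zero>\<^bsub>M\<^esub> \<in> N" "\<And>x y. x \<in> N \<Longrightarrow> y \<in> N \<Longrightarrow> x \<oplus>\<^bsub>M\<^esub> y \<in> N"
    "\<And>a x. a \<in> carrier A \<Longrightarrow> x \<in> N \<Longrightarrow> a \<odot>\<^bsub>M\<^esub> x \<in> N"
  shows "submod A M N"
  using assms by (simp add: submod_def)

lemma submod_subset: "submod A M N \<Longrightarrow> N \<subseteq> carrier M"
  and submod_carrier: "submod A M N \<Longrightarrow> x \<in> N \<Longrightarrow> x \<in> carrier M"
  and submod_zero: "submod A M N \<Longrightarrow> \<zero>\<^bsub>M\<^esub> \<in> N"
  and submod_add: "submod A M N \<Longrightarrow> x \<in> N \<Longrightarrow> y \<in> N \<Longrightarrow> x \<oplus>\<^bsub>M\<^esub> y \<in> N"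
  and submod_smult: "submod A M N \<Longrightarrow> a \<in> carrier A \<Longrightarrow> x \<in> N \<Longrightarrow> a \<odot>\<^bsub>M\<^esub> x \<in> N"
  by (auto simp: submod_def)

lemma submod_Int: "submod A M N \<Longrightarrow> submod A M P \<Longrightarrow> submod A M (N \<inter> P)"
  by (auto simp: submod_def)

lemma submod_sub_iff:
  assumes "submod A M N"
  shows "submod A (M\<lparr>carrier := N\<rparr>) P \<longleftrightarrow> submod A M P \<and> P \<subseteq> N"
  using submod_subset[OF assms] by (auto simp: submod_def)

context left_module
begin

lemma smult_l_null [simp]:
  assumes x: "x \<in> carrier M"
  shows "\<zero>\<^bsub>A\<^esub> \<odot>\<^bsub>M\<^esub> x = \<zero>\<^bsub>M\<^esub>"
proof -
  have "\<zero>\<^bsub>A\<^esub> \<odot>\<^bsub>M\<^esub> x \<oplus>\<^bsub>M\<^esub> \<zero>\<^bsub>A\<^esub> \<odot>\<^bsub>M\<^esub> x = \<zero>\<^bsub>A\<^esub> \<odot>\<^bsub>M\<^esub> x"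
    using smult_l_distr[of "\<zero>\<^bsub>A\<^esub>" "\<zero>\<^bsub>A\<^esub>" x] x by simp
  then show ?thesis using x by (metis M.add.r_cancel_one' A.zero_closed smult_closed)
qed

lemma smult_r_null [simp]:
  assumes a: "a \<in> carrier A"
  shows "a \<odot>\<^bsub>M\<^esub> \<zero>\<^bsub>M\<^esub> = \<zero>\<^bsub>M\<^esub>"
proof -
  have "a \<odot>\<^bsub>M\<^esub> \<zero>\<^bsub>M\<^esub> \<oplus>\<^bsub>M\<^esub> a \<odot>\<^bsub>M\<^esub> \<zero>\<^bsub>M\<^esub> = a \<odot>\<^bsub>M\<^esub> \<zero>\<^bsub>M\<^esub>"
    using smult_r_distr[of a "\<zero>\<^bsub>M\<^esub>" "\<zero>\<^bsub>M\<^esub>"] a by simp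
  then show ?thesis using a by (metis M.add.r_cancel_one' M.zero_closed smult_closed)
qed

lemma smult_l_minus:
  assumes "a \<in> carrier A" "x \<in> carrier M"
  shows "(\<ominus>\<^bsub>A\<^esub> a) \<odot>\<^bsub>M\<^esub> x = \<ominus>\<^bsub>M\<^esub> (a \<odot>\<^bsub>M\<^esub> x)"
proof -
  have "(\<ominus>\<^bsub>A\<^esub> a) \<odot>\<^bsub>M\<^esub> x \<oplus>\<^bsub>M\<^esub> a \<odot>\<^bsub>M\<^esub> x = \<zero>\<^bsub>M\<^esub>"
    using assms by (simp add: smult_l_distr[symmetric] A.l_neg)
  then show ?thesis using assms by (simp add: M.minus_equality)
qed

lemma smult_minus_one: "x \<in> carrier M \<Longrightarrow> (\<ominus>\<^bsub>A\<^esub> \<one>\<^bsub>A\<^esub>) \<odot>\<^bsub>M\<^esub> x = \<ominus>\<^bsub>M\<^esub> x"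
  by (simp add: smult_l_minus)

text \<open>Negation is multiplication by the scalar minus one, so the closure conditions in
  \<open>submod\<close> already give subgroups.\<close>

lemma submod_a_inv: "submod A M N \<Longrightarrow> x \<in> N \<Longrightarrow> \<ominus>\<^bsub>M\<^esub> x \<in> N"
  using submod_smult[of A M N "\<ominus>\<^bsub>A\<^esub> \<one>\<^bsub>A\<^esub>" x] submod_carrier[of A M N x] by (simp add: smult_minus_one)

lemma submod_diff: "submod A M N \<Longrightarrow> x \<in> N \<Longrightarrow> y \<in> N \<Longrightarrow> x \<ominus>\<^bsub>M\<^esub> y \<in> N"
  by (simp add: a_minus_def submod_a_inv submod_add)

lemma diff_add_cancel: "x \<in> carrier M \<Longrightarrow> y \<in> carrier M \<Longrightarrow> (x \<ominus>\<^bsub>M\<^esub> y) \<oplus>\<^bsub>M\<^esub> y = x"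
  by (simp add: a_minus_def M.a_assoc M.l_neg)

lemma add_diff_cancel: "x \<in> carrier M \<Longrightarrow> y \<in> carrier M \<Longrightarrow> (x \<oplus>\<^bsub>M\<^esub> y) \<ominus>\<^bsub>M\<^esub> y = x"
  by (simp add: a_minus_def M.a_assoc M.r_neg)

lemma diff_eq_zero_iff: "x \<in> carrier M \<Longrightarrow> y \<in> carrier M \<Longrightarrow> x \<ominus>\<^bsub>M\<^esub> y = \<zero>\<^bsub>M\<^esub> \<longleftrightarrow> x = y"
  by (metis M.l_zero M.r_neg a_minus_def diff_add_cancel)

lemma submod_mem_add_cancel:
  assumes "submod A M N" "y \<in> N" "x \<in> carrier M"
  shows "x \<oplus>\<^bsub>M\<^esub> y \<in> N \<longleftrightarrow> x \<in> N"
  using assms submod_diff[of N "x \<oplus>\<^bsub>M\<^esub> y" y]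
  by (auto simp: add_diff_cancel submod_add dest: submod_carrier)

lemma submod_self: "submod A M (carrier M)"
  by (rule submodI) auto

lemma submod_null: "submod A M {\<zero>\<^bsub>M\<^esub>}"
  by (rule submodI) auto

lemma left_module_sub:
  assumes N: "submod A M N"
  shows "left_module A (M\<lparr>carrier := N\<rparr>)"
proof -
  note c = submod_carrier[OF N]
  have "abelian_group (M\<lparr>carrier := N\<rparr>)"
  proof (rule abelian_groupI)
    fix x assume "x \<in> carrier (M\<lparr>carrier := N\<rparr>)"
    then show "\<exists>y\<in>carrier (M\<lparr>carrier := N\<rparr>). y \<oplus>\<^bsub>M\<lparr>carrier := N\<rparr>\<^esub> x = \<zero>\<^bsub>M\<lparr>carrier := N\<rparr>\<^esub>"
      using submod_a_inv[OF N] c M.l_neg by auto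
  qed (auto simp: submod_zero[OF N] submod_add[OF N] c M.a_ac)
  then show ?thesis
    by (intro left_module.intro A.ring_axioms left_module_axioms.intro)
      (auto simp: submod_smult[OF N] c smult_l_distr smult_r_distr smult_assoc1)
qed

text \<open>The set is the sum of \<open>N\<close> and the cyclic submodule of \<open>b\<close>,
  with the sign of the coefficient absorbed into \<open>a\<close>.\<close>

lemma submod_adjoin:
  assumes N: "submod A M N" and b: "b \<in> carrier M"
  shows "submod A M {x \<in> carrier M. \<exists>a\<in>carrier A. x \<oplus>\<^bsub>M\<^esub> a \<odot>\<^bsub>M\<^esub> b \<in> N}"
proof (rule submodI)
  fix x y
  assume "x \<in> {x \<in> carrier M. \<exists>a\<in>carrier A. x \<oplus>\<^bsub>M\<^esub> a \<odot>\<^bsub>M\<^esub> b \<in> N}"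
    and "y \<in> {x \<in> carrier M. \<exists>a\<in>carrier A. x \<oplus>\<^bsub>M\<^esub> a \<odot>\<^bsub>M\<^esub> b \<in> N}"
  then obtain a a' where *: "x \<in> carrier M" "y \<in> carrier M" "a \<in> carrier A" "a' \<in> carrier A"
    "x \<oplus>\<^bsub>M\<^esub> a \<odot>\<^bsub>M\<^esub> b \<in> N" "y \<oplus>\<^bsub>M\<^esub> a' \<odot>\<^bsub>M\<^esub> b \<in> N" by blast
  have "(x \<oplus>\<^bsub>M\<^esub> y) \<oplus>\<^bsub>M\<^esub> (a \<oplus>\<^bsub>A\<^esub> a') \<odot>\<^bsub>M\<^esub> b = (x \<oplus>\<^bsub>M\<^esub> a \<odot>\<^bsub>M\<^esub> b) \<oplus>\<^bsub>M\<^esub> (y \<oplus>\<^bsub>M\<^esub> a' \<odot>\<^bsub>M\<^esub> b)"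
    using * b by (simp add: smult_l_distr M.a_ac)
  then show "x \<oplus>\<^bsub>M\<^esub> y \<in> {x \<in> carrier M. \<exists>a\<in>carrier A. x \<oplus>\<^bsub>M\<^esub> a \<odot>\<^bsub>M\<^esub> b \<in> N}"
    using * submod_add[OF N *(5,6)] by (auto intro!: bexI[of _ "a \<oplus>\<^bsub>A\<^esub> a'"])
next
  fix c x assume c: "c \<in> carrier A" and "x \<in> {x \<in> carrier M. \<exists>a\<in>carrier A. x \<oplus>\<^bsub>M\<^esub> a \<odot>\<^bsub>M\<^esub> b \<in> N}"
  then obtain a where *: "x \<in> carrier M" "a \<in> carrier A" "x \<oplus>\<^bsub>M\<^esub> a \<odot>\<^bsub>M\<^esub> b \<in> N" by blast
  have "c \<odot>\<^bsub>M\<^esub> x \<oplus>\<^bsub>M\<^esub> (c \<otimes>\<^bsub>A\<^esub> a) \<odot>\<^bsub>M\<^esub> b = c \<odot>\<^bsub>M\<^esub> (x \<oplus>\<^bsub>M\<^esub> a \<odot>\<^bsub>M\<^esub> b)"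
    using * b c by (simp add: smult_r_distr smult_assoc1)
  then show "c \<odot>\<^bsub>M\<^esub> x \<in> {x \<in> carrier M. \<exists>a\<in>carrier A. x \<oplus>\<^bsub>M\<^esub> a \<odot>\<^bsub>M\<^esub> b \<in> N}"
    using * c submod_smult[OF N c *(3)] by (auto intro!: bexI[of _ "c \<otimes>\<^bsub>A\<^esub> a"])
qed (use b submod_zero[OF N] in \<open>auto intro!: bexI[of _ "\<zero>\<^bsub>A\<^esub>"]\<close>)

lemma submod_adjoin_superset:
  assumes N: "submod A M N" and b: "b \<in> carrier M"
  shows "N \<subseteq> {x \<in> carrier M. \<exists>a\<in>carrier A. x \<oplus>\<^bsub>M\<^esub> a \<odot>\<^bsub>M\<^esub> b \<in> N}"
    and "b \<in> {x \<in> carrier M. \<exists>a\<in>carrier A. x \<oplus>\<^bsub>M\<^esub> a \<odot>\<^bsub>M\<^esub> b \<in> N}"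
proof -
  show "N \<subseteq> {x \<in> carrier M. \<exists>a\<in>carrier A. x \<oplus>\<^bsub>M\<^esub> a \<odot>\<^bsub>M\<^esub> b \<in> N}"
    using b submod_carrier[OF N] by (auto intro!: bexI[of _ "\<zero>\<^bsub>A\<^esub>"])
  show "b \<in> {x \<in> carrier M. \<exists>a\<in>carrier A. x \<oplus>\<^bsub>M\<^esub> a \<odot>\<^bsub>M\<^esub> b \<in> N}"
    using b submod_zero[OF N] by (auto intro!: bexI[of _ "\<ominus>\<^bsub>A\<^esub> \<one>\<^bsub>A\<^esub>"] simp: smult_minus_one M.r_neg)
qed

lemma submod_finsum:
  assumes N: "submod A M N" and "finite B" "\<And>x. x \<in> B \<Longrightarrow> f x \<in> N"
  shows "(\<Oplus>\<^bsub>M\<^esub>x\<in>B. f x) \<in> N"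
  using assms(2,3)
proof (induction B rule: finite_induct)
  case (insert x B)
  then have "f \<in> B \<rightarrow> carrier M" "f x \<in> carrier M" using submod_carrier[OF N] by auto
  then show ?case using insert by (simp add: submod_add[OF N])
qed (simp add: submod_zero[OF N])

text \<open>The linear combinations of \<open>B\<close> form a submodule containing
  \<open>B\<close>, so they exhaust \<open>M\<close> exactly when no proper submodule contains
  \<open>B\<close>. Later arguments about generators use this form, which spares them finite
  sums.\<close>

lemma finitely_generated_iff:
  "finitely_generated_module A M \<longleftrightarrow>
    (\<exists>B. finite B \<and> B \<subseteq> carrier M \<and> (\<forall>N. submod A M N \<and> B \<subseteq> N \<longrightarrow> N = carrier M))"
proof -
  have eq: "carrier M = {(\<Oplus>\<^bsub>M\<^esub>x\<in>B. a x \<odot>\<^bsub>M\<^esub> x) | a. a \<in> B \<rightarrow> carrier A} \<longleftrightarrow>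
      (\<forall>N. submod A M N \<and> B \<subseteq> N \<longrightarrow> N = carrier M)" (is "_ = ?S \<longleftrightarrow> ?R")
    if B: "finite B" "B \<subseteq> carrier M" for B
  proof
    assume c: "carrier M = ?S"
    show ?R
    proof (intro allI impI equalityI subsetI)
      fix N x assume N: "submod A M N \<and> B \<subseteq> N" and "x \<in> carrier M"
      then obtain a where a: "a \<in> B \<rightarrow> carrier A" "x = (\<Oplus>\<^bsub>M\<^esub>x\<in>B. a x \<odot>\<^bsub>M\<^esub> x)" using c by blast
      show "x \<in> N" unfolding a(2)
        by (rule submod_finsum) (use N B a(1) submod_smult in \<open>auto simp: subset_iff Pi_iff intro: submod_smult\<close>)
    qed (auto dest: submod_carrier)
  next
    assume R: ?R
    have cl: "(\<lambda>x. a x \<odot>\<^bsub>M\<^esub> x) \<in> B \<rightarrow> carrier M" if "a \<in> B \<rightarrow> carrier A" for a using that B by auto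
    have "submod A M ?S"
    proof (rule submodI)
      show "?S \<subseteq> carrier M" using cl by (auto intro!: M.finsum_closed)
      have "(\<Oplus>\<^bsub>M\<^esub>x\<in>B. \<zero>\<^bsub>A\<^esub> \<odot>\<^bsub>M\<^esub> x) = \<zero>\<^bsub>M\<^esub>" by (rule M.add.finprod_one_eqI) (use B in auto)
      then have "\<zero>\<^bsub>M\<^esub> = (\<Oplus>\<^bsub>M\<^esub>x\<in>B. \<zero>\<^bsub>A\<^esub> \<odot>\<^bsub>M\<^esub> x)" by simp
      then show "\<zero>\<^bsub>M\<^esub> \<in> ?S" by (intro CollectI exI[of _ "\<lambda>x. \<zero>\<^bsub>A\<^esub>"]) auto
    next
      fix u v assume "u \<in> ?S" "v \<in> ?S"
      then obtain a c where a: "a \<in> B \<rightarrow> carrier A" "u = (\<Oplus>\<^bsub>M\<^esub>x\<in>B. a x \<odot>\<^bsub>M\<^esub> x)"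
        and c: "c \<in> B \<rightarrow> carrier A" "v = (\<Oplus>\<^bsub>M\<^esub>x\<in>B. c x \<odot>\<^bsub>M\<^esub> x)" by blast
      have "u \<oplus>\<^bsub>M\<^esub> v = (\<Oplus>\<^bsub>M\<^esub>x\<in>B. a x \<odot>\<^bsub>M\<^esub> x \<oplus>\<^bsub>M\<^esub> c x \<odot>\<^bsub>M\<^esub> x)"
        unfolding a(2) c(2) by (rule M.finsum_addf[symmetric]) (use a c cl in auto)
      also have "\<dots> = (\<Oplus>\<^bsub>M\<^esub>x\<in>B. (a x \<oplus>\<^bsub>A\<^esub> c x) \<odot>\<^bsub>M\<^esub> x)"
        by (rule M.finsum_cong') (use a c B in \<open>auto simp: smult_l_distr Pi_iff subset_iff\<close>)
      finally show "u \<oplus>\<^bsub>M\<^esub> v \<in> ?S"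
        by (intro CollectI exI[of _ "\<lambda>x. a x \<oplus>\<^bsub>A\<^esub> c x"]) (use a c in auto)
    next
      fix d u assume d: "d \<in> carrier A" and "u \<in> ?S"
      then obtain a where a: "a \<in> B \<rightarrow> carrier A" "u = (\<Oplus>\<^bsub>M\<^esub>x\<in>B. a x \<odot>\<^bsub>M\<^esub> x)" by blast
      have "d \<odot>\<^bsub>M\<^esub> (\<Oplus>\<^bsub>M\<^esub>x\<in>C. a x \<odot>\<^bsub>M\<^esub> x) = (\<Oplus>\<^bsub>M\<^esub>x\<in>C. (d \<otimes>\<^bsub>A\<^esub> a x) \<odot>\<^bsub>M\<^esub> x)" if "C \<subseteq> B" for C
        using finite_subset[OF that B(1)] that
      proof (induction C rule: finite_induct)
        case (insert x C)
        then have *: "(\<lambda>x. a x \<odot>\<^bsub>M\<^esub> x) \<in> C \<rightarrow> carrier M" "a x \<in> carrier A" "x \<in> carrier M"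
          "(\<lambda>x. (d \<otimes>\<^bsub>A\<^esub> a x) \<odot>\<^bsub>M\<^esub> x) \<in> C \<rightarrow> carrier M"
          using a(1) B d by (auto simp: Pi_iff subset_iff)
        have cc: "(\<Oplus>\<^bsub>M\<^esub>x\<in>C. a x \<odot>\<^bsub>M\<^esub> x) \<in> carrier M" using *(1) by (rule M.finsum_closed)
        show ?case using insert * d cc by (simp add: smult_r_distr smult_assoc1)
      qed (use d in simp)
      from this[OF subset_refl] show "d \<odot>\<^bsub>M\<^esub> u \<in> ?S" unfolding a(2)
        by (intro CollectI exI[of _ "\<lambda>x. d \<otimes>\<^bsub>A\<^esub> a x"]) (use a d in auto)
    qed
    moreover have "B \<subseteq> ?S"
    proof
      fix b assume b: "b \<in> B"
      have "(\<Oplus>\<^bsub>M\<^esub>x\<in>B. (if b = x then \<one>\<^bsub>A\<^esub> else \<zero>\<^bsub>A\<^esub>) \<odot>\<^bsub>M\<^esub> x) = (\<Oplus>\<^bsub>M\<^esub>x\<in>B. if b = x then x else \<zero>\<^bsub>M\<^esub>)"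
        by (rule M.finsum_cong') (use B in auto)
      also have "\<dots> = b" using M.finsum_singleton[of b B "\<lambda>x. x"] b B by auto
      finally show "b \<in> ?S" by (intro CollectI exI[of _ "\<lambda>x. if b = x then \<one>\<^bsub>A\<^esub> else \<zero>\<^bsub>A\<^esub>"]) auto
    qed
    ultimately show "carrier M = ?S" using R by blast
  qed
  show ?thesis unfolding finitely_generated_module_def
    by (intro arg_cong[of _ _ Ex] ext conj_cong refl eq)
qed

end

section \<open>Chain conditions as well-foundedness\<close>

definition proper_submods :: "('a, 'k) ring_scheme \<Rightarrow> ('a, 'c, 'l) module_scheme \<Rightarrow> ('c set \<times> 'c set) set" where
  "proper_submods A M = {(N, P). submod A M N \<and> submod A M P \<and> N \<subset> P}"

text \<open>Well-foundedness of strict inclusion says that every non-empty set of submodules has a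
  minimal member; well-foundedness of its converse gives maximal members.\<close>

abbreviation artinian_module where "artinian_module A M \<equiv> wf (proper_submods A M)"
abbreviation noetherian_module where "noetherian_module A M \<equiv> wf ((proper_submods A M)\<inverse>)"

text \<open>A step of \<open>q\<close> moves \<open>f\<close>, or keeps \<open>f\<close> and moves
  \<open>g\<close>. With \<open>f\<close> the trace on a submodule and \<open>g\<close> the trace on
  what remains, this is how chain conditions pass to extensions. The hypothesis is symmetric under
  reversing all three relations, so one argument serves both conditions.\<close>

lemma wf_lex_map:
  assumes "\<And>x y. (x, y) \<in> q \<Longrightarrow> (f x, f y) \<in> r \<or> f x = f y \<and> (g x, g y) \<in> s"
  shows "wf r \<Longrightarrow> wf s \<Longrightarrow> wf q" and "wf (r\<inverse>) \<Longrightarrow> wf (s\<inverse>) \<Longrightarrow> wf (q\<inverse>)"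
proof -
  show "wf q" if "wf r" "wf s"
    by (rule wf_subset[OF wf_inv_image[OF wf_lex_prod[OF that], of "\<lambda>x. (f x, g x)"]])
      (use assms in auto)
  show "wf (q\<inverse>)" if "wf (r\<inverse>)" "wf (s\<inverse>)"
    by (rule wf_subset[OF wf_inv_image[OF wf_lex_prod[OF that], of "\<lambda>x. (f x, g x)"]])
      (use assms in force)
qed

lemma proper_submods_sub:
  assumes "submod A M N"
  shows "(P, Q) \<in> proper_submods A (M\<lparr>carrier := N\<rparr>) \<longleftrightarrow> submod A M P \<and> submod A M Q \<and> P \<subset> Q \<and> Q \<subseteq> N"
  using submod_sub_iff[OF assms] by (auto simp: proper_submods_def)

definition regular_module :: "('a, 'k) ring_scheme \<Rightarrow> ('a, 'a) module" where
  "regular_module A = \<lparr>carrier = carrier A, monoid.mult = monoid.mult A, one = one A,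
     ring.zero = ring.zero A, add = add A, smult = monoid.mult A\<rparr>"

lemma regular_module_simps [simp]:
  "carrier (regular_module A) = carrier A" "add (regular_module A) = add A"
  "\<zero>\<^bsub>regular_module A\<^esub> = \<zero>\<^bsub>A\<^esub>" "smult (regular_module A) = monoid.mult A"
  by (simp_all add: regular_module_def)

lemma left_module_regular:
  assumes "ring A"
  shows "left_module A (regular_module A)"
proof -
  interpret ring A by fact
  have "abelian_group (regular_module A)"
    by (rule abelian_groupI) (auto simp: a_ac intro: l_neg)
  then show ?thesis
    by (intro left_module.intro assms left_module_axioms.intro) (auto simp: l_distr r_distr m_assoc)
qed

context left_module
begin

text \<open>This is the left ideal of all \<open>a\<close> with \<open>a b\<close> in
  \<open>N + V\<close>. When \<open>N\<close> and \<open>b\<close> generate \<open>M\<close>, it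
  measures \<open>V\<close> modulo \<open>N\<close> without a quotient.\<close>

lemma submod_colon:
  assumes N: "submod A M N" and V: "submod A M V" and b: "b \<in> carrier M"
  shows "submod A (regular_module A) {a \<in> carrier A. \<exists>v\<in>V. v \<oplus>\<^bsub>M\<^esub> a \<odot>\<^bsub>M\<^esub> b \<in> N}"
proof (rule submodI)
  note c = submod_carrier[OF V]
  show "\<zero>\<^bsub>regular_module A\<^esub> \<in> {a \<in> carrier A. \<exists>v\<in>V. v \<oplus>\<^bsub>M\<^esub> a \<odot>\<^bsub>M\<^esub> b \<in> N}"
    using b submod_zero[OF V] submod_zero[OF N] by (auto intro!: bexI[of _ "\<zero>\<^bsub>M\<^esub>"])
next
  note c = submod_carrier[OF V]
  fix x y
  assume "x \<in> {a \<in> carrier A. \<exists>v\<in>V. v \<oplus>\<^bsub>M\<^esub> a \<odot>\<^bsub>M\<^esub> b \<in> N}"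
    and "y \<in> {a \<in> carrier A. \<exists>v\<in>V. v \<oplus>\<^bsub>M\<^esub> a \<odot>\<^bsub>M\<^esub> b \<in> N}"
  then obtain v w where *: "x \<in> carrier A" "y \<in> carrier A" "v \<in> V" "w \<in> V"
    "v \<oplus>\<^bsub>M\<^esub> x \<odot>\<^bsub>M\<^esub> b \<in> N" "w \<oplus>\<^bsub>M\<^esub> y \<odot>\<^bsub>M\<^esub> b \<in> N" by blast
  have "(v \<oplus>\<^bsub>M\<^esub> w) \<oplus>\<^bsub>M\<^esub> (x \<oplus>\<^bsub>A\<^esub> y) \<odot>\<^bsub>M\<^esub> b = (v \<oplus>\<^bsub>M\<^esub> x \<odot>\<^bsub>M\<^esub> b) \<oplus>\<^bsub>M\<^esub> (w \<oplus>\<^bsub>M\<^esub> y \<odot>\<^bsub>M\<^esub> b)"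
    using * b c by (simp add: smult_l_distr M.a_ac)
  then show "x \<oplus>\<^bsub>regular_module A\<^esub> y \<in> {a \<in> carrier A. \<exists>v\<in>V. v \<oplus>\<^bsub>M\<^esub> a \<odot>\<^bsub>M\<^esub> b \<in> N}"
    using * submod_add[OF N *(5,6)] submod_add[OF V *(3,4)] by (auto intro!: bexI[of _ "v \<oplus>\<^bsub>M\<^esub> w"])
next
  note cc = submod_carrier[OF V]
  fix c x assume c: "c \<in> carrier A" and "x \<in> {a \<in> carrier A. \<exists>v\<in>V. v \<oplus>\<^bsub>M\<^esub> a \<odot>\<^bsub>M\<^esub> b \<in> N}"
  then obtain v where *: "v \<in> V" "x \<in> carrier A" "v \<oplus>\<^bsub>M\<^esub> x \<odot>\<^bsub>M\<^esub> b \<in> N" by blast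
  have "c \<odot>\<^bsub>M\<^esub> v \<oplus>\<^bsub>M\<^esub> (c \<otimes>\<^bsub>A\<^esub> x) \<odot>\<^bsub>M\<^esub> b = c \<odot>\<^bsub>M\<^esub> (v \<oplus>\<^bsub>M\<^esub> x \<odot>\<^bsub>M\<^esub> b)"
    using * b c cc by (simp add: smult_r_distr smult_assoc1)
  then show "c \<odot>\<^bsub>regular_module A\<^esub> x \<in> {a \<in> carrier A. \<exists>v\<in>V. v \<oplus>\<^bsub>M\<^esub> a \<odot>\<^bsub>M\<^esub> b \<in> N}"
    using * c submod_smult[OF N c *(3)] submod_smult[OF V c *(1)] by (auto intro!: bexI[of _ "c \<odot>\<^bsub>M\<^esub> v"])
qed auto

text \<open>As \<open>M = N + A b\<close>, a chain of submodules that stands still inside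
  \<open>N\<close> must move in the associated left ideals of coefficients of
  \<open>b\<close>.\<close>

lemma proper_submods_adjoin:
  assumes N: "submod A M N" and b: "b \<in> carrier M"
    and gen: "\<And>x. x \<in> carrier M \<Longrightarrow> \<exists>a\<in>carrier A. x \<oplus>\<^bsub>M\<^esub> a \<odot>\<^bsub>M\<^esub> b \<in> N"
    and V: "(V, W) \<in> proper_submods A M"
  shows "(V \<inter> N, W \<inter> N) \<in> proper_submods A (M\<lparr>carrier := N\<rparr>) \<or> V \<inter> N = W \<inter> N \<and>
    ({a \<in> carrier A. \<exists>v\<in>V. v \<oplus>\<^bsub>M\<^esub> a \<odot>\<^bsub>M\<^esub> b \<in> N}, {a \<in> carrier A. \<exists>v\<in>W. v \<oplus>\<^bsub>M\<^esub> a \<odot>\<^bsub>M\<^esub> b \<in> N})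
      \<in> proper_submods A (regular_module A)"
proof (cases "V \<inter> N = W \<inter> N")
  case False
  with V have "V \<inter> N \<subset> W \<inter> N" by (auto simp: proper_submods_def)
  moreover have "submod A M (V \<inter> N)" "submod A M (W \<inter> N)"
    using V N by (simp_all add: proper_submods_def submod_Int)
  ultimately show ?thesis by (simp add: proper_submods_sub[OF N])
next
  case True
  have VW: "submod A M V" "submod A M W" "V \<subset> W" using V by (auto simp: proper_submods_def)
  obtain w where w: "w \<in> W" "w \<notin> V" using VW(3) by blast
  obtain a where a: "a \<in> carrier A" "w \<oplus>\<^bsub>M\<^esub> a \<odot>\<^bsub>M\<^esub> b \<in> N" using gen submod_carrier[OF VW(2) w(1)] by blast
  have "\<not> (\<exists>v\<in>V. v \<oplus>\<^bsub>M\<^esub> a \<odot>\<^bsub>M\<^esub> b \<in> N)"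
  proof
    assume "\<exists>v\<in>V. v \<oplus>\<^bsub>M\<^esub> a \<odot>\<^bsub>M\<^esub> b \<in> N"
    then obtain v where v: "v \<in> V" "v \<oplus>\<^bsub>M\<^esub> a \<odot>\<^bsub>M\<^esub> b \<in> N" by blast
    have cl: "v \<in> carrier M" "w \<in> carrier M" "a \<odot>\<^bsub>M\<^esub> b \<in> carrier M"
      using v w a b VW by (auto dest: submod_carrier)
    have "(w \<oplus>\<^bsub>M\<^esub> a \<odot>\<^bsub>M\<^esub> b) \<ominus>\<^bsub>M\<^esub> (v \<oplus>\<^bsub>M\<^esub> a \<odot>\<^bsub>M\<^esub> b) = w \<ominus>\<^bsub>M\<^esub> v"
      using cl by (simp add: a_minus_def M.minus_add M.a_ac M.r_neg1 M.r_neg)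
    then have "w \<ominus>\<^bsub>M\<^esub> v \<in> N" using submod_diff[OF N a(2) v(2)] by simp
    moreover have "w \<ominus>\<^bsub>M\<^esub> v \<in> W" using w v VW by (auto intro!: submod_diff)
    ultimately have "w \<ominus>\<^bsub>M\<^esub> v \<in> V" using True by blast
    then have "(w \<ominus>\<^bsub>M\<^esub> v) \<oplus>\<^bsub>M\<^esub> v \<in> V" using v VW by (auto intro: submod_add)
    then show False using w cl by (simp add: diff_add_cancel)
  qed
  then show ?thesis
    using True w a VW submod_colon[OF N VW(1) b] submod_colon[OF N VW(2) b] unfolding proper_submods_def by blast
qed

lemma wf_proper_submods_null:
  "wf (proper_submods A (M\<lparr>carrier := {\<zero>\<^bsub>M\<^esub>}\<rparr>))" "wf ((proper_submods A (M\<lparr>carrier := {\<zero>\<^bsub>M\<^esub>}\<rparr>))\<inverse>)"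
proof -
  have "proper_submods A (M\<lparr>carrier := {\<zero>\<^bsub>M\<^esub>}\<rparr>) = {}"
    using submod_zero[of A M] by (fastforce simp: proper_submods_sub[OF submod_null])
  then show "wf (proper_submods A (M\<lparr>carrier := {\<zero>\<^bsub>M\<^esub>}\<rparr>))" "wf ((proper_submods A (M\<lparr>carrier := {\<zero>\<^bsub>M\<^esub>}\<rparr>))\<inverse>)"
    by simp_all
qed

text \<open>Adjoining one generator at a time, starting from the null submodule, preserves both
  chain conditions; each generator contributes a chain of left ideals of \<open>A\<close>.\<close>

lemma finite_length_if_generated:
  assumes fg: "finitely_generated_module A M"
    and art: "artinian_module A (regular_module A)" and noeth: "noetherian_module A (regular_module A)"
  shows "artinian_module A M" and "noetherian_module A M"
proof -
  obtain B where B: "finite B" "B \<subseteq> carrier M" "\<And>N. submod A M N \<Longrightarrow> B \<subseteq> N \<Longrightarrow> N = carrier M"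
    using fg unfolding finitely_generated_iff by blast
  have "\<exists>N. submod A M N \<and> B \<subseteq> N \<and> wf (proper_submods A (M\<lparr>carrier := N\<rparr>)) \<and> wf ((proper_submods A (M\<lparr>carrier := N\<rparr>))\<inverse>)"
    using B(1,2)
  proof (induction B rule: finite_induct)
    case empty
    then show ?case using wf_proper_submods_null submod_null by blast
  next
    case (insert b B)
    then obtain N where N: "submod A M N" "B \<subseteq> N" and wf: "wf (proper_submods A (M\<lparr>carrier := N\<rparr>))"
      "wf ((proper_submods A (M\<lparr>carrier := N\<rparr>))\<inverse>)" by auto
    have b: "b \<in> carrier M" using insert by simp
    let ?N = "{x \<in> carrier M. \<exists>a\<in>carrier A. x \<oplus>\<^bsub>M\<^esub> a \<odot>\<^bsub>M\<^esub> b \<in> N}"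
    have sN: "submod A M ?N" by (rule submod_adjoin[OF N(1) b])
    have sup: "N \<subseteq> ?N" "b \<in> ?N" using submod_adjoin_superset[OF N(1) b] .
    \<comment> \<open>The extension lemma is applied inside \<open>N + A b\<close>, where
      \<open>b\<close> completes \<open>N\<close> to a generating set.\<close>
    interpret L: left_module A "M\<lparr>carrier := ?N\<rparr>" by (rule left_module_sub[OF sN])
    have "submod A (M\<lparr>carrier := ?N\<rparr>) N" using submod_sub_iff[OF sN] N sup by blast
    note m = L.proper_submods_adjoin[OF this, of b, simplified]
    have "wf (proper_submods A (M\<lparr>carrier := ?N\<rparr>))" "wf ((proper_submods A (M\<lparr>carrier := ?N\<rparr>))\<inverse>)"
      by (rule wf_lex_map[OF m], use sup b wf art noeth in auto)+
    then show ?case using sN sup N by (intro exI[of _ ?N] conjI) auto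
  qed
  then obtain N where N: "submod A M N" "B \<subseteq> N" and wf: "wf (proper_submods A (M\<lparr>carrier := N\<rparr>))"
    "wf ((proper_submods A (M\<lparr>carrier := N\<rparr>))\<inverse>)" by blast
  have "N = carrier M" using B N by blast
  moreover have "proper_submods A (M\<lparr>carrier := carrier M\<rparr>) = proper_submods A M" by (simp add: proper_submods_def submod_def)
  ultimately show "artinian_module A M" "noetherian_module A M" using wf by simp_all
qed

end

section \<open>Akizuki's theorem\<close>

text \<open>Commutativity makes multiplication by \<open>s\<close> linear, so that its image and its
  kernel on an ideal are ideals.\<close>

lemma submod_regular_image:
  assumes S: "cring S" and s: "s \<in> carrier S" and I: "submod S (regular_module S) I"
  shows "submod S (regular_module S) ((\<lambda>v. s \<otimes>\<^bsub>S\<^esub> v) ` I)"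
    and "submod S (regular_module S) {v \<in> I. s \<otimes>\<^bsub>S\<^esub> v = \<zero>\<^bsub>S\<^esub>}"
    and "(\<lambda>v. s \<otimes>\<^bsub>S\<^esub> v) ` I \<subseteq> I"
proof -
  interpret S: cring S by fact
  note c = submod_carrier[OF I, simplified] and [simp] = submod_zero[OF I, simplified]
  note add = submod_add[OF I, simplified] and smult = submod_smult[OF I, simplified]
  show "submod S (regular_module S) ((\<lambda>v. s \<otimes>\<^bsub>S\<^esub> v) ` I)"
  proof (rule submodI)
    show "\<zero>\<^bsub>regular_module S\<^esub> \<in> (\<lambda>v. s \<otimes>\<^bsub>S\<^esub> v) ` I" using s by (auto intro!: image_eqI[of _ _ "\<zero>\<^bsub>S\<^esub>"])
  next
    fix x y assume "x \<in> (\<lambda>v. s \<otimes>\<^bsub>S\<^esub> v) ` I" "y \<in> (\<lambda>v. s \<otimes>\<^bsub>S\<^esub> v) ` I"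
    then obtain v w where "v \<in> I" "w \<in> I" "x = s \<otimes>\<^bsub>S\<^esub> v" "y = s \<otimes>\<^bsub>S\<^esub> w" by blast
    then show "x \<oplus>\<^bsub>regular_module S\<^esub> y \<in> (\<lambda>v. s \<otimes>\<^bsub>S\<^esub> v) ` I"
      using s c add by (auto intro!: image_eqI[of _ _ "v \<oplus>\<^bsub>S\<^esub> w"] simp: S.r_distr)
  next
    fix a x assume "a \<in> carrier S" "x \<in> (\<lambda>v. s \<otimes>\<^bsub>S\<^esub> v) ` I"
    then obtain v where "a \<in> carrier S" "v \<in> I" "x = s \<otimes>\<^bsub>S\<^esub> v" by blast
    then show "a \<odot>\<^bsub>regular_module S\<^esub> x \<in> (\<lambda>v. s \<otimes>\<^bsub>S\<^esub> v) ` I"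
      using s c smult by (auto intro!: image_eqI[of _ _ "a \<otimes>\<^bsub>S\<^esub> v"] simp: S.m_lcomm)
  qed (use s c in auto)
  show "submod S (regular_module S) {v \<in> I. s \<otimes>\<^bsub>S\<^esub> v = \<zero>\<^bsub>S\<^esub>}"
    by (rule submodI) (use s c add smult in \<open>auto simp: S.r_distr S.m_lcomm[of s]\<close>)
  show "(\<lambda>v. s \<otimes>\<^bsub>S\<^esub> v) ` I \<subseteq> I" using s smult by auto
qed

text \<open>An ideal \<open>I\<close> minimal among the non-noetherian ones satisfies
  \<open>s I = 0\<close> or \<open>s I = I\<close> for every scalar \<open>s\<close>, so that it is a vector space over the residue field
  of its annihilator; a hyperplane of it is a smaller ideal, hence noetherian.\<close>

theorem cring_artinian_imp_noetherian:
  assumes S: "cring S" and art: "artinian_module S (regular_module S)"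
  shows "noetherian_module S (regular_module S)"
proof (rule ccontr)
  interpret S: cring S by fact
  let ?M = "regular_module S"
  interpret M: left_module S ?M by (rule left_module_regular) (rule S.ring_axioms)
  define noe where "noe I \<longleftrightarrow> wf ((proper_submods S (?M\<lparr>carrier := I\<rparr>))\<inverse>)" for I
  have "proper_submods S (?M\<lparr>carrier := carrier S\<rparr>) = proper_submods S ?M" by (simp add: proper_submods_def submod_def)
  moreover assume "\<not> wf ((proper_submods S ?M)\<inverse>)"
  ultimately have "carrier S \<in> {I. submod S ?M I \<and> \<not> noe I}"
    using M.submod_self by (simp add: noe_def)
  then obtain I where I': "I \<in> {I. submod S ?M I \<and> \<not> noe I}"
    and min: "\<And>J. (J, I) \<in> proper_submods S ?M \<Longrightarrow> J \<notin> {I. submod S ?M I \<and> \<not> noe I}"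
    by (rule wfE_min[OF art]) (rule that)
  then have I: "submod S ?M I" "\<not> noe I" by simp_all
  have small: "noe J" if "submod S ?M J" "J \<subset> I" for J
    using min[of J] that I by (auto simp: proper_submods_def)
  note cI = submod_carrier[OF I(1), simplified]
  \<comment> \<open>If \<open>s I\<close> were a proper part of \<open>I\<close>, then it and the
    kernel of \<open>s\<close> on \<open>I\<close>, which misses \<open>u\<close>, would both be
    noetherian by minimality. A chain in \<open>I\<close> is controlled by its traces on these two,
    so \<open>I\<close> would be noetherian.\<close>
  have onto: "(\<lambda>v. s \<otimes>\<^bsub>S\<^esub> v) ` I = I" if s: "s \<in> carrier S" and nz: "u \<in> I" "s \<otimes>\<^bsub>S\<^esub> u \<noteq> \<zero>\<^bsub>S\<^esub>" for s u
  proof (rule ccontr)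
    let ?J = "(\<lambda>v. s \<otimes>\<^bsub>S\<^esub> v) ` I" and ?K = "{v \<in> I. s \<otimes>\<^bsub>S\<^esub> v = \<zero>\<^bsub>S\<^esub>}"
    note J = submod_regular_image(1)[OF S s I(1)] and K = submod_regular_image(2)[OF S s I(1)]
    assume "?J \<noteq> I"
    then have nJ: "noe ?J" using submod_regular_image(3)[OF S s I(1)] J small by auto
    have nK: "noe ?K" by (rule small[OF K]) (use nz in auto)
    have m: "(V \<inter> ?K, W \<inter> ?K) \<in> proper_submods S (?M\<lparr>carrier := ?K\<rparr>) \<or> V \<inter> ?K = W \<inter> ?K \<and>
        ((\<lambda>v. s \<otimes>\<^bsub>S\<^esub> v) ` V, (\<lambda>v. s \<otimes>\<^bsub>S\<^esub> v) ` W) \<in> proper_submods S (?M\<lparr>carrier := ?J\<rparr>)"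
      if "(V, W) \<in> proper_submods S (?M\<lparr>carrier := I\<rparr>)" for V W
    proof (cases "V \<inter> ?K = W \<inter> ?K")
      case False
      moreover have V: "submod S ?M V" "submod S ?M W" "V \<subset> W" using that by (simp_all add: proper_submods_sub[OF I(1)])
      ultimately show ?thesis
        using submod_Int[OF V(1) K] submod_Int[OF V(2) K] unfolding proper_submods_sub[OF K] by blast
    next
      case True
      have V: "submod S ?M V" "submod S ?M W" "V \<subset> W" "W \<subseteq> I" using that by (simp_all add: proper_submods_sub[OF I(1)])
      obtain w where w: "w \<in> W" "w \<notin> V" using V(3) by blast
      have "s \<otimes>\<^bsub>S\<^esub> w \<notin> (\<lambda>v. s \<otimes>\<^bsub>S\<^esub> v) ` V"
      proof
        assume "s \<otimes>\<^bsub>S\<^esub> w \<in> (\<lambda>v. s \<otimes>\<^bsub>S\<^esub> v) ` V"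
        then obtain v where v: "v \<in> V" "s \<otimes>\<^bsub>S\<^esub> w = s \<otimes>\<^bsub>S\<^esub> v" by blast
        have c: "v \<in> carrier S" "w \<in> carrier S" using v w V cI by auto
        have wv: "w \<ominus>\<^bsub>?M\<^esub> v \<in> W" using M.submod_diff[OF V(2)] v w V by blast
        then have cwv: "w \<ominus>\<^bsub>?M\<^esub> v \<in> carrier S" "w \<ominus>\<^bsub>?M\<^esub> v \<in> I" using V cI by auto
        have eq: "(w \<ominus>\<^bsub>?M\<^esub> v) \<oplus>\<^bsub>S\<^esub> v = w" using M.diff_add_cancel[of w v] c by simp
        have "s \<otimes>\<^bsub>S\<^esub> (w \<ominus>\<^bsub>?M\<^esub> v) \<oplus>\<^bsub>S\<^esub> s \<otimes>\<^bsub>S\<^esub> v = s \<otimes>\<^bsub>S\<^esub> w"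
          using S.r_distr[OF cwv(1) c(1) s] eq by simp
        then have "s \<otimes>\<^bsub>S\<^esub> (w \<ominus>\<^bsub>?M\<^esub> v) = \<zero>\<^bsub>S\<^esub>" using v(2) s c cwv S.add.r_cancel_one' S.m_closed by metis
        then have "w \<ominus>\<^bsub>?M\<^esub> v \<in> V" using wv cwv True by blast
        then have "(w \<ominus>\<^bsub>?M\<^esub> v) \<oplus>\<^bsub>S\<^esub> v \<in> V" using submod_add[OF V(1)] v by simp
        then show False using eq w by simp
      qed
      then have "(\<lambda>v. s \<otimes>\<^bsub>S\<^esub> v) ` V \<subset> (\<lambda>v. s \<otimes>\<^bsub>S\<^esub> v) ` W" using w V(3) by blast
      then show ?thesis
        using True V(4) submod_regular_image(1)[OF S s V(1)] submod_regular_image(1)[OF S s V(2)]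
        unfolding proper_submods_sub[OF J] by blast
    qed
    have "noe I" unfolding noe_def
      by (rule wf_lex_map(2)[OF m nK[unfolded noe_def] nJ[unfolded noe_def]])
    with I(2) show False by simp
  qed
  \<comment> \<open>The inverse of \<open>s\<close> on \<open>I\<close> comes from the ring itself:
    the descending chain of principal ideals of the powers of \<open>s\<close> stops, so
    \<open>s^n = s^(n+1) t\<close> for some \<open>t\<close>, and \<open>s I = I\<close> makes every
    element of \<open>I\<close> a multiple of \<open>s^n\<close>.\<close>
  have unit: "\<exists>t\<in>carrier S. \<forall>v\<in>I. t \<otimes>\<^bsub>S\<^esub> (s \<otimes>\<^bsub>S\<^esub> v) = v"
    if s: "s \<in> carrier S" and sI: "(\<lambda>v. s \<otimes>\<^bsub>S\<^esub> v) ` I = I" for s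
  proof -
    define P where "P n = (\<lambda>v. s [^]\<^bsub>S\<^esub> n \<otimes>\<^bsub>S\<^esub> v) ` carrier S" for n :: nat
    have P: "submod S ?M (P n)" for n
      unfolding P_def using submod_regular_image(1)[OF S, of "s [^]\<^bsub>S\<^esub> n" "carrier S"] s M.submod_self by simp
    obtain n where n: "\<And>m. (P m, P n) \<notin> proper_submods S ?M"
      by (rule wfE_min[OF art, of "P 0" "range P"]) auto
    have "P (Suc n) \<subseteq> P n"
    proof
      fix x assume "x \<in> P (Suc n)"
      then obtain v where "v \<in> carrier S" "x = s [^]\<^bsub>S\<^esub> n \<otimes>\<^bsub>S\<^esub> s \<otimes>\<^bsub>S\<^esub> v" by (auto simp: P_def)
      then show "x \<in> P n" using s by (auto simp: P_def S.m_assoc intro!: image_eqI[of _ _ "s \<otimes>\<^bsub>S\<^esub> v"])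
    qed
    with n[of "Suc n"] P have "P (Suc n) = P n" by (auto simp: proper_submods_def)
    moreover have "s [^]\<^bsub>S\<^esub> n \<in> P n" using s by (auto simp: P_def intro!: image_eqI[of _ _ "\<one>\<^bsub>S\<^esub>"])
    ultimately obtain t where t: "t \<in> carrier S" "s [^]\<^bsub>S\<^esub> n = s [^]\<^bsub>S\<^esub> n \<otimes>\<^bsub>S\<^esub> s \<otimes>\<^bsub>S\<^esub> t" by (auto simp: P_def)
    have pow: "\<exists>u\<in>I. v = s [^]\<^bsub>S\<^esub> k \<otimes>\<^bsub>S\<^esub> u" if "v \<in> I" for v and k :: nat
      using that
    proof (induction k arbitrary: v)
      case (Suc k)
      then obtain u where u: "u \<in> I" "v = s [^]\<^bsub>S\<^esub> k \<otimes>\<^bsub>S\<^esub> u" by blast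
      then obtain u' where u': "u' \<in> I" "u = s \<otimes>\<^bsub>S\<^esub> u'" using sI by blast
      then show ?case using u s cI by (auto intro!: bexI[of _ u'] simp: S.m_assoc)
    next
      case 0
      then show ?case using cI by (intro bexI[of _ v]) auto
    qed
    have "t \<otimes>\<^bsub>S\<^esub> (s \<otimes>\<^bsub>S\<^esub> v) = v" if v: "v \<in> I" for v
    proof -
      obtain u where u: "u \<in> I" "v = s [^]\<^bsub>S\<^esub> n \<otimes>\<^bsub>S\<^esub> u" using pow[OF v] by blast
      have "t \<otimes>\<^bsub>S\<^esub> (s \<otimes>\<^bsub>S\<^esub> v) = (s [^]\<^bsub>S\<^esub> n \<otimes>\<^bsub>S\<^esub> s \<otimes>\<^bsub>S\<^esub> t) \<otimes>\<^bsub>S\<^esub> u"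
        using u t(1) s cI by (simp add: S.m_ac)
      then show ?thesis using t(2) u by simp
    qed
    then show ?thesis using t by blast
  qed
  have "I \<noteq> {\<zero>\<^bsub>S\<^esub>}" using I(2) M.wf_proper_submods_null(2) by (auto simp: noe_def)
  then obtain x where x: "x \<in> I" "x \<noteq> \<zero>\<^bsub>S\<^esub>" using submod_zero[OF I(1)] by auto
  \<comment> \<open>A submodule of \<open>I\<close> maximal among those avoiding \<open>x\<close> is
    the hyperplane. Zorn's lemma applies since the union of a chain of such submodules still avoids
    \<open>x\<close>.\<close>
  let ?Z = "{W. submod S ?M W \<and> W \<subseteq> I \<and> x \<notin> W}"
  have "\<exists>W\<in>?Z. \<forall>B\<in>?Z. W \<subseteq> B \<longrightarrow> B = W"
  proof (rule subset_Zorn_nonempty)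
    have "{\<zero>\<^bsub>S\<^esub>} \<in> ?Z" using M.submod_null submod_zero[OF I(1)] x by simp
    then show "?Z \<noteq> {}" by blast
  next
    fix C assume C: "C \<noteq> {}" "subset.chain ?Z C"
    then have CA: "submod S ?M W" "W \<subseteq> I" "x \<notin> W" if "W \<in> C" for W
      using that by (auto simp: subset.chain_def)
    have "submod S ?M (\<Union>C)"
    proof (rule submodI)
      fix a b assume "a \<in> \<Union>C" "b \<in> \<Union>C"
      then obtain B D where BD: "B \<in> C" "a \<in> B" "D \<in> C" "b \<in> D" by blast
      then have "B \<subseteq> D \<or> D \<subseteq> B" using C(2) by (auto simp: subset.chain_def)
      then show "a \<oplus>\<^bsub>?M\<^esub> b \<in> \<Union>C" using BD submod_add[OF CA(1)] by (metis UnionI subsetD)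
    next
      show "\<Union>C \<subseteq> carrier ?M" using submod_subset[OF CA(1)] by (rule Union_least)
      show "\<zero>\<^bsub>?M\<^esub> \<in> \<Union>C" using C(1) submod_zero[OF CA(1)] by auto
    qed (use submod_smult[OF CA(1)] in blast)
    moreover have "\<Union>C \<subseteq> I" using CA(2) by (rule Union_least)
    moreover have "x \<notin> \<Union>C" using CA(3) by auto
    ultimately show "\<Union>C \<in> ?Z" by simp
  qed
  then obtain W where WZ: "W \<in> ?Z" and maxZ: "\<forall>B\<in>?Z. W \<subseteq> B \<longrightarrow> B = W" by (rule bexE)
  have W: "submod S ?M W" "W \<subseteq> I" "x \<notin> W" using WZ by simp_all
  have max: "B = W" if "submod S ?M B" "B \<subseteq> I" "x \<notin> B" "W \<subseteq> B" for B
    using bspec[OF maxZ, of B] that by simp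
  \<comment> \<open>Otherwise the part of \<open>W + S u\<close> inside \<open>I\<close> would be a
    larger submodule avoiding \<open>x\<close>.\<close>
  have x_gen: "\<exists>a\<in>carrier S. x \<oplus>\<^bsub>S\<^esub> a \<otimes>\<^bsub>S\<^esub> u \<in> W" if u: "u \<in> I" "u \<notin> W" for u
  proof (rule ccontr)
    let ?B = "{y \<in> carrier ?M. \<exists>a\<in>carrier S. y \<oplus>\<^bsub>?M\<^esub> a \<odot>\<^bsub>?M\<^esub> u \<in> W}"
    assume "\<not> (\<exists>a\<in>carrier S. x \<oplus>\<^bsub>S\<^esub> a \<otimes>\<^bsub>S\<^esub> u \<in> W)"
    moreover have uc: "u \<in> carrier ?M" using u cI by simp
    ultimately have "I \<inter> ?B = W"
      using M.submod_adjoin[OF W(1) uc] M.submod_adjoin_superset(1)[OF W(1) uc] W(2)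
      by (intro max submod_Int I(1)) auto
    moreover have "u \<in> ?B" by (rule M.submod_adjoin_superset(2)[OF W(1) uc])
    ultimately show False using u by blast
  qed
  \<comment> \<open>Both \<open>x + r y\<close> and \<open>x + a u\<close> lie in \<open>W\<close>,
    hence so does \<open>r y - a u\<close>. The product \<open>r y\<close> is nonzero because
    \<open>x\<close> is not in \<open>W\<close>, so \<open>r\<close> is invertible on
    \<open>I\<close> and can be cancelled. Thus \<open>W\<close> together with any \<open>u\<close>
    outside it generates \<open>I\<close>.\<close>
  have gen: "\<exists>a\<in>carrier S. y \<oplus>\<^bsub>S\<^esub> a \<otimes>\<^bsub>S\<^esub> u \<in> W" if u: "u \<in> I" "u \<notin> W" and y: "y \<in> I" for u y
  proof (cases "y \<in> W")
    case True
    then show ?thesis using u y cI by (auto intro!: bexI[of _ "\<zero>\<^bsub>S\<^esub>"])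
  next
    case False
    then obtain r where r: "r \<in> carrier S" "x \<oplus>\<^bsub>S\<^esub> r \<otimes>\<^bsub>S\<^esub> y \<in> W" using x_gen y by blast
    obtain a where a: "a \<in> carrier S" "x \<oplus>\<^bsub>S\<^esub> a \<otimes>\<^bsub>S\<^esub> u \<in> W" using x_gen u by blast
    have c: "x \<in> carrier S" "y \<in> carrier S" "u \<in> carrier S" using x y u cI by auto
    have "r \<otimes>\<^bsub>S\<^esub> y \<noteq> \<zero>\<^bsub>S\<^esub>" using r(2) W(3) c by auto
    then obtain t where t: "t \<in> carrier S" "\<forall>v\<in>I. t \<otimes>\<^bsub>S\<^esub> (r \<otimes>\<^bsub>S\<^esub> v) = v"
      using unit[OF r(1) onto[OF r(1) y]] by blast
    have "t \<otimes>\<^bsub>S\<^esub> (x \<oplus>\<^bsub>S\<^esub> r \<otimes>\<^bsub>S\<^esub> y) \<in> W" "(\<ominus>\<^bsub>S\<^esub> t) \<otimes>\<^bsub>S\<^esub> (x \<oplus>\<^bsub>S\<^esub> a \<otimes>\<^bsub>S\<^esub> u) \<in> W"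
      using submod_smult[OF W(1)] t r a by simp_all
    then have "t \<otimes>\<^bsub>S\<^esub> (x \<oplus>\<^bsub>S\<^esub> r \<otimes>\<^bsub>S\<^esub> y) \<oplus>\<^bsub>S\<^esub> (\<ominus>\<^bsub>S\<^esub> t) \<otimes>\<^bsub>S\<^esub> (x \<oplus>\<^bsub>S\<^esub> a \<otimes>\<^bsub>S\<^esub> u) \<in> W"
      using submod_add[OF W(1)] by simp
    also have "t \<otimes>\<^bsub>S\<^esub> (x \<oplus>\<^bsub>S\<^esub> r \<otimes>\<^bsub>S\<^esub> y) \<oplus>\<^bsub>S\<^esub> (\<ominus>\<^bsub>S\<^esub> t) \<otimes>\<^bsub>S\<^esub> (x \<oplus>\<^bsub>S\<^esub> a \<otimes>\<^bsub>S\<^esub> u) =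
        t \<otimes>\<^bsub>S\<^esub> (r \<otimes>\<^bsub>S\<^esub> y) \<oplus>\<^bsub>S\<^esub> (\<ominus>\<^bsub>S\<^esub> t \<otimes>\<^bsub>S\<^esub> a) \<otimes>\<^bsub>S\<^esub> u"
      using c t(1) r(1) a(1) by algebra
    finally show ?thesis using t y r a by (intro bexI[of _ "\<ominus>\<^bsub>S\<^esub> t \<otimes>\<^bsub>S\<^esub> a"]) auto
  qed
  have nW: "noe W" using small[OF W(1)] W x by blast
  \<comment> \<open>Once the trace on \<open>W\<close> is fixed, a strict inclusion can only lead
    from inside \<open>W\<close> to outside, because an element of \<open>V\<close> outside
    \<open>W\<close> generates \<open>I\<close> modulo \<open>W\<close>. The truth value of
    \<open>V \<subseteq> W\<close> is therefore the second lexicographic component, and it permits a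
    single step.\<close>
  have m: "(V \<inter> W, V' \<inter> W) \<in> proper_submods S (?M\<lparr>carrier := W\<rparr>) \<or> V \<inter> W = V' \<inter> W \<and>
      (V \<subseteq> W, V' \<subseteq> W) \<in> {(True, False)}"
    if "(V, V') \<in> proper_submods S (?M\<lparr>carrier := I\<rparr>)" for V V'
  proof (cases "V \<inter> W = V' \<inter> W")
    case False
    moreover have V: "submod S ?M V" "submod S ?M V'" "V \<subset> V'" using that by (simp_all add: proper_submods_sub[OF I(1)])
    ultimately show ?thesis
      using submod_Int[OF V(1) W(1)] submod_Int[OF V(2) W(1)] unfolding proper_submods_sub[OF W(1)] by blast
  next
    case True
    have V: "submod S ?M V" "submod S ?M V'" "V \<subset> V'" "V' \<subseteq> I" using that by (simp_all add: proper_submods_sub[OF I(1)])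
    have "V \<subseteq> W"
    proof (rule ccontr)
      assume "\<not> V \<subseteq> W"
      then obtain u where u: "u \<in> V" "u \<notin> W" by blast
      obtain v where v: "v \<in> V'" "v \<notin> V" using V(3) by blast
      obtain a where a: "a \<in> carrier S" "v \<oplus>\<^bsub>S\<^esub> a \<otimes>\<^bsub>S\<^esub> u \<in> W" using gen[of u v] u v V by blast
      have au: "a \<otimes>\<^bsub>S\<^esub> u \<in> V" using submod_smult[OF V(1) a(1) u(1)] by simp
      then have "v \<oplus>\<^bsub>S\<^esub> a \<otimes>\<^bsub>S\<^esub> u \<in> V'" using submod_add[OF V(2) v(1)] V(3) by auto
      then have "v \<oplus>\<^bsub>S\<^esub> a \<otimes>\<^bsub>S\<^esub> u \<in> V" using a(2) True by blast
      then show False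
        using M.submod_mem_add_cancel[OF V(1) au] v V cI by auto
    qed
    then show ?thesis using True V(3) by auto
  qed
  have w: "wf ({(True, False)}\<inverse>)" by (rule wf_subset[OF wf_measure[of "\<lambda>b. if b then 1 else 0"]]) auto
  have "noe I" unfolding noe_def by (rule wf_lex_map(2)[OF m nW[unfolded noe_def] w])
  with I(2) show False by simp
qed

text \<open>Submodules of \<open>S\<close> over itself are ideals. Well-foundedness speaks of
  arbitrary sets of sets, but a set that is no submodule has no predecessor and is trivially
  minimal.\<close>

lemma minimal_condition_imp_artinian:
  assumes S: "cring S" and min: "minimal_condition_on_ideals S"
  shows "artinian_module S (regular_module S)"
proof (rule wfI_min)
  interpret S: cring S by fact
  interpret M: left_module S "regular_module S" by (rule left_module_regular) (rule S.ring_axioms)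
  have ideal: "ideal I S" if I: "submod S (regular_module S) I" for I
  proof (rule idealI[OF S.ring_axioms])
    show "subgroup I (add_monoid S)"
    proof (rule subgroup.intro)
      fix x assume x: "x \<in> I"
      then have "\<ominus>\<^bsub>S\<^esub> \<one>\<^bsub>S\<^esub> \<otimes>\<^bsub>S\<^esub> x \<in> I" using submod_smult[OF I] by simp
      then have "\<ominus>\<^bsub>S\<^esub> x \<in> I" using submod_carrier[OF I x] by (simp add: S.l_minus)
      then show "inv\<^bsub>add_monoid S\<^esub> x \<in> I" by (simp add: a_inv_def)
    qed (use submod_add[OF I] submod_zero[OF I] submod_subset[OF I] in auto)
  next
    fix a x assume ax: "a \<in> I" "x \<in> carrier S"
    show "x \<otimes>\<^bsub>S\<^esub> a \<in> I" using submod_smult[OF I ax(2,1)] by simp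
    then show "a \<otimes>\<^bsub>S\<^esub> x \<in> I" using submod_carrier[OF I ax(1)] ax(2) S.m_comm[of a x] by simp
  qed
  fix x and Q :: "'a set set" assume x: "x \<in> Q"
  show "\<exists>z\<in>Q. \<forall>y. (y, z) \<in> proper_submods S (regular_module S) \<longrightarrow> y \<notin> Q"
  proof (cases "\<exists>I\<in>Q. submod S (regular_module S) I")
    case True
    let ?Q = "{I \<in> Q. submod S (regular_module S) I}"
    have "\<exists>I\<in>?Q. \<forall>J\<in>?Q. J \<subseteq> I \<longrightarrow> J = I"
      by (rule min[unfolded minimal_condition_on_ideals_def, rule_format]) (use True ideal in auto)
    then obtain I where "I \<in> ?Q" "\<forall>J\<in>?Q. J \<subseteq> I \<longrightarrow> J = I" by blast
    then show ?thesis by (intro bexI[of _ I]) (auto simp: proper_submods_def)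
  qed (use x in \<open>auto simp: proper_submods_def\<close>)
qed

section \<open>Composition series\<close>

lemma left_module_homD:
  assumes "f \<in> left_module_hom A M N"
  shows "x \<in> carrier M \<Longrightarrow> f x \<in> carrier N"
    and "x \<in> carrier M \<Longrightarrow> y \<in> carrier M \<Longrightarrow> f (x \<oplus>\<^bsub>M\<^esub> y) = f x \<oplus>\<^bsub>N\<^esub> f y"
    and "a \<in> carrier A \<Longrightarrow> x \<in> carrier M \<Longrightarrow> f (a \<odot>\<^bsub>M\<^esub> x) = a \<odot>\<^bsub>N\<^esub> f x"
  using assms by (auto simp: left_module_hom_def)

lemma left_module_homI:
  assumes "\<And>x. x \<in> carrier M \<Longrightarrow> f x \<in> carrier N"
    and "\<And>x y. x \<in> carrier M \<Longrightarrow> y \<in> carrier M \<Longrightarrow> f (x \<oplus>\<^bsub>M\<^esub> y) = f x \<oplus>\<^bsub>N\<^esub> f y"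
    and "\<And>a x. a \<in> carrier A \<Longrightarrow> x \<in> carrier M \<Longrightarrow> f (a \<odot>\<^bsub>M\<^esub> x) = a \<odot>\<^bsub>N\<^esub> f x"
  shows "f \<in> left_module_hom A M N"
  using assms by (simp add: left_module_hom_def)

lemma left_module_hom_comp:
  "f \<in> left_module_hom A M N \<Longrightarrow> g \<in> left_module_hom A N P \<Longrightarrow> (\<lambda>x. g (f x)) \<in> left_module_hom A M P"
  by (auto simp: left_module_hom_def Pi_iff)

lemma left_module_hom_sub:
  "f \<in> left_module_hom A M N \<Longrightarrow> P \<subseteq> carrier M \<Longrightarrow> f ` P \<subseteq> Q \<Longrightarrow>
    f \<in> left_module_hom A (M\<lparr>carrier := P\<rparr>) (N\<lparr>carrier := Q\<rparr>)"
  by (auto simp: left_module_hom_def subset_iff)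

locale left_module_morphism = M?: left_module A M + N?: left_module A N
  for A :: "('a, 'k) ring_scheme" and M :: "('a, 'c, 'l) module_scheme" and N :: "('a, 'd, 'm) module_scheme" +
  fixes f assumes f: "f \<in> left_module_hom A M N"
begin

lemmas f_closed = left_module_homD(1)[OF f] and f_add = left_module_homD(2)[OF f]
  and f_smult = left_module_homD(3)[OF f]

lemma f_zero [simp]: "f \<zero>\<^bsub>M\<^esub> = \<zero>\<^bsub>N\<^esub>"
  using f_smult[of "\<zero>\<^bsub>A\<^esub>" "\<zero>\<^bsub>M\<^esub>"] f_closed[of "\<zero>\<^bsub>M\<^esub>"] by simp

lemma f_diff: "x \<in> carrier M \<Longrightarrow> y \<in> carrier M \<Longrightarrow> f (x \<ominus>\<^bsub>M\<^esub> y) = f x \<ominus>\<^bsub>N\<^esub> f y"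
  using f_smult[of "\<ominus>\<^bsub>A\<^esub> \<one>\<^bsub>A\<^esub>" y] f_closed
  by (simp add: a_minus_def f_add M.smult_minus_one N.smult_minus_one)

lemma submod_image:
  assumes P: "submod A M P"
  shows "submod A N (f ` P)"
proof (rule submodI)
  note c = submod_carrier[OF P]
  show "f ` P \<subseteq> carrier N" using f_closed c by auto
  show "\<zero>\<^bsub>N\<^esub> \<in> f ` P" using submod_zero[OF P] f_zero by (metis image_eqI)
next
  fix x y assume "x \<in> f ` P" "y \<in> f ` P"
  then obtain u v where "u \<in> P" "x = f u" "v \<in> P" "y = f v" by blast
  then show "x \<oplus>\<^bsub>N\<^esub> y \<in> f ` P"
    using f_add[OF submod_carrier[OF P] submod_carrier[OF P]] submod_add[OF P]
    by (intro image_eqI[of _ _ "u \<oplus>\<^bsub>M\<^esub> v"]) auto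
next
  fix a x assume "a \<in> carrier A" "x \<in> f ` P"
  then obtain u where "u \<in> P" "x = f u" "a \<in> carrier A" by blast
  then show "a \<odot>\<^bsub>N\<^esub> x \<in> f ` P"
    using f_smult[OF _ submod_carrier[OF P]] submod_smult[OF P]
    by (intro image_eqI[of _ _ "a \<odot>\<^bsub>M\<^esub> u"]) auto
qed

lemma submod_kernel: "submod A M {x \<in> carrier M. f x = \<zero>\<^bsub>N\<^esub>}"
  by (rule submodI) (auto simp: f_add f_smult)

lemma f_eq_iff: "x \<in> carrier M \<Longrightarrow> y \<in> carrier M \<Longrightarrow> f x = f y \<longleftrightarrow> f (x \<ominus>\<^bsub>M\<^esub> y) = \<zero>\<^bsub>N\<^esub>"
  by (simp add: f_diff N.diff_eq_zero_iff f_closed)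

text \<open>Plays the part of the homomorphism theorem: the kernel of \<open>f\<close> lies in that
  of \<open>p\<close>, so the value of \<open>p\<close> at a preimage does not depend on the
  preimage, and \<open>p\<close> descends along the surjection \<open>f\<close>.\<close>

lemma hom_factor:
  fixes T :: "('a, 'e, 'n) module_scheme"
  assumes T: "left_module A T" and p: "p \<in> left_module_hom A M T"
    and surj: "f ` carrier M = carrier N"
    and ker: "\<And>x. x \<in> carrier M \<Longrightarrow> f x = \<zero>\<^bsub>N\<^esub> \<Longrightarrow> p x = \<zero>\<^bsub>T\<^esub>"
  shows "(\<lambda>y. p (inv_into (carrier M) f y)) \<in> left_module_hom A N T"
    and "x \<in> carrier M \<Longrightarrow> p (inv_into (carrier M) f (f x)) = p x"
proof -
  interpret p: left_module_morphism A M T p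
    by (intro left_module_morphism.intro left_module_morphism_axioms.intro M.left_module_axioms T p)
  have eq: "p (inv_into (carrier M) f (f x)) = p x" if "x \<in> carrier M" for x
  proof -
    have "inv_into (carrier M) f (f x) \<in> carrier M" "f (inv_into (carrier M) f (f x)) = f x"
      using that inv_into_into[of "f x" f "carrier M"] f_inv_into_f[of "f x" f "carrier M"] by auto
    then show ?thesis using that ker f_eq_iff p.f_eq_iff by auto
  qed
  show "(\<lambda>y. p (inv_into (carrier M) f y)) \<in> left_module_hom A N T"
  proof (rule left_module_homI)
    fix x assume "x \<in> carrier N"
    then obtain u where "u \<in> carrier M" "x = f u" using surj by blast
    then show "p (inv_into (carrier M) f x) \<in> carrier T" by (simp add: eq p.f_closed)
  next
    fix x y assume "x \<in> carrier N" "y \<in> carrier N"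
    then obtain u v where "u \<in> carrier M" "x = f u" "v \<in> carrier M" "y = f v" using surj by blast
    then show "p (inv_into (carrier M) f (x \<oplus>\<^bsub>N\<^esub> y)) =
      p (inv_into (carrier M) f x) \<oplus>\<^bsub>T\<^esub> p (inv_into (carrier M) f y)"
      by (simp add: eq f_add[symmetric] p.f_add)
  next
    fix a x assume "a \<in> carrier A" "x \<in> carrier N"
    then obtain u where "a \<in> carrier A" "u \<in> carrier M" "x = f u" using surj by blast
    then show "p (inv_into (carrier M) f (a \<odot>\<^bsub>N\<^esub> x)) = a \<odot>\<^bsub>T\<^esub> p (inv_into (carrier M) f x)"
      by (simp add: eq f_smult[symmetric] p.f_smult)
  qed
  show "x \<in> carrier M \<Longrightarrow> p (inv_into (carrier M) f (f x)) = p x" by (rule eq)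
qed

end

lemma left_module_morphismI:
  "left_module A M \<Longrightarrow> left_module A N \<Longrightarrow> f \<in> left_module_hom A M N \<Longrightarrow> left_module_morphism A M N f"
  by (intro left_module_morphism.intro left_module_morphism_axioms.intro)

definition isomorphic_modules ::
  "('a, 'k) ring_scheme \<Rightarrow> ('a, 'c, 'l) module_scheme \<Rightarrow> ('a, 'd, 'm) module_scheme \<Rightarrow> bool" where
  "isomorphic_modules A M N \<longleftrightarrow> (\<exists>f\<in>left_module_hom A M N. bij_betw f (carrier M) (carrier N))"

lemma isomorphic_modules_refl: "isomorphic_modules A M M"
  unfolding isomorphic_modules_def
  by (rule bexI[of _ "\<lambda>x. x"]) (auto simp: left_module_hom_def bij_betw_def)

text \<open>The inverse map is linear because it is the identity of \<open>M\<close> descended along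
  \<open>f\<close>, whose kernel is null.\<close>

lemma isomorphic_modules_sym:
  assumes "left_module A M" "left_module A N" "isomorphic_modules A M N"
  shows "isomorphic_modules A N M"
proof -
  obtain f where f: "f \<in> left_module_hom A M N" "bij_betw f (carrier M) (carrier N)"
    using assms(3) unfolding isomorphic_modules_def by blast
  interpret h: left_module_morphism A M N f by (rule left_module_morphismI) fact+
  have id: "(\<lambda>x. x) \<in> left_module_hom A M M" by (simp add: left_module_hom_def)
  have "x = \<zero>\<^bsub>M\<^esub>" if "x \<in> carrier M" "f x = \<zero>\<^bsub>N\<^esub>" for x
    using that f(2) by (auto simp: bij_betw_def dest: inj_onD[of f _ x "\<zero>\<^bsub>M\<^esub>"])
  then have "inv_into (carrier M) f \<in> left_module_hom A N M"
    using h.hom_factor(1)[OF assms(1) id] f(2) by (auto simp: bij_betw_def)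
  then show ?thesis using bij_betw_inv_into[OF f(2)] unfolding isomorphic_modules_def by blast
qed

lemma isomorphic_modules_trans:
  assumes "isomorphic_modules A M N" "isomorphic_modules A N P"
  shows "isomorphic_modules A M P"
proof -
  obtain f g where "f \<in> left_module_hom A M N" "bij_betw f (carrier M) (carrier N)"
    "g \<in> left_module_hom A N P" "bij_betw g (carrier N) (carrier P)"
    using assms unfolding isomorphic_modules_def by blast
  then show ?thesis unfolding isomorphic_modules_def
    using left_module_hom_comp[of f A M N g P] bij_betw_trans[of f "carrier M" "carrier N" g "carrier P"]
    by (auto simp: comp_def)
qed

section \<open>Simple modules and the Jordan-Hoelder theorem\<close>

definition simple_module :: "('a, 'k) ring_scheme \<Rightarrow> ('a, 'c, 'l) module_scheme \<Rightarrow> bool" where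
  "simple_module A T \<longleftrightarrow> left_module A T \<and> carrier T \<noteq> {\<zero>\<^bsub>T\<^esub>} \<and>
     (\<forall>N. submod A T N \<longrightarrow> N = {\<zero>\<^bsub>T\<^esub>} \<or> N = carrier T)"

text \<open>\<open>composition A \<T> M c\<close>: the module \<open>M\<close> has a composition series whose factors, counted with
  multiplicity, form the formal sum \<open>c\<close> of members of \<open>\<T>\<close>.\<close>

inductive composition ::
  "('a, 'k) ring_scheme \<Rightarrow> ('a, 'd) module set \<Rightarrow> ('a, 'c) module \<Rightarrow> (('a, 'd) module \<Rightarrow>\<^sub>0 int) \<Rightarrow> bool"
  for A :: "('a, 'k) ring_scheme" and \<T> :: "('a, 'd) module set" where
  null: "left_module A M \<Longrightarrow> carrier M = {\<zero>\<^bsub>M\<^esub>} \<Longrightarrow> composition A \<T> M 0"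
| step: "left_module A M \<Longrightarrow> T \<in> \<T> \<Longrightarrow> p \<in> left_module_hom A M T \<Longrightarrow> p ` carrier M = carrier T \<Longrightarrow>
    composition A \<T> (M\<lparr>carrier := {x \<in> carrier M. p x = \<zero>\<^bsub>T\<^esub>}\<rparr>) c \<Longrightarrow>
    composition A \<T> M (c + frag_of T)"

lemma composition_left_module: "composition A \<T> M c \<Longrightarrow> left_module A M"
  by (induction rule: composition.induct) auto

lemma composition_nonneg: "composition A \<T> M c \<Longrightarrow> Poly_Mapping.lookup c T \<ge> 0"
  by (induction rule: composition.induct) (auto simp: lookup_add)

lemma keys_composition: "composition A \<T> M c \<Longrightarrow> Poly_Mapping.keys c \<subseteq> \<T>"
proof (induction rule: composition.induct)
  case (step M T p c)
  then show ?case using keys_add[of c "frag_of T"] by auto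
qed simp

text \<open>Members of \<open>\<T>\<close> serve as labels of composition factors. Isomorphic labels
  must coincide, since otherwise one module could carry several formal sums.\<close>

locale simple_modules =
  fixes A :: "('a, 'k) ring_scheme" and \<T> :: "('a, 'd) module set"
  assumes simple: "T \<in> \<T> \<Longrightarrow> simple_module A T"
    and iso_imp_eq: "T \<in> \<T> \<Longrightarrow> T' \<in> \<T> \<Longrightarrow> isomorphic_modules A T T' \<Longrightarrow> T = T'"
begin

lemma left_module_simple: "T \<in> \<T> \<Longrightarrow> left_module A T"
  using simple by (simp add: simple_module_def)

text \<open>Each projection onto a factor descends along \<open>f\<close>, and the kernels
  correspond under \<open>f\<close>, so the labels do not change.\<close>

lemma composition_iso:
  assumes "composition A \<T> M c" "left_module A N" "f \<in> left_module_hom A M N" "bij_betw f (carrier M) (carrier N)"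
  shows "composition A \<T> N c"
  using assms
proof (induction arbitrary: N rule: composition.induct)
  case (null M)
  interpret f: left_module_morphism A M N f by (rule left_module_morphismI) (use null in auto)
  have "carrier N = {\<zero>\<^bsub>N\<^esub>}" using null by (auto simp: bij_betw_def)
  then show ?case using null by (intro composition.null)
next
  case (step M T p c)
  interpret f: left_module_morphism A M N f by (rule left_module_morphismI) (use step in auto)
  interpret p: left_module_morphism A M T p by (rule left_module_morphismI) (use step left_module_simple in auto)
  let ?K = "{x \<in> carrier M. p x = \<zero>\<^bsub>T\<^esub>}"
  have fs: "f ` carrier M = carrier N" "inj_on f (carrier M)" using step.prems by (auto simp: bij_betw_def)
  have fz: "p x = \<zero>\<^bsub>T\<^esub>" if "x \<in> carrier M" "f x = \<zero>\<^bsub>N\<^esub>" for x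
    using that inj_onD[OF fs(2), of x "\<zero>\<^bsub>M\<^esub>"] by simp
  let ?q = "\<lambda>y. p (inv_into (carrier M) f y)"
  note q = f.hom_factor[OF left_module_simple[OF step.hyps(2)] step.hyps(3) fs(1) fz]
  have onto: "?q ` carrier N = carrier T"
    unfolding fs(1)[symmetric] image_image using q(2) step.hyps(4) by auto
  have ker: "{y \<in> carrier N. ?q y = \<zero>\<^bsub>T\<^esub>} = f ` ?K" unfolding fs(1)[symmetric] using q(2) by auto
  have "composition A \<T> (N\<lparr>carrier := f ` ?K\<rparr>) c"
  proof (rule step.IH)
    show "left_module A (N\<lparr>carrier := f ` ?K\<rparr>)"
      by (intro f.N.left_module_sub f.submod_image p.submod_kernel)
    show "f \<in> left_module_hom A (M\<lparr>carrier := ?K\<rparr>) (N\<lparr>carrier := f ` ?K\<rparr>)"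
      by (rule left_module_hom_sub) (use step in auto)
    show "bij_betw f (carrier (M\<lparr>carrier := ?K\<rparr>)) (carrier (N\<lparr>carrier := f ` ?K\<rparr>))"
      using inj_on_subset[OF fs(2), of ?K] by (auto simp: bij_betw_def)
  qed
  then show ?case
    by (intro composition.step[OF step.prems(1) step.hyps(2) q(1) onto]) (simp_all add: ker)
qed

text \<open>The heart of Jordan-Hoelder. The first projection \<open>p\<close> sends the kernel of
  \<open>g\<close> to a submodule of the simple module \<open>T\<close>. If that image is all of
  \<open>T\<close>, the factor \<open>T\<close> belongs to the kernel of \<open>g\<close>; if it is
  null, \<open>T\<close> belongs to \<open>N\<close>. The remaining factors are distributed by
  induction, with \<open>g\<close> restricted to the kernel of \<open>p\<close>.\<close>

lemma composition_split:
  assumes "composition A \<T> M c" "left_module A N" "g \<in> left_module_hom A M N" "g ` carrier M = carrier N"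
  shows "\<exists>c' c''. c = c' + c'' \<and> composition A \<T> (M\<lparr>carrier := {x \<in> carrier M. g x = \<zero>\<^bsub>N\<^esub>}\<rparr>) c' \<and>
    composition A \<T> N c''"
  using assms
proof (induction arbitrary: N rule: composition.induct)
  case (null M)
  interpret g: left_module_morphism A M N g by (rule left_module_morphismI) (use null in auto)
  have "carrier N = {\<zero>\<^bsub>N\<^esub>}" using null by auto
  moreover have "left_module A (M\<lparr>carrier := {x \<in> carrier M. g x = \<zero>\<^bsub>N\<^esub>}\<rparr>)"
    by (intro g.M.left_module_sub g.submod_kernel)
  ultimately show ?case using null by (intro exI[of _ 0] conjI composition.null) auto
next
  case (step M T p c)
  interpret g: left_module_morphism A M N g by (rule left_module_morphismI) (use step in auto)
  interpret p: left_module_morphism A M T p by (rule left_module_morphismI) (use step left_module_simple in auto)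
  let ?K = "{x \<in> carrier M. p x = \<zero>\<^bsub>T\<^esub>}" and ?L = "{x \<in> carrier M. g x = \<zero>\<^bsub>N\<^esub>}"
  have "\<exists>c' c''. c = c' + c'' \<and>
    composition A \<T> (M\<lparr>carrier := ?K\<rparr>\<lparr>carrier := {x \<in> carrier (M\<lparr>carrier := ?K\<rparr>). g x = \<zero>\<^bsub>N\<lparr>carrier := g ` ?K\<rparr>\<^esub>}\<rparr>) c' \<and>
    composition A \<T> (N\<lparr>carrier := g ` ?K\<rparr>) c''"
  proof (rule step.IH)
    show "left_module A (N\<lparr>carrier := g ` ?K\<rparr>)"
      by (intro g.N.left_module_sub g.submod_image p.submod_kernel)
    show "g \<in> left_module_hom A (M\<lparr>carrier := ?K\<rparr>) (N\<lparr>carrier := g ` ?K\<rparr>)"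
      by (rule left_module_hom_sub) (use step in auto)
  qed simp
  then obtain c' c'' where c: "c = c' + c''" "composition A \<T> (M\<lparr>carrier := {x \<in> ?K. g x = \<zero>\<^bsub>N\<^esub>}\<rparr>) c'"
    "composition A \<T> (N\<lparr>carrier := g ` ?K\<rparr>) c''" by auto
  have L: "submod A M ?L" by (rule g.submod_kernel)
  have "p ` ?L = {\<zero>\<^bsub>T\<^esub>} \<or> p ` ?L = carrier T"
    using simple[OF step.hyps(2)] p.submod_image[OF L] by (simp add: simple_module_def)
  then show ?case
  proof
    assume pL: "p ` ?L = carrier T"
    have ker: "{x \<in> ?L. p x = \<zero>\<^bsub>T\<^esub>} = {x \<in> ?K. g x = \<zero>\<^bsub>N\<^esub>}" by auto
    have hom: "p \<in> left_module_hom A (M\<lparr>carrier := ?L\<rparr>) T"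
      using left_module_hom_sub[OF step.hyps(3), of ?L "carrier T"] p.f_closed by auto
    have "composition A \<T> (M\<lparr>carrier := ?L\<rparr>) (c' + frag_of T)"
      by (rule composition.step[OF g.M.left_module_sub[OF L] step.hyps(2) hom]) (use pL ker c(2) in simp_all)
    \<comment> \<open>Any \<open>m\<close> can be corrected by some \<open>z\<close> in the kernel
      of \<open>g\<close> with \<open>p z = p m\<close>; then \<open>m - z\<close> lies in the
      kernel of \<open>p\<close> and has the same image under \<open>g\<close>.\<close>
    moreover have "g ` ?K = carrier N"
    proof
      show "carrier N \<subseteq> g ` ?K"
      proof
        fix y assume "y \<in> carrier N"
        then obtain m where m: "m \<in> carrier M" "y = g m" using step.prems(3) by blast
        have "p m \<in> p ` ?L" using m(1) pL p.f_closed by simp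
        then obtain z where z: "z \<in> carrier M" "g z = \<zero>\<^bsub>N\<^esub>" "p z = p m" by auto
        have "p (m \<ominus>\<^bsub>M\<^esub> z) = \<zero>\<^bsub>T\<^esub>" using p.f_eq_iff[of m z] m z by simp
        moreover have "g m \<ominus>\<^bsub>N\<^esub> \<zero>\<^bsub>N\<^esub> = g m" using m g.f_closed by (simp add: a_minus_def)
        then have "g (m \<ominus>\<^bsub>M\<^esub> z) = y" using m z by (simp add: g.f_diff)
        ultimately show "y \<in> g ` ?K" using m z by (intro image_eqI[of _ _ "m \<ominus>\<^bsub>M\<^esub> z"]) auto
      qed
    qed (use g.f_closed in auto)
    then have "composition A \<T> N c''" using c(3) by simp
    ultimately show ?thesis using c(1)
      by (intro exI[of _ "c' + frag_of T"] exI[of _ c'']) (simp add: algebra_simps)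
  next
    assume pL: "p ` ?L = {\<zero>\<^bsub>T\<^esub>}"
    have "{x \<in> ?K. g x = \<zero>\<^bsub>N\<^esub>} = ?L" using pL by auto
    then have "composition A \<T> (M\<lparr>carrier := ?L\<rparr>) c'" using c(2) by simp
    \<comment> \<open>As \<open>p\<close> vanishes on the kernel of \<open>g\<close>, it descends to
      a projection of \<open>N\<close> onto \<open>T\<close>, whose kernel is the image of
      \<open>?K\<close>.\<close>
    moreover have "composition A \<T> N (c'' + frag_of T)"
    proof -
      let ?q = "\<lambda>y. p (inv_into (carrier M) g y)"
      have gz: "p x = \<zero>\<^bsub>T\<^esub>" if "x \<in> carrier M" "g x = \<zero>\<^bsub>N\<^esub>" for x using that pL by auto
      note q = g.hom_factor[OF left_module_simple[OF step.hyps(2)] step.hyps(3) step.prems(3) gz]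
      have onto: "?q ` carrier N = carrier T"
        unfolding step.prems(3)[symmetric] image_image using q(2) step.hyps(4) by auto
      have ker: "{y \<in> carrier N. ?q y = \<zero>\<^bsub>T\<^esub>} = g ` ?K"
        unfolding step.prems(3)[symmetric] using q(2) by auto
      show ?thesis
        by (intro composition.step[OF step.prems(1) step.hyps(2) q(1) onto]) (simp_all add: ker c(3))
    qed
    ultimately show ?thesis using c(1)
      by (intro exI[of _ c'] exI[of _ "c'' + frag_of T"]) (simp add: algebra_simps)
  qed
qed

lemma composition_null:
  assumes "composition A \<T> M c" "carrier M = {\<zero>\<^bsub>M\<^esub>}"
  shows "c = 0"
  using assms(1)
proof cases
  case (step T p c')
  interpret p: left_module_morphism A M T p by (rule left_module_morphismI) (use step left_module_simple in auto)
  have "carrier T = {\<zero>\<^bsub>T\<^esub>}" using step(5) assms(2) by auto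
  then show ?thesis using simple[OF step(3)] by (simp add: simple_module_def)
qed

text \<open>A surjection between simple modules is an isomorphism by Schur's argument, which for
  labels means equality; the kernel left over is null and contributes nothing.\<close>

lemma composition_simple:
  assumes c: "composition A \<T> T c" and T: "T \<in> \<T>"
  shows "c = frag_of T"
  using c
proof cases
  case null
  then show ?thesis using simple[OF T] by (simp add: simple_module_def)
next
  case (step T' p c')
  interpret p: left_module_morphism A T T' p by (rule left_module_morphismI) (use step T left_module_simple in auto)
  let ?K = "{x \<in> carrier T. p x = \<zero>\<^bsub>T'\<^esub>}"
  have "?K \<noteq> carrier T"
  proof
    assume "?K = carrier T"
    then have "p x = \<zero>\<^bsub>T'\<^esub>" if "x \<in> carrier T" for x using that by blast
    then have "p ` carrier T \<subseteq> {\<zero>\<^bsub>T'\<^esub>}" by auto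
    then have "carrier T' = {\<zero>\<^bsub>T'\<^esub>}" using step(5) submod_zero[OF p.N.submod_self] by auto
    then show False using simple[OF step(3)] by (simp add: simple_module_def)
  qed
  then have K: "?K = {\<zero>\<^bsub>T\<^esub>}" using simple[OF T] p.submod_kernel by (auto simp: simple_module_def)
  have "inj_on p (carrier T)"
  proof (rule inj_onI)
    fix x y assume "x \<in> carrier T" "y \<in> carrier T" "p x = p y"
    then have "x \<ominus>\<^bsub>T\<^esub> y \<in> ?K" by (simp add: p.f_eq_iff)
    then show "x = y" using \<open>x \<in> carrier T\<close> \<open>y \<in> carrier T\<close> K by (simp add: p.M.diff_eq_zero_iff)
  qed
  then have "isomorphic_modules A T T'"
    unfolding isomorphic_modules_def bij_betw_def using step by blast
  then have "T = T'" using T step(3) by (rule iso_imp_eq[rotated -1])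
  moreover have "c' = 0" by (rule composition_null[OF step(6)]) (simp add: K)
  ultimately show ?thesis using step by simp
qed

text \<open>The second series is split along the first projection \<open>p\<close> of the first one:
  its part in the kernel of \<open>p\<close> agrees with \<open>c\<close> by induction, and its part
  over \<open>T\<close> is the single label \<open>T\<close>.\<close>

lemma composition_unique:
  assumes "composition A \<T> M c" "composition A \<T> M d"
  shows "c = d"
  using assms
proof (induction arbitrary: d rule: composition.induct)
  case (null M)
  then show ?case using composition_null by metis
next
  case (step M T p c)
  obtain d' d'' where d: "d = d' + d''"
    "composition A \<T> (M\<lparr>carrier := {x \<in> carrier M. p x = \<zero>\<^bsub>T\<^esub>}\<rparr>) d'" "composition A \<T> T d''"
    using composition_split[OF step.prems left_module_simple step.hyps(3,4)] step.hyps(2) by blast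
  then show ?case using step.IH[OF d(2)] composition_simple[OF d(3) step.hyps(2)] by simp
qed

text \<open>This additivity is what lets multiplicities of composition factors descend to the
  Grothendieck group. The series of \<open>M\<close> is split along the surjection, whose kernel is
  a copy of \<open>M'\<close> by way of \<open>f\<close>.\<close>

lemma composition_short_exact:
  assumes exact: "short_exact A M' M M''" and M: "left_module A M'" "left_module A M''"
    and c: "composition A \<T> M' c'" "composition A \<T> M c" "composition A \<T> M'' c''"
  shows "c = c' + c''"
proof -
  obtain f g where f: "f \<in> left_module_hom A M' M" "inj_on f (carrier M')"
    and g: "g \<in> left_module_hom A M M''" "g ` carrier M = carrier M''"
    and fg: "f ` carrier M' = {x \<in> carrier M. g x = \<zero>\<^bsub>M''\<^esub>}"
    using exact unfolding short_exact_def by blast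
  have lM: "left_module A M" using c(2) by (rule composition_left_module)
  interpret g: left_module_morphism A M M'' g by (rule left_module_morphismI[OF lM M(2) g(1)])
  let ?K = "{x \<in> carrier M. g x = \<zero>\<^bsub>M''\<^esub>}"
  obtain d' d'' where d: "c = d' + d''" "composition A \<T> (M\<lparr>carrier := ?K\<rparr>) d'" "composition A \<T> M'' d''"
    using composition_split[OF c(2) M(2) g] by blast
  have "composition A \<T> (M\<lparr>carrier := ?K\<rparr>) c'"
  proof (rule composition_iso[OF c(1)])
    show "left_module A (M\<lparr>carrier := ?K\<rparr>)" by (intro g.M.left_module_sub g.submod_kernel)
    show "f \<in> left_module_hom A M' (M\<lparr>carrier := ?K\<rparr>)"
      using left_module_hom_sub[OF f(1), of "carrier M'" ?K] fg by (simp add: left_module_hom_def)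
    show "bij_betw f (carrier M') (carrier (M\<lparr>carrier := ?K\<rparr>))" using f(2) fg by (simp add: bij_betw_def)
  qed
  then show ?thesis using d composition_unique c(3) by metis
qed

end

section \<open>Modules of finite length\<close>

context left_module
begin

lemma smult_r_minus:
  assumes "a \<in> carrier A" "x \<in> carrier M"
  shows "a \<odot>\<^bsub>M\<^esub> (\<ominus>\<^bsub>M\<^esub> x) = \<ominus>\<^bsub>M\<^esub> (a \<odot>\<^bsub>M\<^esub> x)"
proof -
  have "a \<odot>\<^bsub>M\<^esub> (\<ominus>\<^bsub>M\<^esub> x) \<oplus>\<^bsub>M\<^esub> a \<odot>\<^bsub>M\<^esub> x = \<zero>\<^bsub>M\<^esub>"
    using assms by (simp add: smult_r_distr[symmetric] M.l_neg)
  then show ?thesis using assms by (simp add: M.minus_equality)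
qed

lemma diff_zero: "x \<in> carrier M \<Longrightarrow> x \<ominus>\<^bsub>M\<^esub> \<zero>\<^bsub>M\<^esub> = x"
  by (simp add: a_minus_def)

lemma smult_r_diff:
  "a \<in> carrier A \<Longrightarrow> x \<in> carrier M \<Longrightarrow> y \<in> carrier M \<Longrightarrow> a \<odot>\<^bsub>M\<^esub> (x \<ominus>\<^bsub>M\<^esub> y) = a \<odot>\<^bsub>M\<^esub> x \<ominus>\<^bsub>M\<^esub> a \<odot>\<^bsub>M\<^esub> y"
  by (simp add: a_minus_def smult_r_distr smult_r_minus)

text \<open>A maximal one among the finitely generated submodules of \<open>N\<close> must be
  \<open>N\<close>, since any further element could be adjoined to it.\<close>

lemma finitely_generated_if_noetherian:
  assumes noeth: "noetherian_module A M" and N: "submod A M N"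
  shows "finitely_generated_module A (M\<lparr>carrier := N\<rparr>)"
proof -
  let ?gen = "\<lambda>P. \<exists>B. finite B \<and> B \<subseteq> P \<and> (\<forall>Q. submod A M Q \<and> B \<subseteq> Q \<longrightarrow> P \<subseteq> Q)"
  let ?Q = "{P. submod A M P \<and> P \<subseteq> N \<and> ?gen P}"
  have "{\<zero>\<^bsub>M\<^esub>} \<in> ?Q"
    using submod_null submod_zero[OF N] submod_zero[of A M] by (auto intro!: exI[of _ "{}"])
  then obtain P where P: "P \<in> ?Q" and max: "\<And>R. (R, P) \<in> (proper_submods A M)\<inverse> \<Longrightarrow> R \<notin> ?Q"
    by (rule wfE_min[OF noeth]) (rule that)
  have sP: "submod A M P" "P \<subseteq> N" and "?gen P" using P by simp_all
  from this(3) obtain B where "finite B \<and> B \<subseteq> P \<and> (\<forall>Q. submod A M Q \<and> B \<subseteq> Q \<longrightarrow> P \<subseteq> Q)" by (rule exE)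
  then have B: "finite B" "B \<subseteq> P" "\<And>Q. submod A M Q \<Longrightarrow> B \<subseteq> Q \<Longrightarrow> P \<subseteq> Q" by simp_all
  have "P = N"
  proof (rule ccontr)
    assume "P \<noteq> N"
    then obtain x where x: "x \<in> N" "x \<notin> P" using sP by blast
    have xM: "x \<in> carrier M" using submod_carrier[OF N x(1)] .
    let ?R = "{y \<in> carrier M. \<exists>a\<in>carrier A. y \<oplus>\<^bsub>M\<^esub> a \<odot>\<^bsub>M\<^esub> x \<in> P}"
    note R = submod_adjoin[OF sP(1) xM] submod_adjoin_superset[OF sP(1) xM]
    have sub: "?R \<subseteq> Q" if Q: "submod A M Q" "insert x B \<subseteq> Q" for Q
    proof
      fix y assume "y \<in> ?R"
      then obtain a where a: "y \<in> carrier M" "a \<in> carrier A" "y \<oplus>\<^bsub>M\<^esub> a \<odot>\<^bsub>M\<^esub> x \<in> P" by blast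
      have "a \<odot>\<^bsub>M\<^esub> x \<in> Q" using submod_smult[OF Q(1) a(2)] Q(2) by simp
      moreover have "y \<oplus>\<^bsub>M\<^esub> a \<odot>\<^bsub>M\<^esub> x \<in> Q" using a(3) B(3)[OF Q(1)] Q(2) by auto
      ultimately show "y \<in> Q" using submod_mem_add_cancel[OF Q(1)] a(1) by blast
    qed
    have "insert x B \<subseteq> N" using x B sP by blast
    then have "?R \<subseteq> N" using sub N by blast
    moreover have "?gen ?R"
      by (intro exI[of _ "insert x B"]) (use B sub R in blast)
    ultimately have "?R \<in> ?Q" using R(1) by simp
    moreover have "(?R, P) \<in> (proper_submods A M)\<inverse>" using R sP x by (auto simp: proper_submods_def)
    ultimately show False using max by blast
  qed
  interpret N: left_module A "M\<lparr>carrier := N\<rparr>" by (rule left_module_sub[OF N])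
  show ?thesis unfolding N.finitely_generated_iff
  proof (intro exI[of _ B] conjI allI impI)
    fix Q assume "submod A (M\<lparr>carrier := N\<rparr>) Q \<and> B \<subseteq> Q"
    then have "submod A M Q" "Q \<subseteq> N" "B \<subseteq> Q" by (simp_all add: submod_sub_iff[OF N])
    then show "Q = carrier (M\<lparr>carrier := N\<rparr>)" using B(3)[of Q] \<open>P = N\<close> by auto
  qed (use B \<open>P = N\<close> in auto)
qed

end

lemma finitely_generated_image:
  assumes f: "left_module_morphism A M N f" and "f ` carrier M = carrier N"
    and "finitely_generated_module A M"
  shows "finitely_generated_module A N"
proof -
  interpret left_module_morphism A M N f by fact
  obtain B where B: "finite B" "B \<subseteq> carrier M" "\<And>V. submod A M V \<Longrightarrow> B \<subseteq> V \<Longrightarrow> V = carrier M"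
    using assms(3) unfolding M.finitely_generated_iff by blast
  show ?thesis unfolding N.finitely_generated_iff
  proof (intro exI[of _ "f ` B"] conjI allI impI)
    fix V assume V: "submod A N V \<and> f ` B \<subseteq> V"
    have "submod A M {x \<in> carrier M. f x \<in> V}"
      by (rule submodI) (use V in \<open>auto simp: f_add f_smult intro: submod_zero submod_add submod_smult\<close>)
    moreover have "B \<subseteq> {x \<in> carrier M. f x \<in> V}" using V B(2) by auto
    ultimately have "{x \<in> carrier M. f x \<in> V} = carrier M" using B(3) by blast
    then have "f ` carrier M \<subseteq> V" by blast
    then show "V = carrier N" using V assms(2) submod_subset[of A N V] by auto
  qed (use B assms(2) in auto)
qed

text \<open>The quotient is carried by a system of representatives of the cosets, so that its elements
  have the same type as those of \<open>M\<close>.\<close>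

lemma ex_quotient_module:
  fixes M :: "('a, 'c) module"
  assumes M: "left_module A M" and N: "submod A M N"
  obtains Q :: "('a, 'c) module" and p where "left_module A Q" "p \<in> left_module_hom A M Q"
    "p ` carrier M = carrier Q" "{x \<in> carrier M. p x = \<zero>\<^bsub>Q\<^esub>} = N"
proof -
  interpret left_module A M by fact
  define j where "j x = (SOME y. y \<in> carrier M \<and> y \<ominus>\<^bsub>M\<^esub> x \<in> N)" for x
  have j: "j x \<in> carrier M" "j x \<ominus>\<^bsub>M\<^esub> x \<in> N" if "x \<in> carrier M" for x
  proof -
    have "x \<in> carrier M \<and> x \<ominus>\<^bsub>M\<^esub> x \<in> N"
      using that submod_zero[OF N] diff_eq_zero_iff[of x x] by simp
    then have "j x \<in> carrier M \<and> j x \<ominus>\<^bsub>M\<^esub> x \<in> N" unfolding j_def by (rule someI)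
    then show "j x \<in> carrier M" "j x \<ominus>\<^bsub>M\<^esub> x \<in> N" by simp_all
  qed
  have trans: "x \<ominus>\<^bsub>M\<^esub> z \<in> N"
    if "x \<in> carrier M" "y \<in> carrier M" "z \<in> carrier M" "x \<ominus>\<^bsub>M\<^esub> y \<in> N" "y \<ominus>\<^bsub>M\<^esub> z \<in> N" for x y z
  proof -
    have "(x \<ominus>\<^bsub>M\<^esub> y) \<oplus>\<^bsub>M\<^esub> (y \<ominus>\<^bsub>M\<^esub> z) = x \<ominus>\<^bsub>M\<^esub> z"
      using that by (simp add: a_minus_def M.a_assoc M.r_neg2 M.r_neg1)
    then show ?thesis using submod_add[OF N that(4,5)] by simp
  qed
  have sym: "y \<ominus>\<^bsub>M\<^esub> x \<in> N" if "x \<in> carrier M" "y \<in> carrier M" "x \<ominus>\<^bsub>M\<^esub> y \<in> N" for x y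
  proof -
    have "\<ominus>\<^bsub>M\<^esub> (x \<ominus>\<^bsub>M\<^esub> y) = y \<ominus>\<^bsub>M\<^esub> x" using that by (simp add: a_minus_def M.minus_add M.a_comm)
    then show ?thesis using submod_a_inv[OF N that(3)] by simp
  qed
  \<comment> \<open>Congruent elements give equivalent predicates, from which \<open>SOME\<close>
    picks the same element; so \<open>j\<close> depends only on the coset.\<close>
  have j_eq: "j x = j y" if "x \<in> carrier M" "y \<in> carrier M" "x \<ominus>\<^bsub>M\<^esub> y \<in> N" for x y
  proof -
    have "(z \<in> carrier M \<and> z \<ominus>\<^bsub>M\<^esub> x \<in> N) = (z \<in> carrier M \<and> z \<ominus>\<^bsub>M\<^esub> y \<in> N)" for z
      using that trans sym by blast
    then show ?thesis by (simp add: j_def)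
  qed
  have j_eqD: "x \<ominus>\<^bsub>M\<^esub> y \<in> N" if "x \<in> carrier M" "y \<in> carrier M" "j x = j y" for x y
    using that j[of x] j[of y] trans[of x "j x" y] sym[of "j x" x] by simp
  have j_add: "j (j x \<oplus>\<^bsub>M\<^esub> j y) = j (x \<oplus>\<^bsub>M\<^esub> y)" if xy: "x \<in> carrier M" "y \<in> carrier M" for x y
  proof (rule j_eq)
    have "(j x \<oplus>\<^bsub>M\<^esub> j y) \<ominus>\<^bsub>M\<^esub> (x \<oplus>\<^bsub>M\<^esub> y) = (j x \<ominus>\<^bsub>M\<^esub> x) \<oplus>\<^bsub>M\<^esub> (j y \<ominus>\<^bsub>M\<^esub> y)"
      using xy j(1) by (simp add: a_minus_def M.minus_add M.a_ac)
    then show "(j x \<oplus>\<^bsub>M\<^esub> j y) \<ominus>\<^bsub>M\<^esub> (x \<oplus>\<^bsub>M\<^esub> y) \<in> N" using submod_add[OF N] xy j by simp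
  qed (use xy j in auto)
  have j_idem: "j (j x) = j x" if "x \<in> carrier M" for x using that j j_eq by blast
  have j_add': "j (j x \<oplus>\<^bsub>M\<^esub> y) = j (x \<oplus>\<^bsub>M\<^esub> y)" "j (y \<oplus>\<^bsub>M\<^esub> j x) = j (y \<oplus>\<^bsub>M\<^esub> x)"
    if xy: "x \<in> carrier M" "y \<in> carrier M" for x y
    using j_add[of "j x" y] j_add[of x y] j_add[of y "j x"] j_add[of y x] xy j(1) j_idem by simp_all
  have j_smult: "j (a \<odot>\<^bsub>M\<^esub> j x) = j (a \<odot>\<^bsub>M\<^esub> x)" if "a \<in> carrier A" "x \<in> carrier M" for a x
    using that j submod_smult[OF N, of a "j x \<ominus>\<^bsub>M\<^esub> x"] by (intro j_eq) (simp_all add: smult_r_diff)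
  \<comment> \<open>The operations are those of \<open>M\<close> followed by normalization. The
    module laws carry over because an inner \<open>j\<close> may be dropped under an outer
    one.\<close>
  define Q :: "('a, 'c) module" where
    "Q = \<lparr>carrier = j ` carrier M, monoid.mult = monoid.mult M, one = one M, ring.zero = j \<zero>\<^bsub>M\<^esub>,
      add = (\<lambda>u v. j (u \<oplus>\<^bsub>M\<^esub> v)), smult = (\<lambda>a u. j (a \<odot>\<^bsub>M\<^esub> u))\<rparr>"
  have Q [simp]: "carrier Q = j ` carrier M" "\<zero>\<^bsub>Q\<^esub> = j \<zero>\<^bsub>M\<^esub>"
    "u \<oplus>\<^bsub>Q\<^esub> v = j (u \<oplus>\<^bsub>M\<^esub> v)" "a \<odot>\<^bsub>Q\<^esub> u = j (a \<odot>\<^bsub>M\<^esub> u)" for u v a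
    by (simp_all add: Q_def)
  have "abelian_group Q"
  proof (rule abelian_groupI)
    fix u assume "u \<in> carrier Q"
    then obtain m where m: "m \<in> carrier M" "u = j m" by auto
    then have "j (\<ominus>\<^bsub>M\<^esub> m) \<in> carrier Q" "j (\<ominus>\<^bsub>M\<^esub> m) \<oplus>\<^bsub>Q\<^esub> u = \<zero>\<^bsub>Q\<^esub>"
      by (simp_all add: j_add M.l_neg)
    then show "\<exists>y\<in>carrier Q. y \<oplus>\<^bsub>Q\<^esub> u = \<zero>\<^bsub>Q\<^esub>" by blast
  next
    fix u v w assume "u \<in> carrier Q" "v \<in> carrier Q" "w \<in> carrier Q"
    then obtain x y z where "x \<in> carrier M" "u = j x" "y \<in> carrier M" "v = j y" "z \<in> carrier M" "w = j z" by auto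
    then show "u \<oplus>\<^bsub>Q\<^esub> v \<oplus>\<^bsub>Q\<^esub> w = u \<oplus>\<^bsub>Q\<^esub> (v \<oplus>\<^bsub>Q\<^esub> w)" by (simp add: j_add M.a_assoc)
  qed (auto simp: j_add j_add' j_idem j(1) M.a_comm)
  have "left_module A Q"
  proof (intro left_module.intro A.ring_axioms left_module_axioms.intro \<open>abelian_group Q\<close>)
    fix a b u assume ab: "a \<in> carrier A" "b \<in> carrier A" and "u \<in> carrier Q"
    then obtain x where x: "x \<in> carrier M" "u = j x" by auto
    have *: "j ((a \<oplus>\<^bsub>A\<^esub> b) \<odot>\<^bsub>M\<^esub> j x) = j ((a \<oplus>\<^bsub>A\<^esub> b) \<odot>\<^bsub>M\<^esub> x)"
      "j ((a \<otimes>\<^bsub>A\<^esub> b) \<odot>\<^bsub>M\<^esub> j x) = j ((a \<otimes>\<^bsub>A\<^esub> b) \<odot>\<^bsub>M\<^esub> x)"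
      by (rule j_smult, use ab x in auto)+
    show "(a \<oplus>\<^bsub>A\<^esub> b) \<odot>\<^bsub>Q\<^esub> u = a \<odot>\<^bsub>Q\<^esub> u \<oplus>\<^bsub>Q\<^esub> b \<odot>\<^bsub>Q\<^esub> u"
      unfolding x(2) Q * using ab x by (simp add: j_smult j_add smult_l_distr)
    show "(a \<otimes>\<^bsub>A\<^esub> b) \<odot>\<^bsub>Q\<^esub> u = a \<odot>\<^bsub>Q\<^esub> (b \<odot>\<^bsub>Q\<^esub> u)"
      unfolding x(2) Q * using ab x by (simp add: j_smult smult_assoc1)
  qed (auto simp: j_add j_smult j_idem smult_r_distr j(1))
  moreover have "j \<in> left_module_hom A M Q"
    by (rule left_module_homI) (auto simp: j_add j_smult)
  moreover have "{x \<in> carrier M. j x = \<zero>\<^bsub>Q\<^esub>} = N"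
  proof (intro equalityI subsetI)
    fix x assume "x \<in> {x \<in> carrier M. j x = \<zero>\<^bsub>Q\<^esub>}"
    then show "x \<in> N" using j_eqD[of x "\<zero>\<^bsub>M\<^esub>"] by (simp add: diff_zero)
  next
    fix x assume "x \<in> N"
    then show "x \<in> {x \<in> carrier M. j x = \<zero>\<^bsub>Q\<^esub>}"
      using j_eq[of x "\<zero>\<^bsub>M\<^esub>"] submod_carrier[OF N] by (simp add: diff_zero)
  qed
  ultimately show thesis by (intro that[of Q j]) simp_all
qed

text \<open>Submodules of \<open>T\<close> have preimages between the kernel of \<open>p\<close> and
  \<open>M\<close>, where maximality leaves only the two extremes.\<close>

lemma simple_if_kernel_maximal:
  assumes f: "left_module_morphism A M T p" and onto: "p ` carrier M = carrier T"
    and K: "{x \<in> carrier M. p x = \<zero>\<^bsub>T\<^esub>} \<noteq> carrier M"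
    and max: "\<And>N. submod A M N \<Longrightarrow> {x \<in> carrier M. p x = \<zero>\<^bsub>T\<^esub>} \<subset> N \<Longrightarrow> N = carrier M"
  shows "simple_module A T"
  unfolding simple_module_def
proof (intro conjI allI impI)
  interpret left_module_morphism A M T p by fact
  show "left_module A T" by (rule N.left_module_axioms)
  show "carrier T \<noteq> {\<zero>\<^bsub>T\<^esub>}" using K onto by auto
  fix V assume V: "submod A T V"
  let ?V = "{x \<in> carrier M. p x \<in> V}" and ?K = "{x \<in> carrier M. p x = \<zero>\<^bsub>T\<^esub>}"
  have sV: "submod A M ?V"
    by (rule submodI) (use V in \<open>auto simp: f_add f_smult intro: submod_zero submod_add submod_smult\<close>)
  have img: "p ` ?V = V" using submod_subset[OF V] onto[symmetric] by auto
  show "V = {\<zero>\<^bsub>T\<^esub>} \<or> V = carrier T"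
  proof (cases "?V = ?K")
    case True
    then have "\<And>y. y \<in> V \<Longrightarrow> y = \<zero>\<^bsub>T\<^esub>" using img by auto
    then show ?thesis using submod_zero[OF V] by blast
  next
    case False
    then have "?K \<subset> ?V" using submod_zero[OF V] by auto
    then have "?V = carrier M" using max sV by blast
    then show ?thesis using img onto by simp
  qed
qed

section \<open>Rings whose finitely generated modules have finite length\<close>

locale finite_length_ring = ring A for A :: "('a, 'k) ring_scheme" (structure) +
  assumes artinian: "M \<in> fg_modules A \<Longrightarrow> artinian_module A M"
    and noetherian: "M \<in> fg_modules A \<Longrightarrow> noetherian_module A M"
begin

text \<open>The ascending chain condition keeps submodules finitely generated, so that the terms of
  a composition series have classes in the Grothendieck group.\<close>

lemma fg_modules_sub: "M \<in> fg_modules A \<Longrightarrow> submod A M N \<Longrightarrow> M\<lparr>carrier := N\<rparr> \<in> fg_modules A"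
  using noetherian[of M] left_module.left_module_sub[of A M N]
    left_module.finitely_generated_if_noetherian[of A M N]
  by (simp add: fg_modules_def)

lemma ex_quotient_fg:
  assumes M: "M \<in> fg_modules A" and N: "submod A M N"
  obtains T p where "T \<in> fg_modules A" "p \<in> left_module_hom A M T" "p ` carrier M = carrier T"
    "{x \<in> carrier M. p x = \<zero>\<^bsub>T\<^esub>} = N"
proof -
  have lM: "left_module A M" "finitely_generated_module A M" using M by (simp_all add: fg_modules_def)
  obtain T :: "('a, (nat \<Rightarrow> 'a) set) module" and p where T: "left_module A T" "p \<in> left_module_hom A M T" "p ` carrier M = carrier T"
    "{x \<in> carrier M. p x = \<zero>\<^bsub>T\<^esub>} = N"
    by (rule ex_quotient_module[OF lM(1) N]) (rule that)
  have "finitely_generated_module A T"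
    by (rule finitely_generated_image[OF left_module_morphismI[OF lM(1) T(1,2)] T(3) lM(2)])
  then show ?thesis using that[of T p] T by (simp add: fg_modules_def)
qed

text \<open>The descending condition drives the induction over submodules of \<open>M\<close>; the
  ascending one yields a maximal proper submodule at each stage. The simple quotient by it is then
  exchanged for its representative in \<open>\<T>\<close>.\<close>

lemma ex_composition:
  assumes T: "\<And>T. T \<in> fg_modules A \<Longrightarrow> simple_module A T \<Longrightarrow> \<exists>T'\<in>\<T>. isomorphic_modules A T T'"
    and fgT: "\<T> \<subseteq> fg_modules A"
    and M: "M \<in> fg_modules A"
  shows "\<exists>c. composition A \<T> M c"
proof -
  interpret M: left_module A M using M by (simp add: fg_modules_def)
  have "submod A M N \<longrightarrow> (\<exists>c. composition A \<T> (M\<lparr>carrier := N\<rparr>) c)" for N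
  proof (induction N rule: wf_induct_rule[OF artinian[OF M]])
    case (1 N)
    show ?case
    proof
      assume N: "submod A M N"
      have lN: "left_module A (M\<lparr>carrier := N\<rparr>)" by (rule M.left_module_sub[OF N])
      show "\<exists>c. composition A \<T> (M\<lparr>carrier := N\<rparr>) c"
      proof (cases "N = {\<zero>\<^bsub>M\<^esub>}")
        case True
        then show ?thesis using composition.null[OF lN] by auto
      next
        case False
        let ?Q = "{P. submod A M P \<and> P \<subset> N}"
        have "{\<zero>\<^bsub>M\<^esub>} \<in> ?Q" using False M.submod_null submod_zero[OF N] by auto
        then obtain P where P: "P \<in> ?Q" and max: "\<And>R. (R, P) \<in> (proper_submods A M)\<inverse> \<Longrightarrow> R \<notin> ?Q"
          by (rule wfE_min[OF noetherian[OF M]]) (rule that)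
        then have sP: "submod A M P" "P \<subset> N" by simp_all
        then have "submod A (M\<lparr>carrier := N\<rparr>) P" by (auto simp: submod_sub_iff[OF N])
        then obtain T0 p0 where T0: "T0 \<in> fg_modules A" and p0: "p0 \<in> left_module_hom A (M\<lparr>carrier := N\<rparr>) T0"
          "p0 ` carrier (M\<lparr>carrier := N\<rparr>) = carrier T0"
          "{x \<in> carrier (M\<lparr>carrier := N\<rparr>). p0 x = \<zero>\<^bsub>T0\<^esub>} = P"
          by (rule ex_quotient_fg[OF fg_modules_sub[OF M N]]) (rule that)
        have lT0: "left_module A T0" using T0 by (simp add: fg_modules_def)
        have "simple_module A T0"
        proof (rule simple_if_kernel_maximal[OF left_module_morphismI[OF lN lT0 p0(1)] p0(2)])
          show "{x \<in> carrier (M\<lparr>carrier := N\<rparr>). p0 x = \<zero>\<^bsub>T0\<^esub>} \<noteq> carrier (M\<lparr>carrier := N\<rparr>)"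
            unfolding p0(3) using sP by auto
          fix R assume "submod A (M\<lparr>carrier := N\<rparr>) R" "{x \<in> carrier (M\<lparr>carrier := N\<rparr>). p0 x = \<zero>\<^bsub>T0\<^esub>} \<subset> R"
          then have R: "submod A M R" "R \<subseteq> N" "P \<subset> R" unfolding p0(3) by (simp_all add: submod_sub_iff[OF N])
          then have "R \<notin> ?Q" using max sP by (simp add: proper_submods_def)
          then show "R = carrier (M\<lparr>carrier := N\<rparr>)" using R by auto
        qed
        then obtain T e where T: "T \<in> \<T>" and e: "e \<in> left_module_hom A T0 T" "bij_betw e (carrier T0) (carrier T)"
          using T[OF T0] unfolding isomorphic_modules_def by blast
        \<comment> \<open>Composing with an isomorphism onto the representative leaves the kernel
          \<open>P\<close> unchanged.\<close>
        let ?p = "\<lambda>x. e (p0 x)"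
        have p: "?p \<in> left_module_hom A (M\<lparr>carrier := N\<rparr>) T" by (rule left_module_hom_comp[OF p0(1) e(1)])
        have onto: "?p ` carrier (M\<lparr>carrier := N\<rparr>) = carrier T"
          using p0(2) e(2) by (auto simp: bij_betw_def image_image[symmetric])
        have lT: "left_module A T" using T fgT by (auto simp: fg_modules_def)
        interpret e: left_module_morphism A T0 T e by (rule left_module_morphismI[OF lT0 lT e(1)])
        have "{x \<in> carrier (M\<lparr>carrier := N\<rparr>). ?p x = \<zero>\<^bsub>T\<^esub>} =
            {x \<in> carrier (M\<lparr>carrier := N\<rparr>). p0 x = \<zero>\<^bsub>T0\<^esub>}"
        proof (intro Collect_cong conj_cong refl)
          fix x assume "x \<in> carrier (M\<lparr>carrier := N\<rparr>)"
          then have "p0 x \<in> carrier T0" by (rule left_module_homD(1)[OF p0(1)])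
          then show "?p x = \<zero>\<^bsub>T\<^esub> \<longleftrightarrow> p0 x = \<zero>\<^bsub>T0\<^esub>"
            using inj_on_eq_iff[OF bij_betw_imp_inj_on[OF e(2)], of "p0 x" "\<zero>\<^bsub>T0\<^esub>"] by simp
        qed
        then have ker: "{x \<in> carrier (M\<lparr>carrier := N\<rparr>). ?p x = \<zero>\<^bsub>T\<^esub>} = P" unfolding p0(3) .
        obtain c where "composition A \<T> (M\<lparr>carrier := P\<rparr>) c"
          using 1[of P] sP N by (auto simp: proper_submods_def)
        then have "composition A \<T> (M\<lparr>carrier := N\<rparr>\<lparr>carrier :=
            {x \<in> carrier (M\<lparr>carrier := N\<rparr>). ?p x = \<zero>\<^bsub>T\<^esub>}\<rparr>) c" unfolding ker by simp
        then show ?thesis using composition.step[OF lN T p onto] by blast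
      qed
    qed
  qed
  from this[of "carrier M"] show ?thesis using M.submod_self by simp
qed

end

section \<open>The Grothendieck group of a ring of finite length\<close>

lemma finitely_generated_regular:
  assumes "ring A"
  shows "finitely_generated_module A (regular_module A)"
proof -
  interpret ring A by fact
  interpret R: left_module A "regular_module A" by (rule left_module_regular) fact
  show ?thesis unfolding R.finitely_generated_iff
  proof (intro exI[of _ "{\<one>\<^bsub>A\<^esub>}"] conjI allI impI)
    fix N assume N: "submod A (regular_module A) N \<and> {\<one>\<^bsub>A\<^esub>} \<subseteq> N"
    have "a \<in> N" if "a \<in> carrier A" for a
      using submod_smult[of A "regular_module A" N a "\<one>\<^bsub>A\<^esub>"] N that by simp
    then show "N = carrier (regular_module A)" using N submod_subset[of A "regular_module A" N] by auto
  qed auto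
qed

context finite_length_ring
begin

text \<open>Isomorphic modules \<open>T\<close> present \<open>SOME\<close> with equivalent
  predicates, so they share one representative, and each isomorphism class of simple modules is met
  exactly once.\<close>

definition simple_reps :: "('a, (nat \<Rightarrow> 'a) set) module set" where
  "simple_reps = (\<lambda>T. SOME T'. T' \<in> fg_modules A \<and> simple_module A T' \<and> isomorphic_modules A T T') `
     {T \<in> fg_modules A. simple_module A T}"

lemma simple_reps:
  "T \<in> simple_reps \<Longrightarrow> T \<in> fg_modules A \<and> simple_module A T"
  "T \<in> fg_modules A \<Longrightarrow> simple_module A T \<Longrightarrow> \<exists>T'\<in>simple_reps. isomorphic_modules A T T'"
proof -
  let ?r = "\<lambda>T. SOME T'. T' \<in> fg_modules A \<and> simple_module A T' \<and> isomorphic_modules A T T'"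
  have r: "?r T \<in> fg_modules A \<and> simple_module A (?r T) \<and> isomorphic_modules A T (?r T)"
    if "T \<in> fg_modules A" "simple_module A T" for T
    by (rule someI[of "\<lambda>T'. T' \<in> fg_modules A \<and> simple_module A T' \<and> isomorphic_modules A T T'" T])
      (simp add: that isomorphic_modules_refl)
  show "T \<in> simple_reps \<Longrightarrow> T \<in> fg_modules A \<and> simple_module A T"
    using r by (auto simp: simple_reps_def)
  show "T \<in> fg_modules A \<Longrightarrow> simple_module A T \<Longrightarrow> \<exists>T'\<in>simple_reps. isomorphic_modules A T T'"
    using r[of T] unfolding simple_reps_def by blast
qed

lemma simple_reps_iso_imp_eq:
  assumes T: "T \<in> simple_reps" "T' \<in> simple_reps" and iso: "isomorphic_modules A T T'"
  shows "T = T'"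
proof -
  define r :: "('a, (nat \<Rightarrow> 'a) set) module \<Rightarrow> ('a, (nat \<Rightarrow> 'a) set) module"
    where "r T = (SOME T'. T' \<in> fg_modules A \<and> simple_module A T' \<and> isomorphic_modules A T T')" for T
  have r: "isomorphic_modules A V (r V) \<and> r V \<in> fg_modules A" if "V \<in> fg_modules A" "simple_module A V" for V
    using someI[of "\<lambda>T'. T' \<in> fg_modules A \<and> simple_module A T' \<and> isomorphic_modules A V T'" V]
    by (simp add: r_def that isomorphic_modules_refl)
  obtain V W where V: "V \<in> fg_modules A" "simple_module A V" "T = r V"
    and W: "W \<in> fg_modules A" "simple_module A W" "T' = r W"
    using T by (auto simp: simple_reps_def r_def)
  have l: "left_module A V" "left_module A W" "left_module A (r W)" "left_module A (r V)"
    using V W r[OF V(1,2)] r[OF W(1,2)] by (simp_all add: fg_modules_def)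
  have "isomorphic_modules A V (r W)"
    using isomorphic_modules_trans r[OF V(1,2)] iso V(3) W(3) by blast
  then have VW: "isomorphic_modules A V W"
    using isomorphic_modules_trans isomorphic_modules_sym[OF l(2,3)] r[OF W(1,2)] by blast
  have "isomorphic_modules A V U = isomorphic_modules A W U" for U :: "('a, (nat \<Rightarrow> 'a) set) module"
    using VW isomorphic_modules_sym[OF l(1,2) VW] isomorphic_modules_trans by blast
  then show ?thesis unfolding V(3) W(3) r_def by simp
qed

sublocale simple_modules A simple_reps
  by unfold_locales (auto dest: simple_reps(1) intro: simple_reps_iso_imp_eq)

lemma ex_composition_fg: "M \<in> fg_modules A \<Longrightarrow> \<exists>c. composition A simple_reps M c"
  by (rule ex_composition) (use simple_reps in auto)

text \<open>A simple module is generated by any nonzero element, hence is a quotient of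
  \<open>A\<close>. Its representative therefore occurs among the finitely many factors of a single
  composition series of \<open>A\<close>.\<close>

lemma finite_simple_reps: "finite simple_reps"
proof -
  let ?R = "regular_module A"
  have lR: "left_module A ?R" by (rule left_module_regular) (rule ring_axioms)
  \<comment> \<open>A copy of the regular module inside \<open>fg_modules\<close> is taken, because
    existence of composition series is established there.\<close>
  obtain M :: "('a, (nat \<Rightarrow> 'a) set) module" and f where M: "M \<in> fg_modules A"
    and f: "f \<in> left_module_hom A ?R M" "bij_betw f (carrier ?R) (carrier M)"
    using fg_modules_complete[OF lR finitely_generated_regular[OF ring_axioms]] by (elim bexE) (rule that)
  have lM: "left_module A M" using M by (simp add: fg_modules_def)
  have "isomorphic_modules A M ?R"
    using isomorphic_modules_sym[OF lR lM] f by (auto simp: isomorphic_modules_def)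
  then obtain g where g: "g \<in> left_module_hom A M ?R" "bij_betw g (carrier M) (carrier ?R)"
    unfolding isomorphic_modules_def by (elim bexE) (rule that)
  obtain c where c: "composition A simple_reps M c" using ex_composition_fg[OF M] by blast
  have "T \<in> Poly_Mapping.keys c" if T: "T \<in> simple_reps" for T
  proof -
    have sT: "simple_module A T" using simple_reps(1)[OF T] by simp
    interpret T: left_module A T using sT by (simp add: simple_module_def)
    obtain t where t: "t \<in> carrier T" "t \<noteq> \<zero>\<^bsub>T\<^esub>"
      using sT submod_zero[OF T.submod_self] by (auto simp: simple_module_def)
    let ?q = "\<lambda>a. a \<odot>\<^bsub>T\<^esub> t"
    have q: "?q \<in> left_module_hom A ?R T"
      by (rule left_module_homI) (use t in \<open>auto simp: T.smult_l_distr T.smult_assoc1\<close>)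
    interpret q: left_module_morphism A ?R T ?q by (rule left_module_morphismI[OF lR T.left_module_axioms q])
    have "submod A T (?q ` carrier ?R)" by (rule q.submod_image) (rule q.M.submod_self)
    moreover have "t \<in> ?q ` carrier ?R" using t by (auto intro!: image_eqI[of _ _ "\<one>\<^bsub>A\<^esub>"])
    ultimately have qonto: "?q ` carrier ?R = carrier T" using sT t by (auto simp: simple_module_def)
    let ?p = "\<lambda>x. ?q (g x)"
    have p: "?p \<in> left_module_hom A M T" by (rule left_module_hom_comp[OF g(1) q])
    have onto: "?p ` carrier M = carrier T"
      using g(2) qonto by (simp add: bij_betw_def image_image[symmetric, of ?q g])
    interpret p: left_module_morphism A M T ?p by (rule left_module_morphismI[OF lM T.left_module_axioms p])
    obtain d where "composition A simple_reps (M\<lparr>carrier := {x \<in> carrier M. ?p x = \<zero>\<^bsub>T\<^esub>}\<rparr>) d"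
      using ex_composition_fg[OF fg_modules_sub[OF M p.submod_kernel]] by blast
    \<comment> \<open>Uniqueness identifies this series with \<open>c\<close>, and since
      \<open>d\<close> has no negative coefficients the label \<open>T\<close> cannot
      cancel.\<close>
    then have "composition A simple_reps M (d + frag_of T)" "Poly_Mapping.lookup d T \<ge> 0"
      using composition.step[OF lM T p onto] composition_nonneg by blast+
    then have "Poly_Mapping.lookup c T > 0"
      using composition_unique[OF c, of "d + frag_of T"] by (simp add: lookup_add)
    then show ?thesis by (simp add: in_keys_iff)
  qed
  then show ?thesis by (meson finite_keys finite_subset subsetI)
qed

definition factors :: "('a, (nat \<Rightarrow> 'a) set) module \<Rightarrow> ('a, (nat \<Rightarrow> 'a) set) module \<Rightarrow>\<^sub>0 int" where
  "factors M = (THE c. composition A simple_reps M c)"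

lemma composition_factors:
  assumes "M \<in> fg_modules A"
  shows "composition A simple_reps M (factors M)"
proof -
  obtain c where "composition A simple_reps M c" using ex_composition_fg[OF assms] by blast
  then show ?thesis unfolding factors_def by (rule theI) (rule composition_unique[OF _ \<open>composition A simple_reps M c\<close>])
qed

text \<open>Generating relations are killed by additivity on short exact sequences; sums and
  inverses of them follow formally.\<close>

lemma factors_relation:
  assumes "r \<in> groth_relations A"
  shows "frag_extend factors r = 0"
  using assms unfolding groth_relations_def
proof (induction r rule: generate.induct)
  \<comment> \<open>The bound on the keys is carried along because only on the carrier of the free
    abelian group is the group inverse the negation.\<close>
  have 0: "frag_extend factors h = 0 \<and> Poly_Mapping.keys h \<subseteq> fg_modules A"
    if h0: "h \<in> {frag_of M - (frag_of M' + frag_of M'') | M' M M''.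
        M' \<in> fg_modules A \<and> M \<in> fg_modules A \<and> M'' \<in> fg_modules A \<and> short_exact A M' M M''}" for h
  proof -
    obtain M' M M'' where h: "h = frag_of M - (frag_of M' + frag_of M'')"
      and m: "M' \<in> fg_modules A" "M \<in> fg_modules A" "M'' \<in> fg_modules A" "short_exact A M' M M''"
      using h0 by (elim CollectE exE conjE) (rule that)
    have "factors M = factors M' + factors M''"
      using composition_short_exact[OF m(4) _ _ composition_factors composition_factors composition_factors] m
      by (simp add: fg_modules_def)
    moreover have "Poly_Mapping.keys h \<subseteq> {M} \<union> ({M'} \<union> {M''})" unfolding h
      by (intro order_trans[OF keys_diff] Un_mono order_trans[OF keys_add]) simp_all
    ultimately show ?thesis using m by (auto simp: h frag_extend_diff frag_extend_add)
  qed
  show "frag_extend factors h = 0"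
    if "h \<in> {frag_of M - (frag_of M' + frag_of M'') | M' M M''.
        M' \<in> fg_modules A \<and> M \<in> fg_modules A \<and> M'' \<in> fg_modules A \<and> short_exact A M' M M''}" for h
    using 0[OF that] by simp
  show "frag_extend factors (inv\<^bsub>free_Abelian_group (fg_modules A)\<^esub> h) = 0"
    if "h \<in> {frag_of M - (frag_of M' + frag_of M'') | M' M M''.
        M' \<in> fg_modules A \<and> M \<in> fg_modules A \<and> M'' \<in> fg_modules A \<and> short_exact A M' M M''}" for h
    using 0[OF that] by (simp add: frag_extend_minus)
qed (simp_all add: frag_extend_add)

end

section \<open>The subgroup of relations and the embedding of the quotient\<close>

lemma groth_relations_subset: "groth_relations A \<subseteq> carrier (free_Abelian_group (fg_modules A))"
  using normal.axioms(1)[OF normal_groth_relations] by (rule subgroup.subset)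

lemma groth_relations_zero: "0 \<in> groth_relations A"
  using subgroup.one_closed[OF normal.axioms(1)[OF normal_groth_relations, of A]] by simp

lemma groth_relations_add: "r \<in> groth_relations A \<Longrightarrow> s \<in> groth_relations A \<Longrightarrow> r + s \<in> groth_relations A"
  using subgroup.m_closed[OF normal.axioms(1)[OF normal_groth_relations, of A]] by simp

lemma groth_relations_minus:
  assumes "r \<in> groth_relations A"
  shows "- r \<in> groth_relations A"
proof -
  have "Poly_Mapping.keys r \<subseteq> fg_modules A"
    using subsetD[OF groth_relations_subset assms] by simp
  then show ?thesis
    using subgroup.m_inv_closed[OF normal.axioms(1)[OF normal_groth_relations, of A] assms] by simp
qed

lemma groth_relations_diff: "r \<in> groth_relations A \<Longrightarrow> s \<in> groth_relations A \<Longrightarrow> r - s \<in> groth_relations A"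
  using groth_relations_add[of r A "- s"] groth_relations_minus[of s A] by simp

lemma groth_relation_short_exact:
  assumes "M' \<in> fg_modules A" "M \<in> fg_modules A" "M'' \<in> fg_modules A" "short_exact A M' M M''"
  shows "frag_of M - (frag_of M' + frag_of M'') \<in> groth_relations A"
  unfolding groth_relations_def by (rule generate.incl) (use assms in blast)

context finite_length_ring
begin

text \<open>Each step of the series is a short exact sequence, whose relation splits off one simple
  factor; the class of the null module at the end is itself a relation.\<close>

lemma composition_relation:
  assumes "composition A simple_reps M c" "M \<in> fg_modules A"
  shows "frag_of M - c \<in> groth_relations A"
  using assms
proof (induction rule: composition.induct)
  case (null M)
  \<comment> \<open>For a null module, the identity followed by the zero map is exact with
    \<open>M\<close> in all three places, so \<open>[M] = [M] + [M]\<close>.\<close>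
  have "short_exact A M M M" unfolding short_exact_def
  proof (rule bexI[of _ "\<lambda>x. x"], rule bexI[of _ "\<lambda>x. \<zero>\<^bsub>M\<^esub>"], intro conjI)
    interpret M: left_module A M by fact
    show "(\<lambda>x. x) \<in> left_module_hom A M M" by (simp add: left_module_hom_def)
    show "(\<lambda>x. \<zero>\<^bsub>M\<^esub>) \<in> left_module_hom A M M" by (simp add: left_module_hom_def)
  qed (use null in auto)
  then have "frag_of M - (frag_of M + frag_of M) \<in> groth_relations A"
    using null by (intro groth_relation_short_exact) auto
  then show ?case using groth_relations_minus by fastforce
next
  case (step M T p c)
  interpret p: left_module_morphism A M T p by (rule left_module_morphismI) (use step left_module_simple in auto)
  let ?K = "{x \<in> carrier M. p x = \<zero>\<^bsub>T\<^esub>}"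
  have K: "M\<lparr>carrier := ?K\<rparr> \<in> fg_modules A" by (rule fg_modules_sub[OF step.prems p.submod_kernel])
  have "short_exact A (M\<lparr>carrier := ?K\<rparr>) M T" unfolding short_exact_def
    by (rule bexI[of _ "\<lambda>x. x"], rule bexI[of _ p])
      (use step.hyps in \<open>auto simp: left_module_hom_def\<close>)
  then have "frag_of M - (frag_of (M\<lparr>carrier := ?K\<rparr>) + frag_of T) \<in> groth_relations A"
    using K step.prems simple_reps(1)[OF step.hyps(2)] by (intro groth_relation_short_exact) auto
  from groth_relations_add[OF this step.IH[OF K]] show ?case by (simp add: algebra_simps)
qed

text \<open>This is the source of injectivity: two elements with the same factors differ by a
  relation.\<close>

lemma factors_representative:
  assumes "c \<in> carrier (free_Abelian_group (fg_modules A))"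
  shows "c - frag_extend factors c \<in> groth_relations A"
proof -
  have "Poly_Mapping.keys c \<subseteq> fg_modules A" using assms by simp
  then show ?thesis
  proof (induction rule: frag_induction)
    case (one M)
    then show ?case using composition_relation[OF composition_factors] by simp
  next
    case (diff a b)
    have "(a - frag_extend factors a) - (b - frag_extend factors b) \<in> groth_relations A"
      by (rule groth_relations_diff[OF diff])
    then show ?case by (simp add: frag_extend_diff algebra_simps)
  qed (simp add: groth_relations_zero)
qed

theorem groth_group_embedding:
  obtains \<Phi> and I :: "('a, (nat \<Rightarrow> 'a) set) module set" where "finite I"
    "inj_on \<Phi> (carrier (groth_group A))"
    "\<And>C. C \<in> carrier (groth_group A) \<Longrightarrow> Poly_Mapping.keys (\<Phi> C :: _ \<Rightarrow>\<^sub>0 int) \<subseteq> I"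
    "\<And>C D. C \<in> carrier (groth_group A) \<Longrightarrow> D \<in> carrier (groth_group A) \<Longrightarrow>
       \<Phi> (C \<otimes>\<^bsub>groth_group A\<^esub> D) = \<Phi> C + \<Phi> D"
proof -
  let ?F = "free_Abelian_group (fg_modules A)" and ?R = "groth_relations A"
  interpret R: normal ?R ?F by (rule normal_groth_relations)
  \<comment> \<open>A coset goes to the common value of the factors on its members; the image is a
    singleton because relations have no factors.\<close>
  define \<Phi> where "\<Phi> C = the_elem (frag_extend factors ` C)" for C
  have \<Phi>: "\<Phi> (?R #>\<^bsub>?F\<^esub> c) = frag_extend factors c" for c
  proof -
    have "frag_extend factors ` (?R #>\<^bsub>?F\<^esub> c) = {frag_extend factors c}"
      using factors_relation groth_relations_zero[of A]
      by (force simp: r_coset_def frag_extend_add)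
    then show ?thesis by (simp add: \<Phi>_def)
  qed
  have cosets: "\<exists>c\<in>carrier ?F. C = ?R #>\<^bsub>?F\<^esub> c" if "C \<in> carrier (groth_group A)" for C
    using that unfolding groth_group_def carrier_FactGroup by blast
  show thesis
  proof (rule that[OF finite_simple_reps])
    show "inj_on \<Phi> (carrier (groth_group A))"
    proof (rule inj_onI)
      fix C D assume "C \<in> carrier (groth_group A)" "D \<in> carrier (groth_group A)" and eq: "\<Phi> C = \<Phi> D"
      then obtain c d where c: "c \<in> carrier ?F" "C = ?R #>\<^bsub>?F\<^esub> c" and d: "d \<in> carrier ?F" "D = ?R #>\<^bsub>?F\<^esub> d"
        using cosets by metis
      have "(c - frag_extend factors c) - (d - frag_extend factors d) \<in> ?R"
        by (intro groth_relations_diff factors_representative c d)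
      then have "c - d \<in> ?R" using eq by (simp add: c d \<Phi>)
      then have "c \<in> ?R #>\<^bsub>?F\<^esub> d" by (auto simp: r_coset_def intro!: bexI[of _ "c - d"])
      then show "C = D" using R.repr_independence[OF _ d(1) R.subgroup_axioms] c d by simp
    qed
    fix C assume "C \<in> carrier (groth_group A)"
    then obtain c where c: "c \<in> carrier ?F" "C = ?R #>\<^bsub>?F\<^esub> c" using cosets by blast
    have "Poly_Mapping.keys (factors M) \<subseteq> simple_reps" if "M \<in> Poly_Mapping.keys c" for M
      using that c(1) keys_composition[OF composition_factors] by auto
    then show "Poly_Mapping.keys (\<Phi> C) \<subseteq> simple_reps"
      using keys_frag_extend[of factors c] unfolding c(2) \<Phi> by blast
    fix D assume "D \<in> carrier (groth_group A)"
    then obtain d where d: "d \<in> carrier ?F" "D = ?R #>\<^bsub>?F\<^esub> d" using cosets by blast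
    show "\<Phi> (C \<otimes>\<^bsub>groth_group A\<^esub> D) = \<Phi> C + \<Phi> D"
      using R.rcos_sum[OF c(1) d(1)] by (simp add: groth_group_def c(2) d(2) \<Phi> frag_extend_add)
  qed
qed

end

section \<open>Group rings of finite groups\<close>

lemma restrict_scalars_simps [simp]:
  "carrier (restrict_scalars \<phi> M) = carrier M" "add (restrict_scalars \<phi> M) = add M"
  "\<zero>\<^bsub>restrict_scalars \<phi> M\<^esub> = \<zero>\<^bsub>M\<^esub>" "smult (restrict_scalars \<phi> M) = (\<lambda>a x. \<phi> a \<odot>\<^bsub>M\<^esub> x)"
  by (simp_all add: restrict_scalars_def)

lemma left_module_restrict_scalars:
  assumes A: "ring A" and \<phi>: "\<phi> \<in> ring_hom A B" and M: "left_module B M"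
  shows "left_module A (restrict_scalars \<phi> M)"
proof -
  interpret M: left_module B M by fact
  interpret A: ring A by fact
  have "abelian_group (restrict_scalars \<phi> M)"
    by (rule abelian_groupI) (auto simp: M.M.a_ac intro: M.M.l_neg)
  then show ?thesis
    by (intro left_module.intro A left_module_axioms.intro)
      (auto simp: ring_hom_closed[OF \<phi>] ring_hom_add[OF \<phi>] ring_hom_mult[OF \<phi>] ring_hom_one[OF \<phi>]
        M.smult_l_distr M.smult_r_distr M.smult_assoc1)
qed

lemma submod_restrict_scalars:
  "\<phi> \<in> carrier A \<rightarrow> carrier B \<Longrightarrow> submod B M N \<Longrightarrow> submod A (restrict_scalars \<phi> M) N"
  by (auto simp: submod_def)

text \<open>With fewer submodules to exclude, generation is easier, so generators over
  \<open>A\<close> also generate over \<open>B\<close>. The intended case is \<open>A\<close> a base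
  ring and \<open>B\<close> a group ring over it.\<close>

lemma finitely_generated_mono:
  assumes "left_module A M" "left_module B N" and carrier: "carrier M = carrier N"
    and sub: "\<And>P. submod B N P \<Longrightarrow> submod A M P"
    and fg: "finitely_generated_module A M"
  shows "finitely_generated_module B N"
proof -
  interpret M: left_module A M by fact
  interpret N: left_module B N by fact
  obtain C where C: "finite C" "C \<subseteq> carrier M" "\<And>P. submod A M P \<Longrightarrow> C \<subseteq> P \<Longrightarrow> P = carrier M"
    using fg unfolding M.finitely_generated_iff by blast
  show ?thesis unfolding N.finitely_generated_iff
    by (intro exI[of _ C]) (use C sub carrier in auto)
qed

lemma finite_group_ring_carrier:
  assumes "finite (carrier G)"
  shows "a \<in> carrier (group_ring R G) \<longleftrightarrow>
    (\<forall>x. a x \<in> carrier R) \<and> (\<forall>x. x \<notin> carrier G \<longrightarrow> a x = \<zero>\<^bsub>R\<^esub>)"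
proof -
  have "(\<forall>x. x \<notin> carrier G \<longrightarrow> a x = \<zero>\<^bsub>R\<^esub>) \<Longrightarrow> {x. a x \<noteq> \<zero>\<^bsub>R\<^esub>} \<subseteq> carrier G" by auto
  then show ?thesis using assms by (auto simp: group_ring_def intro: finite_subset)
qed

lemma group_ring_simps [simp]:
  "\<zero>\<^bsub>group_ring R G\<^esub> = (\<lambda>x. \<zero>\<^bsub>R\<^esub>)"
  "\<one>\<^bsub>group_ring R G\<^esub> = (\<lambda>x. if x = \<one>\<^bsub>G\<^esub> then \<one>\<^bsub>R\<^esub> else \<zero>\<^bsub>R\<^esub>)"
  "a \<oplus>\<^bsub>group_ring R G\<^esub> b = (\<lambda>x. a x \<oplus>\<^bsub>R\<^esub> b x)"
  by (simp_all add: group_ring_def)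

lemma group_ring_mult_outside: "x \<notin> carrier G \<Longrightarrow> (a \<otimes>\<^bsub>group_ring R G\<^esub> b) x = \<zero>\<^bsub>R\<^esub>"
  by (simp add: group_ring_def)

definition group_ring_single :: "('r, 'm) ring_scheme \<Rightarrow> 'r \<Rightarrow> 'g \<Rightarrow> 'g \<Rightarrow> 'r" where
  "group_ring_single R s g = (\<lambda>x. if x = g then s else \<zero>\<^bsub>R\<^esub>)"

locale finite_group_ring = R: cring R + G: group G
  for R :: "('r, 'm) ring_scheme" and G :: "('g, 'n) monoid_scheme" +
  assumes finite_G: "finite (carrier G)"
begin

abbreviation "RG \<equiv> group_ring R G"
abbreviation "single \<equiv> group_ring_single R"

lemmas carrier_RG = finite_group_ring_carrier[OF finite_G, of _ R]

lemma ring_RG: "ring RG"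
  by (rule ring_group_ring[OF R.ring_axioms G.group_axioms finite_G])

lemma single_closed [simp]: "s \<in> carrier R \<Longrightarrow> g \<in> carrier G \<Longrightarrow> single s g \<in> carrier RG"
  by (auto simp: carrier_RG group_ring_single_def)

lemma single_mult:
  assumes s: "s \<in> carrier R" and g: "g \<in> carrier G" and b: "b \<in> carrier RG" and x: "x \<in> carrier G"
  shows "(single s g \<otimes>\<^bsub>RG\<^esub> b) x = s \<otimes>\<^bsub>R\<^esub> b (inv\<^bsub>G\<^esub> g \<otimes>\<^bsub>G\<^esub> x)"
proof -
  have bc: "b y \<in> carrier R" for y using b by (simp add: carrier_RG)
  have "(single s g \<otimes>\<^bsub>RG\<^esub> b) x =
      (\<Oplus>\<^bsub>R\<^esub>y\<in>carrier G. if g = y then s \<otimes>\<^bsub>R\<^esub> b (inv\<^bsub>G\<^esub> y \<otimes>\<^bsub>G\<^esub> x) else \<zero>\<^bsub>R\<^esub>)"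
    unfolding group_ring_mult_eq[OF R.ring_axioms G.group_axioms finite_G single_closed[OF s g] b x]
    by (rule R.add.finprod_cong') (use s bc in \<open>auto simp: group_ring_single_def\<close>)
  also have "\<dots> = s \<otimes>\<^bsub>R\<^esub> b (inv\<^bsub>G\<^esub> g \<otimes>\<^bsub>G\<^esub> x)"
    using R.add.finprod_singleton[of g "carrier G" "\<lambda>y. s \<otimes>\<^bsub>R\<^esub> b (inv\<^bsub>G\<^esub> y \<otimes>\<^bsub>G\<^esub> x)"] g finite_G s bc by simp
  finally show ?thesis .
qed

lemma single_mult_single:
  assumes s: "s \<in> carrier R" "t \<in> carrier R" and g: "g \<in> carrier G" "h \<in> carrier G"
  shows "single s g \<otimes>\<^bsub>RG\<^esub> single t h = single (s \<otimes>\<^bsub>R\<^esub> t) (g \<otimes>\<^bsub>G\<^esub> h)"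
proof
  fix x show "(single s g \<otimes>\<^bsub>RG\<^esub> single t h) x = single (s \<otimes>\<^bsub>R\<^esub> t) (g \<otimes>\<^bsub>G\<^esub> h) x"
  proof (cases "x \<in> carrier G")
    case True
    then have "inv\<^bsub>G\<^esub> g \<otimes>\<^bsub>G\<^esub> x = h \<longleftrightarrow> x = g \<otimes>\<^bsub>G\<^esub> h" using g by (auto simp: G.inv_solve_left')
    then show ?thesis using single_mult[OF s(1) g(1) single_closed[OF s(2) g(2)] True] s
      by (simp add: group_ring_single_def)
  next
    case False
    then show ?thesis using g by (auto simp: group_ring_mult_outside group_ring_single_def)
  qed
qed

lemma single_one: "single \<one>\<^bsub>R\<^esub> \<one>\<^bsub>G\<^esub> = \<one>\<^bsub>RG\<^esub>"
  by (simp add: group_ring_single_def)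

lemma scalar_ring_hom: "(\<lambda>s. single s \<one>\<^bsub>G\<^esub>) \<in> ring_hom R RG"
  by (rule ring_hom_memI) (auto simp: single_mult_single single_one simp del: group_ring_simps(2),
      auto simp: group_ring_single_def)

text \<open>The one-term elements span the group ring additively; the induction truncates
  \<open>a\<close> to growing parts of the finite group.\<close>

lemma submod_group_ringI:
  assumes M: "left_module RG M" and N: "N \<subseteq> carrier M" "\<zero>\<^bsub>M\<^esub> \<in> N"
    and add: "\<And>x y. x \<in> N \<Longrightarrow> y \<in> N \<Longrightarrow> x \<oplus>\<^bsub>M\<^esub> y \<in> N"
    and smult: "\<And>s g x. s \<in> carrier R \<Longrightarrow> g \<in> carrier G \<Longrightarrow> x \<in> N \<Longrightarrow> single s g \<odot>\<^bsub>M\<^esub> x \<in> N"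
  shows "submod RG M N"
proof (rule submodI)
  interpret M: left_module RG M by fact
  fix a x assume a: "a \<in> carrier RG" and x: "x \<in> N"
  have ac: "a y \<in> carrier R" for y using a by (simp add: carrier_RG)
  have "(\<lambda>y. if y \<in> B then a y else \<zero>\<^bsub>R\<^esub>) \<odot>\<^bsub>M\<^esub> x \<in> N" if "B \<subseteq> carrier G" for B
    using finite_subset[OF that finite_G] that
  proof (induction B rule: finite_induct)
    case empty
    have "(\<lambda>y. \<zero>\<^bsub>R\<^esub>) \<odot>\<^bsub>M\<^esub> x = \<zero>\<^bsub>M\<^esub>" using M.smult_l_null[of x] x N(1) by auto
    then show ?case using N by simp
  next
    case (insert g B)
    let ?b = "\<lambda>y. if y \<in> B then a y else \<zero>\<^bsub>R\<^esub>"
    have b: "?b \<in> carrier RG" using insert.prems ac by (auto simp: carrier_RG)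
    have g: "g \<in> carrier G" using insert.prems by simp
    have "(\<lambda>y. if y \<in> insert g B then a y else \<zero>\<^bsub>R\<^esub>) = single (a g) g \<oplus>\<^bsub>RG\<^esub> ?b"
      using insert.hyps ac by (auto simp: group_ring_single_def fun_eq_iff)
    then have "(\<lambda>y. if y \<in> insert g B then a y else \<zero>\<^bsub>R\<^esub>) \<odot>\<^bsub>M\<^esub> x = single (a g) g \<odot>\<^bsub>M\<^esub> x \<oplus>\<^bsub>M\<^esub> ?b \<odot>\<^bsub>M\<^esub> x"
      using M.smult_l_distr[OF single_closed[OF ac g] b, of x] x N(1) by (auto simp del: group_ring_simps)
    then show ?case using insert smult[OF ac g x] add by simp
  qed
  from this[OF subset_refl] have "(\<lambda>y. if y \<in> carrier G then a y else \<zero>\<^bsub>R\<^esub>) \<odot>\<^bsub>M\<^esub> x \<in> N" .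
  moreover have "(\<lambda>y. if y \<in> carrier G then a y else \<zero>\<^bsub>R\<^esub>) = a" using a by (auto simp: carrier_RG)
  ultimately show "a \<odot>\<^bsub>M\<^esub> x \<in> N" by simp
qed (use N add in auto)

text \<open>Over the base ring, the translates of the generators by the finitely many group elements
  generate.\<close>

lemma finitely_generated_scalars:
  assumes M: "left_module RG M" and fg: "finitely_generated_module RG M"
  shows "finitely_generated_module R (restrict_scalars (\<lambda>s. single s \<one>\<^bsub>G\<^esub>) M)" (is "finitely_generated_module R ?M")
proof -
  interpret M: left_module RG M by fact
  interpret S: left_module R ?M by (rule left_module_restrict_scalars[OF R.ring_axioms scalar_ring_hom M])
  obtain B where B: "finite B" "B \<subseteq> carrier M" "\<And>P. submod RG M P \<Longrightarrow> B \<subseteq> P \<Longrightarrow> P = carrier M"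
    using fg unfolding M.finitely_generated_iff by blast
  let ?C = "(\<lambda>(g, b). single \<one>\<^bsub>R\<^esub> g \<odot>\<^bsub>M\<^esub> b) ` (carrier G \<times> B)"
  show ?thesis unfolding S.finitely_generated_iff
  proof (intro exI[of _ ?C] conjI allI impI)
    show "finite ?C" using finite_G B by auto
    show "?C \<subseteq> carrier ?M" using B by auto
    fix N assume N: "submod R ?M N \<and> ?C \<subseteq> N"
    then have sN: "submod R ?M N" by simp
    \<comment> \<open>The largest part of \<open>N\<close> stable under the group. It contains
      \<open>B\<close> because \<open>N\<close> contains all translates, so it is all of
      \<open>M\<close>, and translation by the unit element gives \<open>N = M\<close>.\<close>
    let ?N = "{x \<in> carrier M. \<forall>g\<in>carrier G. single \<one>\<^bsub>R\<^esub> g \<odot>\<^bsub>M\<^esub> x \<in> N}"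
    have "submod RG M ?N"
    proof (rule submod_group_ringI[OF M])
      show "\<zero>\<^bsub>M\<^esub> \<in> ?N" using submod_zero[OF sN] by simp
    next
      fix x y assume "x \<in> ?N" "y \<in> ?N"
      then show "x \<oplus>\<^bsub>M\<^esub> y \<in> ?N" using submod_add[OF sN] by (simp add: M.smult_r_distr)
    next
      fix s g x assume s: "s \<in> carrier R" and g: "g \<in> carrier G" and x: "x \<in> ?N"
      have "single \<one>\<^bsub>R\<^esub> h \<odot>\<^bsub>M\<^esub> (single s g \<odot>\<^bsub>M\<^esub> x) \<in> N" if h: "h \<in> carrier G" for h
      proof -
        \<comment> \<open>Scalars commute with group elements, so the product regroups as a scalar
          acting on a translate of \<open>x\<close>.\<close>
        have "single \<one>\<^bsub>R\<^esub> h \<odot>\<^bsub>M\<^esub> (single s g \<odot>\<^bsub>M\<^esub> x) =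
            single s \<one>\<^bsub>G\<^esub> \<odot>\<^bsub>M\<^esub> (single \<one>\<^bsub>R\<^esub> (h \<otimes>\<^bsub>G\<^esub> g) \<odot>\<^bsub>M\<^esub> x)"
          using s g h x by (simp add: M.smult_assoc1[symmetric] single_mult_single)
        moreover have "single \<one>\<^bsub>R\<^esub> (h \<otimes>\<^bsub>G\<^esub> g) \<odot>\<^bsub>M\<^esub> x \<in> N" using g h x by simp
        ultimately show ?thesis using submod_smult[OF sN s] by simp
      qed
      then show "single s g \<odot>\<^bsub>M\<^esub> x \<in> ?N" using s g x by simp
    qed auto
    moreover have "B \<subseteq> ?N" using N B(2) by auto
    ultimately have N': "?N = carrier M" by (rule B(3))
    have "x \<in> N" if "x \<in> carrier M" for x
    proof -
      have "single \<one>\<^bsub>R\<^esub> \<one>\<^bsub>G\<^esub> \<odot>\<^bsub>M\<^esub> x \<in> N" using N' that by blast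
      then show ?thesis using that unfolding single_one by (simp del: group_ring_simps)
    qed
    then show "N = carrier ?M" using submod_subset[OF sN] by auto
  qed
qed

text \<open>Submodules over the group ring are also submodules over \<open>R\<close>, so both
  conditions are inherited from the module over \<open>R\<close>; there Akizuki's theorem supplies
  the ascending one.\<close>

lemma finite_length:
  assumes art: "artinian_module R (regular_module R)"
  shows "finite_length_ring RG"
proof (intro finite_length_ring.intro ring_RG finite_length_ring_axioms.intro)
  let ?\<iota> = "\<lambda>s. single s \<one>\<^bsub>G\<^esub>"
  fix M assume "M \<in> fg_modules RG"
  then have M: "left_module RG M" "finitely_generated_module RG M" by (simp_all add: fg_modules_def)
  have \<iota>: "?\<iota> \<in> carrier R \<rightarrow> carrier RG" by simp
  have lm: "left_module R (restrict_scalars ?\<iota> M)"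
    by (rule left_module_restrict_scalars[OF R.ring_axioms scalar_ring_hom M(1)])
  have sub: "proper_submods RG M \<subseteq> proper_submods R (restrict_scalars ?\<iota> M)"
    using submod_restrict_scalars[OF \<iota>] by (auto simp: proper_submods_def)
  have wf: "artinian_module R (restrict_scalars ?\<iota> M)" "noetherian_module R (restrict_scalars ?\<iota> M)"
    by (rule left_module.finite_length_if_generated[OF lm finitely_generated_scalars[OF M] art
          cring_artinian_imp_noetherian[OF R.cring_axioms art]])+
  show "artinian_module RG M" using wf(1) sub by (rule wf_subset)
  show "noetherian_module RG M" using wf(2) by (rule wf_subset) (use sub in auto)
qed

end

section \<open>Maps of group rings induced by injective homomorphisms\<close>

locale finite_group_ring_map = G?: finite_group_ring R G + H?: finite_group_ring R H
  for R :: "('r, 'm) ring_scheme" and G :: "('g, 'n) monoid_scheme" and H :: "('h, 'l) monoid_scheme" +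
  fixes \<phi> assumes hom: "\<phi> \<in> hom G H" and inj: "inj_on \<phi> (carrier G)"
begin

sublocale \<phi>: group_hom G H \<phi>
  by (intro group_hom.intro group_hom_axioms.intro G.G.group_axioms H.G.group_axioms hom)

abbreviation "\<phi>R \<equiv> group_ring_map R G H \<phi>"

text \<open>Injectivity leaves at most one term in the sum defining \<open>group_ring_map\<close>,
  so coefficients are merely moved along \<open>\<phi>\<close>. The inclusions and conjugations of
  the inverse limit are of this kind.\<close>

lemma map_image:
  assumes a: "a \<in> carrier (group_ring R G)" and x: "x \<in> carrier G"
  shows "\<phi>R a (\<phi> x) = a x"
proof -
  have ax: "a x \<in> carrier R" using a by (simp add: G.carrier_RG)
  have "{u \<in> carrier G. a u \<noteq> \<zero>\<^bsub>R\<^esub> \<and> \<phi> u = \<phi> x} = (if a x = \<zero>\<^bsub>R\<^esub> then {} else {x})"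
    using inj_onD[OF inj] x by auto
  then show ?thesis using x ax by (simp add: group_ring_map_def)
qed

lemma map_outside: "y \<notin> \<phi> ` carrier G \<Longrightarrow> \<phi>R a y = \<zero>\<^bsub>R\<^esub>"
proof -
  assume y: "y \<notin> \<phi> ` carrier G"
  then have "{x \<in> carrier G. a x \<noteq> \<zero>\<^bsub>R\<^esub> \<and> \<phi> x = y} = {}" by auto
  then show ?thesis unfolding group_ring_map_def by (simp only: G.R.finsum_empty if_cancel)
qed

lemma map_eqI:
  assumes "\<And>x. x \<in> carrier G \<Longrightarrow> f (\<phi> x) = g (\<phi> x)" "\<And>y. y \<notin> \<phi> ` carrier G \<Longrightarrow> f y = g y"
  shows "f = g"
  using assms by (metis (no_types) ext imageE)

lemma map_closed: "a \<in> carrier (group_ring R G) \<Longrightarrow> \<phi>R a \<in> carrier (group_ring R H)"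
proof -
  assume a: "a \<in> carrier (group_ring R G)"
  have "\<phi>R a y \<in> carrier R" for y
  proof (cases "y \<in> \<phi> ` carrier G")
    case True
    then show ?thesis using map_image[OF a] a by (auto simp: G.carrier_RG)
  qed (simp add: map_outside)
  moreover have "\<phi>R a y = \<zero>\<^bsub>R\<^esub>" if "y \<notin> carrier H" for y
    using that by (intro map_outside) auto
  ultimately show ?thesis by (simp add: H.carrier_RG)
qed

lemma map_single:
  assumes "s \<in> carrier R" "g \<in> carrier G"
  shows "\<phi>R (group_ring_single R s g) = group_ring_single R s (\<phi> g)"
proof (rule map_eqI)
  fix x assume "x \<in> carrier G"
  then show "\<phi>R (group_ring_single R s g) (\<phi> x) = group_ring_single R s (\<phi> g) (\<phi> x)"
    using map_image[OF G.single_closed[OF assms]] assms(2) inj_on_eq_iff[OF inj, of x g]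
    by (simp add: group_ring_single_def)
next
  fix y assume "y \<notin> \<phi> ` carrier G"
  then show "\<phi>R (group_ring_single R s g) y = group_ring_single R s (\<phi> g) y"
    using assms(2) by (auto simp: map_outside group_ring_single_def)
qed

text \<open>The convolution over \<open>H\<close> shrinks to the image of \<open>G\<close>, outside
  which coefficients vanish, and is then reindexed along the injective
  \<open>\<phi>\<close>.\<close>

lemma map_mult:
  assumes a: "a \<in> carrier (group_ring R G)" and b: "b \<in> carrier (group_ring R G)"
  shows "\<phi>R (a \<otimes>\<^bsub>group_ring R G\<^esub> b) = \<phi>R a \<otimes>\<^bsub>group_ring R H\<^esub> \<phi>R b"
proof -
  interpret GR: ring "group_ring R G" by (rule G.ring_RG)
  have c: "a x \<in> carrier R" "b x \<in> carrier R" "\<phi>R a y \<in> carrier R" "\<phi>R b y \<in> carrier R" for x y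
    using a b map_closed[OF a] map_closed[OF b] by (simp_all add: G.carrier_RG H.carrier_RG)
  have prod: "(\<phi>R a \<otimes>\<^bsub>group_ring R H\<^esub> \<phi>R b) y =
      (\<Oplus>\<^bsub>R\<^esub>x\<in>carrier G. a x \<otimes>\<^bsub>R\<^esub> \<phi>R b (inv\<^bsub>H\<^esub> (\<phi> x) \<otimes>\<^bsub>H\<^esub> y))" if y: "y \<in> carrier H" for y
  proof -
    have "(\<phi>R a \<otimes>\<^bsub>group_ring R H\<^esub> \<phi>R b) y =
        (\<Oplus>\<^bsub>R\<^esub>z\<in>carrier H. \<phi>R a z \<otimes>\<^bsub>R\<^esub> \<phi>R b (inv\<^bsub>H\<^esub> z \<otimes>\<^bsub>H\<^esub> y))"
      by (rule group_ring_mult_eq[OF G.R.ring_axioms H.G.group_axioms H.finite_G map_closed[OF a] map_closed[OF b] y])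
    also have "\<dots> = (\<Oplus>\<^bsub>R\<^esub>z\<in>\<phi> ` carrier G. \<phi>R a z \<otimes>\<^bsub>R\<^esub> \<phi>R b (inv\<^bsub>H\<^esub> z \<otimes>\<^bsub>H\<^esub> y))"
      by (rule G.R.add.finprod_mono_neutral_cong_right) (use H.finite_G c in \<open>auto simp: map_outside\<close>)
    also have "\<dots> = (\<Oplus>\<^bsub>R\<^esub>x\<in>carrier G. \<phi>R a (\<phi> x) \<otimes>\<^bsub>R\<^esub> \<phi>R b (inv\<^bsub>H\<^esub> (\<phi> x) \<otimes>\<^bsub>H\<^esub> y))"
      by (rule G.R.finsum_reindex[OF _ inj]) (use c in auto)
    also have "\<dots> = (\<Oplus>\<^bsub>R\<^esub>x\<in>carrier G. a x \<otimes>\<^bsub>R\<^esub> \<phi>R b (inv\<^bsub>H\<^esub> (\<phi> x) \<otimes>\<^bsub>H\<^esub> y))"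
      by (rule G.R.finsum_cong') (use c map_image[OF a] in auto)
    finally show ?thesis .
  qed
  show ?thesis
  proof (rule map_eqI)
    fix w assume w: "w \<in> carrier G"
    have "(\<phi>R a \<otimes>\<^bsub>group_ring R H\<^esub> \<phi>R b) (\<phi> w) =
        (\<Oplus>\<^bsub>R\<^esub>x\<in>carrier G. a x \<otimes>\<^bsub>R\<^esub> b (inv\<^bsub>G\<^esub> x \<otimes>\<^bsub>G\<^esub> w))"
      unfolding prod[OF \<phi>.hom_closed[OF w]]
    proof (rule G.R.finsum_cong')
      fix x assume x: "x \<in> carrier G"
      then have *: "inv\<^bsub>H\<^esub> (\<phi> x) \<otimes>\<^bsub>H\<^esub> \<phi> w = \<phi> (inv\<^bsub>G\<^esub> x \<otimes>\<^bsub>G\<^esub> w)" using w by simp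
      then show "a x \<otimes>\<^bsub>R\<^esub> \<phi>R b (inv\<^bsub>H\<^esub> (\<phi> x) \<otimes>\<^bsub>H\<^esub> \<phi> w) = a x \<otimes>\<^bsub>R\<^esub> b (inv\<^bsub>G\<^esub> x \<otimes>\<^bsub>G\<^esub> w)"
        unfolding * using map_image[OF b, of "inv\<^bsub>G\<^esub> x \<otimes>\<^bsub>G\<^esub> w"] x w by simp
    qed (use c in auto)
    then show "\<phi>R (a \<otimes>\<^bsub>group_ring R G\<^esub> b) (\<phi> w) = (\<phi>R a \<otimes>\<^bsub>group_ring R H\<^esub> \<phi>R b) (\<phi> w)"
      using map_image[OF GR.m_closed[OF a b] w] group_ring_mult_eq[OF G.R.ring_axioms G.G.group_axioms G.finite_G a b w]
      by simp
  next
    \<comment> \<open>The image of \<open>G\<close> is a subgroup, so multiplying \<open>y\<close>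
      by the inverse of some \<open>\<phi> x\<close> stays outside it, and every term of the
      convolution is zero.\<close>
    fix y assume y: "y \<notin> \<phi> ` carrier G"
    have "(\<phi>R a \<otimes>\<^bsub>group_ring R H\<^esub> \<phi>R b) y = \<zero>\<^bsub>R\<^esub>"
    proof (cases "y \<in> carrier H")
      case True
      have "inv\<^bsub>H\<^esub> (\<phi> x) \<otimes>\<^bsub>H\<^esub> y \<notin> \<phi> ` carrier G" if x: "x \<in> carrier G" for x
      proof
        assume "inv\<^bsub>H\<^esub> (\<phi> x) \<otimes>\<^bsub>H\<^esub> y \<in> \<phi> ` carrier G"
        then obtain u where u: "u \<in> carrier G" "inv\<^bsub>H\<^esub> (\<phi> x) \<otimes>\<^bsub>H\<^esub> y = \<phi> u" by blast
        then have "y = \<phi> (x \<otimes>\<^bsub>G\<^esub> u)" using x True by (simp add: H.G.inv_solve_left')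
        moreover have "\<phi> (x \<otimes>\<^bsub>G\<^esub> u) \<in> \<phi> ` carrier G" using x u by (intro imageI) simp
        ultimately show False using y by blast
      qed
      then show ?thesis unfolding prod[OF True]
        by (intro G.R.add.finprod_one_eqI) (use c in \<open>simp add: map_outside\<close>)
    qed (simp add: group_ring_mult_outside)
    then show "\<phi>R (a \<otimes>\<^bsub>group_ring R G\<^esub> b) y = (\<phi>R a \<otimes>\<^bsub>group_ring R H\<^esub> \<phi>R b) y"
      by (simp add: map_outside[OF y])
  qed
qed

lemma map_ring_hom: "\<phi>R \<in> ring_hom (group_ring R G) (group_ring R H)"
proof (rule ring_hom_memI)
  interpret GR: ring "group_ring R G" by (rule G.ring_RG)
  fix a b assume a: "a \<in> carrier (group_ring R G)" and b: "b \<in> carrier (group_ring R G)"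
  show "\<phi>R (a \<oplus>\<^bsub>group_ring R G\<^esub> b) = \<phi>R a \<oplus>\<^bsub>group_ring R H\<^esub> \<phi>R b"
  proof (rule map_eqI)
    fix x assume "x \<in> carrier G"
    then show "\<phi>R (a \<oplus>\<^bsub>group_ring R G\<^esub> b) (\<phi> x) = (\<phi>R a \<oplus>\<^bsub>group_ring R H\<^esub> \<phi>R b) (\<phi> x)"
      using map_image[OF GR.a_closed[OF a b]] map_image[OF a] map_image[OF b] by simp
  qed (simp add: map_outside)
next
  show "\<phi>R \<one>\<^bsub>group_ring R G\<^esub> = \<one>\<^bsub>group_ring R H\<^esub>"
    using map_single[of "\<one>\<^bsub>R\<^esub>" "\<one>\<^bsub>G\<^esub>"] unfolding G.single_one[symmetric] H.single_one[symmetric] by simp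
qed (simp_all add: map_closed map_mult)

text \<open>\<open>M\<close> is finitely generated already over \<open>R\<close>, as
  \<open>H\<close> is finite, and a submodule over the group ring of \<open>G\<close> is in
  particular one over \<open>R\<close>.\<close>

lemma restrict_scalars_fg:
  assumes M: "left_module (group_ring R H) M" "finitely_generated_module (group_ring R H) M"
  shows "left_module (group_ring R G) (restrict_scalars \<phi>R M)"
    and "finitely_generated_module (group_ring R G) (restrict_scalars \<phi>R M)"
proof -
  have lG: "left_module (group_ring R G) (restrict_scalars \<phi>R M)"
    by (rule left_module_restrict_scalars[OF G.ring_RG map_ring_hom M(1)])
  have lR: "left_module R (restrict_scalars (\<lambda>s. group_ring_single R s \<one>\<^bsub>H\<^esub>) M)"
    by (rule left_module_restrict_scalars[OF G.R.ring_axioms H.scalar_ring_hom M(1)])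
  have sub: "submod R (restrict_scalars (\<lambda>s. group_ring_single R s \<one>\<^bsub>H\<^esub>) M) P"
    if P: "submod (group_ring R G) (restrict_scalars \<phi>R M) P" for P
  proof (rule submodI)
    fix s x assume s: "s \<in> carrier R" and x: "x \<in> P"
    have "\<phi>R (group_ring_single R s \<one>\<^bsub>G\<^esub>) \<odot>\<^bsub>M\<^esub> x \<in> P"
      using submod_smult[OF P G.single_closed[OF s G.G.one_closed] x] by simp
    then show "s \<odot>\<^bsub>restrict_scalars (\<lambda>s. group_ring_single R s \<one>\<^bsub>H\<^esub>) M\<^esub> x \<in> P"
      using map_single[OF s G.G.one_closed] by simp
  qed (use submod_subset[OF P] submod_zero[OF P] submod_add[OF P] in auto)
  show "finitely_generated_module (group_ring R G) (restrict_scalars \<phi>R M)"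
    by (rule finitely_generated_mono[OF lR lG _ sub H.finitely_generated_scalars[OF M]]) simp_all
  show "left_module (group_ring R G) (restrict_scalars \<phi>R M)" by (rule lG)
qed

end

section \<open>Subgroups of free abelian groups\<close>

text \<open>Induction on the coordinates. The \<open>i\<close>-th coordinate maps \<open>H\<close>
  onto a subgroup of the integers; its kernel is free by induction, and a lift of the generator of
  the image splits off one more basis element. Here \<open>H\<close> is a bare set, so the
  isomorphism is described by additivity and bijectivity.\<close>

lemma frag_subgroup_free:
  fixes H :: "('i \<Rightarrow>\<^sub>0 int) set"
  assumes "finite I" and "\<And>h. h \<in> H \<Longrightarrow> Poly_Mapping.keys h \<subseteq> I"
    and "0 \<in> H" and "\<And>h k. h \<in> H \<Longrightarrow> k \<in> H \<Longrightarrow> h - k \<in> H"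
  shows "\<exists>(m :: nat) \<phi>. (\<forall>h\<in>H. \<forall>k\<in>H. \<phi> (h + k) = \<phi> h + \<phi> k) \<and>
    bij_betw \<phi> H (carrier (free_Abelian_group {..<m}))"
  using assms
proof (induction I arbitrary: H rule: finite_induct)
  case empty
  then have "H = {0}" by auto
  then have "bij_betw (\<lambda>_. 0 :: nat \<Rightarrow>\<^sub>0 int) H (carrier (free_Abelian_group {..<0}))"
    by (auto simp: bij_betw_def)
  then show ?case by (intro exI[of _ 0] exI[of _ "\<lambda>_. 0"]) simp
next
  case (insert i I)
  note zero = insert.prems(2) and diff = insert.prems(3)
  have cmul: "frag_cmul n h \<in> H" if "h \<in> H" for n h
    by (rule frag_closure_minus_cmul[of "\<lambda>h. h \<in> H"]) (use zero diff that in auto)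
  have add: "h + k \<in> H" if "h \<in> H" "k \<in> H" for h k
    using diff[OF that(1) diff[OF zero that(2)]] by simp
  let ?c = "\<lambda>h. Poly_Mapping.lookup h i" and ?H = "{h \<in> H. Poly_Mapping.lookup h i = 0}"
  have keys: "Poly_Mapping.keys h \<subseteq> I" if "h \<in> ?H" for h
    using insert.prems(1)[of h] that by (auto simp: in_keys_iff)
  have "\<exists>(m :: nat) \<phi>. (\<forall>h\<in>?H. \<forall>k\<in>?H. \<phi> (h + k) = \<phi> h + \<phi> k) \<and>
      bij_betw \<phi> ?H (carrier (free_Abelian_group {..<m}))"
    by (rule insert.IH) (use keys zero diff in \<open>auto simp: lookup_minus\<close>)
  then obtain m :: nat and \<phi> where \<phi>: "\<And>h k. h \<in> ?H \<Longrightarrow> k \<in> ?H \<Longrightarrow> \<phi> (h + k) = \<phi> h + \<phi> k"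
    and bij: "bij_betw \<phi> ?H (carrier (free_Abelian_group {..<m}))" by blast
  show ?case
  proof (cases "?H = H")
    case True
    then show ?thesis using \<phi> bij by (intro exI[of _ m] exI[of _ \<phi>]) simp
  next
    case False
    then obtain h1 where h1: "h1 \<in> H" "?c h1 \<noteq> 0" by auto
    \<comment> \<open>The image is generated by its least positive value; one exists because
      \<open>h1\<close> or its negative has a positive coordinate.\<close>
    let ?P = "\<lambda>n. 0 < n \<and> (\<exists>h\<in>H. ?c h = int n)"
    have "?P (nat \<bar>?c h1\<bar>)"
    proof (cases "?c h1 > 0")
      case True
      then show ?thesis using h1 by (auto intro!: bexI[of _ h1])
    next
      case False
      then show ?thesis using h1 cmul[of h1 "-1"] by (auto intro!: bexI[of _ "- h1"] simp: lookup_uminus)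
    qed
    then have P: "?P (LEAST n. ?P n)" by (rule LeastI)
    define d where "d = (LEAST n. ?P n)"
    from P obtain g where g: "g \<in> H" "?c g = int d" and d: "d > 0" by (auto simp: d_def[symmetric])
    \<comment> \<open>By division with remainder, a nonzero remainder would be a smaller positive
      value of the coordinate.\<close>
    have dvd: "int d dvd ?c h" if h: "h \<in> H" for h
    proof (rule ccontr)
      assume nd: "\<not> int d dvd ?c h"
      let ?r = "?c h mod int d"
      have r: "?r > 0" "?r < int d" using nd d by (simp_all add: dvd_eq_mod_eq_0 le_neq_trans)
      have "h - frag_cmul (?c h div int d) g \<in> H" by (intro diff cmul h g)
      moreover have "?c (h - frag_cmul (?c h div int d) g) = ?r"
        using g by (simp add: lookup_minus minus_div_mult_eq_mod)
      ultimately have "?P (nat ?r)" using r by auto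
      then have "d \<le> nat ?r" unfolding d_def by (rule Least_le)
      then show False using r by linarith
    qed
    define q where "q h = ?c h div int d" for h
    have q: "?c h = q h * int d" if "h \<in> H" for h using dvd[OF that] by (simp add: q_def)
    have q_add: "q (h + k) = q h + q k" if "h \<in> H" "k \<in> H" for h k
      using dvd[OF that(1)] by (simp add: q_def lookup_add div_plus_div_distrib_dvd_left)
    define r where "r h = h - frag_cmul (q h) g" for h
    have r: "r h \<in> ?H" if "h \<in> H" for h
      using that q[OF that] g by (auto simp: r_def lookup_minus intro: diff cmul)
    \<comment> \<open>The remainder \<open>r h\<close> has \<open>i\<close>-th coordinate zero and
      is covered by induction; the quotient \<open>q h\<close> becomes the coefficient of the new
      basis element \<open>m\<close>.\<close>
    define \<psi> where "\<psi> h = \<phi> (r h) + frag_cmul (q h) (frag_of m)" for h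
    have \<phi>keys: "Poly_Mapping.keys (\<phi> h) \<subseteq> {..<m}" if "h \<in> ?H" for h
      using bij_betw_apply[OF bij that] by simp
    have \<psi>m: "Poly_Mapping.lookup (\<psi> h) m = q h" if "h \<in> H" for h
      using \<phi>keys[OF r[OF that]] by (auto simp: \<psi>_def lookup_add in_keys_iff subset_iff)
    have "bij_betw \<psi> H (carrier (free_Abelian_group {..<Suc m}))"
      unfolding bij_betw_def
    proof (intro conjI inj_onI equalityI subsetI)
      fix h k assume hk: "h \<in> H" "k \<in> H" "\<psi> h = \<psi> k"
      then have "q h = q k" using \<psi>m by metis
      moreover from this have "\<phi> (r h) = \<phi> (r k)" using hk by (simp add: \<psi>_def)
      then have "r h = r k" using bij_betw_imp_inj_on[OF bij] r hk by (auto dest: inj_onD)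
      ultimately show "h = k" by (simp add: r_def)
    next
      fix f assume "f \<in> \<psi> ` H"
      then obtain h where h: "h \<in> H" "f = \<psi> h" by blast
      have "Poly_Mapping.keys (\<psi> h) \<subseteq> {..<m} \<union> {m}" unfolding \<psi>_def
        by (intro order_trans[OF keys_add] Un_mono \<phi>keys r h) (auto split: if_splits)
      then show "f \<in> carrier (free_Abelian_group {..<Suc m})" using h(2) by auto
    next
      fix f assume f: "f \<in> carrier (free_Abelian_group {..<Suc m})"
      let ?n = "Poly_Mapping.lookup f m"
      have "Poly_Mapping.keys (f - frag_cmul ?n (frag_of m)) \<subseteq> {..<m}"
      proof
        fix j assume j: "j \<in> Poly_Mapping.keys (f - frag_cmul ?n (frag_of m))"
        then have "j \<noteq> m" by (auto simp: in_keys_iff lookup_minus)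
        moreover have "j \<in> {..<Suc m}"
          using j f keys_diff[of f "frag_cmul ?n (frag_of m)"] by (auto split: if_splits)
        ultimately show "j \<in> {..<m}" by auto
      qed
      then have "f - frag_cmul ?n (frag_of m) \<in> \<phi> ` ?H"
        using bij by (auto simp: bij_betw_def)
      then obtain h where h: "h \<in> ?H" "f - frag_cmul ?n (frag_of m) = \<phi> h" by blast
      let ?k = "h + frag_cmul ?n g"
      have k: "?k \<in> H" using h g by (auto intro: add cmul)
      have "q ?k = ?n" using h(1) g d by (simp add: q_def lookup_add)
      then have "\<psi> ?k = f" using h(2)[symmetric] by (simp add: \<psi>_def r_def)
      then show "f \<in> \<psi> ` H" using k by (intro image_eqI[of _ _ ?k]) simp_all
    qed
    moreover have "\<psi> (h + k) = \<psi> h + \<psi> k" if "h \<in> H" "k \<in> H" for h k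
    proof -
      have "r (h + k) = r h + r k" using that by (simp add: r_def q_add frag_cmul_distrib)
      then show ?thesis using that by (simp add: \<psi>_def q_add \<phi>[OF r r] frag_cmul_distrib)
    qed
    ultimately show ?thesis by (intro exI[of _ "Suc m"] exI[of _ \<psi>]) simp
  qed
qed

lemma free_abelian_of_finite_rank_if_embeds:
  fixes \<Psi> :: "'a \<Rightarrow> ('i \<Rightarrow>\<^sub>0 int)"
  assumes G: "group G" and I: "finite I" and inj: "inj_on \<Psi> (carrier G)"
    and keys: "\<And>x. x \<in> carrier G \<Longrightarrow> Poly_Mapping.keys (\<Psi> x) \<subseteq> I"
    and mult: "\<And>x y. x \<in> carrier G \<Longrightarrow> y \<in> carrier G \<Longrightarrow> \<Psi> (x \<otimes>\<^bsub>G\<^esub> y) = \<Psi> x + \<Psi> y"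
  shows "free_abelian_of_finite_rank G"
proof -
  interpret group G by fact
  have one: "\<Psi> \<one>\<^bsub>G\<^esub> = 0" using mult[of "\<one>\<^bsub>G\<^esub>" "\<one>\<^bsub>G\<^esub>"] by simp
  have inv: "\<Psi> (inv\<^bsub>G\<^esub> x) = - \<Psi> x" if "x \<in> carrier G" for x
    using mult[of x "inv\<^bsub>G\<^esub> x"] that one by (simp add: add_eq_0_iff)
  have "\<exists>(m :: nat) \<phi>. (\<forall>h\<in>\<Psi> ` carrier G. \<forall>k\<in>\<Psi> ` carrier G. \<phi> (h + k) = \<phi> h + \<phi> k) \<and>
      bij_betw \<phi> (\<Psi> ` carrier G) (carrier (free_Abelian_group {..<m}))"
  proof (rule frag_subgroup_free[OF I])
    show "0 \<in> \<Psi> ` carrier G" using one by (metis image_eqI one_closed)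
    fix h k assume "h \<in> \<Psi> ` carrier G" "k \<in> \<Psi> ` carrier G"
    then obtain x y where x: "x \<in> carrier G" "h = \<Psi> x" and y: "y \<in> carrier G" "k = \<Psi> y" by blast
    then have "h - k = \<Psi> (x \<otimes>\<^bsub>G\<^esub> inv\<^bsub>G\<^esub> y)" by (simp add: mult inv)
    then show "h - k \<in> \<Psi> ` carrier G" using x y by simp
  qed (use keys in auto)
  then obtain m :: nat and \<phi> where \<phi>: "\<And>h k. h \<in> \<Psi> ` carrier G \<Longrightarrow> k \<in> \<Psi> ` carrier G \<Longrightarrow> \<phi> (h + k) = \<phi> h + \<phi> k"
    and bij: "bij_betw \<phi> (\<Psi> ` carrier G) (carrier (free_Abelian_group {..<m}))" by blast
  have "bij_betw (\<phi> \<circ> \<Psi>) (carrier G) (carrier (free_Abelian_group {..<m}))"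
    using inj bij by (intro bij_betw_trans[of \<Psi>]) (simp_all add: bij_betw_def)
  then have "\<phi> \<circ> \<Psi> \<in> iso G (free_Abelian_group {..<m})"
    by (auto simp: iso_def hom_def mult \<phi> dest: bij_betw_apply)
  then show ?thesis unfolding free_abelian_of_finite_rank_def is_iso_def by blast
qed

section \<open>The inverse limit\<close>

text \<open>Triples in \<open>Z\<close> are transition maps from \<open>G j\<close> to
  \<open>G i\<close>. Collecting restrictions and conjugations in one such set treats both
  compatibility conditions at once.\<close>

lemma subgroup_compatible_families:
  assumes G: "\<And>i. i \<in> F \<Longrightarrow> group (G i)"
    and Z: "\<And>i j f. (i, j, f) \<in> Z \<Longrightarrow> i \<in> F \<and> j \<in> F \<and> f \<in> hom (G j) (G i)"
  shows "subgroup {x \<in> carrier (product_group F G). \<forall>(i, j, f)\<in>Z. f (x j) = x i} (product_group F G)"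
proof (rule group.subgroupI)
  let ?P = "product_group F G"
  show P: "group ?P" using G by simp
  have hom: "group_hom (G j) (G i) f" if "(i, j, f) \<in> Z" for i j f
    using Z[OF that] G by (simp add: group_hom_def group_hom_axioms_def)
  have "\<one>\<^bsub>?P\<^esub> \<in> {x \<in> carrier ?P. \<forall>(i, j, f)\<in>Z. f (x j) = x i}"
  proof (rule CollectI, intro conjI ballI)
    show "\<one>\<^bsub>?P\<^esub> \<in> carrier ?P" using P by (simp only: group.is_monoid monoid.one_closed)
    fix z assume z: "z \<in> Z"
    obtain i j f where "z = (i, j, f)" by (cases z)
    then show "case z of (i, j, f) \<Rightarrow> f (\<one>\<^bsub>?P\<^esub> j) = \<one>\<^bsub>?P\<^esub> i"
      using z Z group_hom.hom_one[OF hom] by simp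
  qed
  then show "{x \<in> carrier ?P. \<forall>(i, j, f)\<in>Z. f (x j) = x i} \<noteq> {}" by blast
next
  let ?P = "product_group F G"
  have hom: "group_hom (G j) (G i) f" if "(i, j, f) \<in> Z" for i j f
    using Z[OF that] G by (simp add: group_hom_def group_hom_axioms_def)
  fix x assume "x \<in> {x \<in> carrier ?P. \<forall>(i, j, f)\<in>Z. f (x j) = x i}"
  then have x: "x \<in> carrier ?P" "\<And>i j f. (i, j, f) \<in> Z \<Longrightarrow> f (x j) = x i" by auto
  have xi: "x i \<in> carrier (G i)" if "i \<in> F" for i using x(1) that by auto
  have iv: "inv\<^bsub>?P\<^esub> x = (\<lambda>i\<in>F. inv\<^bsub>G i\<^esub> x i)" using x(1) G by (intro inv_product_group) simp_all
  have P: "group ?P" using G by simp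
  show "inv\<^bsub>?P\<^esub> x \<in> {x \<in> carrier ?P. \<forall>(i, j, f)\<in>Z. f (x j) = x i}"
  proof (rule CollectI, intro conjI ballI)
    show "inv\<^bsub>?P\<^esub> x \<in> carrier ?P" using group.inv_closed[OF P x(1)] .
    fix z assume z: "z \<in> Z"
    obtain i j f where "z = (i, j, f)" by (cases z)
    then show "case z of (i, j, f) \<Rightarrow> f ((inv\<^bsub>?P\<^esub> x) j) = (inv\<^bsub>?P\<^esub> x) i"
      using z Z[of i j f] group_hom.hom_inv[OF hom, of i j f "x j"] x(2)[of i j f] xi by (simp add: iv)
  qed
  fix y assume "y \<in> {x \<in> carrier ?P. \<forall>(i, j, f)\<in>Z. f (x j) = x i}"
  then have y: "y \<in> carrier ?P" "\<And>i j f. (i, j, f) \<in> Z \<Longrightarrow> f (y j) = y i" by auto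
  have yi: "y i \<in> carrier (G i)" if "i \<in> F" for i using y(1) that by auto
  show "x \<otimes>\<^bsub>?P\<^esub> y \<in> {x \<in> carrier ?P. \<forall>(i, j, f)\<in>Z. f (x j) = x i}"
  proof (rule CollectI, intro conjI ballI)
    show "x \<otimes>\<^bsub>?P\<^esub> y \<in> carrier ?P" using P x(1) y(1) by (rule monoid.m_closed[OF group.is_monoid])
    fix z assume z: "z \<in> Z"
    obtain i j f where "z = (i, j, f)" by (cases z)
    then show "case z of (i, j, f) \<Rightarrow> f ((x \<otimes>\<^bsub>?P\<^esub> y) j) = (x \<otimes>\<^bsub>?P\<^esub> y) i"
      using z Z[of i j f] group_hom.hom_mult[OF hom, of i j f "x j" "y j"] x(2)[of i j f] y(2)[of i j f] xi yi
      by simp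
  qed
qed auto

lemma group_groth_group: "group (groth_group A)"
  unfolding groth_group_def by (rule normal.factorgroup_is_group[OF normal_groth_relations])

lemma finite_group_ring_subgroup:
  assumes "cring S" "group \<Gamma>" "H \<in> finite_subgroups \<Gamma>"
  shows "finite_group_ring S (\<Gamma>\<lparr>carrier := H\<rparr>)"
  using assms subgroup.subgroup_is_group[of H \<Gamma>]
  by (simp add: finite_group_ring_def finite_group_ring_axioms_def finite_subgroups_def)

text \<open>Restriction along an injective homomorphism of finite groups keeps modules finitely
  generated, which is what the pullback of Grothendieck groups requires.\<close>

lemma subgroup_groth_pullback_hom:
  assumes S: "cring S" and \<Gamma>: "group \<Gamma>" and H: "H \<in> finite_subgroups \<Gamma>" and K: "K \<in> finite_subgroups \<Gamma>"
    and \<phi>: "\<phi> \<in> hom (\<Gamma>\<lparr>carrier := H\<rparr>) (\<Gamma>\<lparr>carrier := K\<rparr>)" "inj_on \<phi> H"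
  shows "subgroup_groth_pullback S \<Gamma> H K \<phi> \<in> hom (groth_group (subgroup_ring S \<Gamma> K)) (groth_group (subgroup_ring S \<Gamma> H))"
proof -
  interpret finite_group_ring_map S "\<Gamma>\<lparr>carrier := H\<rparr>" "\<Gamma>\<lparr>carrier := K\<rparr>" \<phi>
    using finite_group_ring_subgroup[OF S \<Gamma>] H K \<phi>
    by (simp add: finite_group_ring_map_def finite_group_ring_map_axioms_def)
  show ?thesis unfolding subgroup_groth_pullback_def
    by (rule groth_pullback_hom(1)) (use map_closed restrict_scalars_fg in \<open>auto simp: fg_modules_def\<close>)
qed

lemma (in group) conj_map_hom:
  assumes "subgroup H G" "\<gamma> \<in> carrier G" "conj_map G \<gamma> ` H = K"
  shows "conj_map G \<gamma> \<in> hom (G\<lparr>carrier := H\<rparr>) (G\<lparr>carrier := K\<rparr>)" and "inj_on (conj_map G \<gamma>) H"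
proof -
  have c: "h \<in> carrier G" if "h \<in> H" for h using subgroup.mem_carrier[OF assms(1) that] .
  have "conj_map G \<gamma> (h \<otimes> k) = conj_map G \<gamma> h \<otimes> conj_map G \<gamma> k" if "h \<in> H" "k \<in> H" for h k
  proof -
    have "inv \<gamma> \<otimes> (\<gamma> \<otimes> x) = x" if "x \<in> carrier G" for x
      using that assms(2) by (simp add: m_assoc[symmetric])
    then show ?thesis using assms(2) c[OF that(1)] c[OF that(2)] by (simp add: conj_map_def m_assoc)
  qed
  then show "conj_map G \<gamma> \<in> hom (G\<lparr>carrier := H\<rparr>) (G\<lparr>carrier := K\<rparr>)"
    using assms(3) by (auto simp: hom_def)
  show "inj_on (conj_map G \<gamma>) H"
    by (rule inj_onI) (use assms(2) c in \<open>simp add: conj_map_def\<close>)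
qed

lemma (in group) conj_map_one: "H \<subseteq> carrier G \<Longrightarrow> conj_map G \<one> ` H = H"
  by (force simp: conj_map_def)

text \<open>Tagging basis elements with the subgroup keeps different components apart, so that each
  can be read off from a sum.\<close>

lemma lookup_frag_extend_Pair:
  "Poly_Mapping.lookup (frag_extend (\<lambda>T. frag_of (K, T)) c) (H, T) = (if H = K then Poly_Mapping.lookup c T else 0)"
proof -
  have "Poly_Mapping.keys c \<subseteq> UNIV" by simp
  then show ?thesis
    by (induction c rule: frag_induction) (auto simp: frag_extend_diff lookup_minus)
qed

theorem proposition2p1:
  fixes \<Gamma> :: "('g, 'n) monoid_scheme"
    and S :: "('r, 'm) ring_scheme"
    and \<F> :: "'g set set"
  assumes "group \<Gamma>"
    and "finitely_many_finite_subgroups_up_to_conj \<Gamma>"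
    and "cring S"
    and "minimal_condition_on_ideals S"
    and "family_of_finite_subgroups \<Gamma> \<F>"
  shows "free_abelian_of_finite_rank (family_groth_group S \<Gamma> \<F>)"
proof -
  interpret \<Gamma>: group \<Gamma> by fact
  note art = minimal_condition_imp_artinian[OF assms(3,4)]
  have fin: "H \<in> finite_subgroups \<Gamma>" if "H \<in> \<F>" for H
    using assms(5) that by (auto simp: family_of_finite_subgroups_def)
  then have sub: "subgroup H \<Gamma>" if "H \<in> \<F>" for H using that by (auto simp: finite_subgroups_def)
  let ?G = "\<lambda>H. groth_group (subgroup_ring S \<Gamma> H)" and ?pull = "subgroup_groth_pullback S \<Gamma>"
  let ?P = "product_group \<F> ?G" and ?L = "family_groth_group S \<Gamma> \<F>"
  define Z where "Z = {(H, K, ?pull H K (\<lambda>h. h)) | H K. H \<in> \<F> \<and> K \<in> \<F> \<and> H \<subseteq> K} \<union>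
    {(H, K, ?pull H K (conj_map \<Gamma> \<gamma>)) | H K \<gamma>. H \<in> \<F> \<and> K \<in> \<F> \<and> \<gamma> \<in> carrier \<Gamma> \<and> K = conj_map \<Gamma> \<gamma> ` H}"
  have Z: "H \<in> \<F> \<and> K \<in> \<F> \<and> f \<in> hom (?G K) (?G H)" if z: "(H, K, f) \<in> Z" for H K f
    using z unfolding Z_def
  proof
    assume "(H, K, f) \<in> {(H, K, ?pull H K (\<lambda>h. h)) | H K. H \<in> \<F> \<and> K \<in> \<F> \<and> H \<subseteq> K}"
    then have *: "H \<in> \<F>" "K \<in> \<F>" "H \<subseteq> K" "f = ?pull H K (\<lambda>h. h)" by auto
    then show ?thesis
      using subgroup_groth_pullback_hom[OF assms(3,1) fin[OF *(1)] fin[OF *(2)], of "\<lambda>h. h"]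
      by (auto simp: hom_def)
  next
    assume "(H, K, f) \<in> {(H, K, ?pull H K (conj_map \<Gamma> \<gamma>)) | H K \<gamma>.
      H \<in> \<F> \<and> K \<in> \<F> \<and> \<gamma> \<in> carrier \<Gamma> \<and> K = conj_map \<Gamma> \<gamma> ` H}"
    then obtain \<gamma> where *: "H \<in> \<F>" "K \<in> \<F>" "\<gamma> \<in> carrier \<Gamma>" "K = conj_map \<Gamma> \<gamma> ` H"
      "f = ?pull H K (conj_map \<Gamma> \<gamma>)" by auto
    then show ?thesis
      using subgroup_groth_pullback_hom[OF assms(3,1) fin[OF *(1)] fin[OF *(2)]
          \<Gamma>.conj_map_hom[OF sub[OF *(1)] *(3) *(4)[symmetric]]] by simp
  qed
  let ?C = "{x \<in> carrier ?P. \<forall>(H, K, f)\<in>Z. f (x K) = x H}"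
  have C: "subgroup ?C ?P" by (rule subgroup_compatible_families) (use group_groth_group Z in auto)
  \<comment> \<open>These two facts turn the condition over \<open>Z\<close> back into the
    quantifiers of \<open>family_groth_group\<close>, so that the limit is literally the subgroup
    \<open>?C\<close>.\<close>
  have ball2: "(\<forall>z\<in>{(H, K, f H K) | H K. Q H K}. R z) \<longleftrightarrow> (\<forall>H K. Q H K \<longrightarrow> R (H, K, f H K))" for f Q R
    by blast
  have ball3: "(\<forall>z\<in>{(H, K, f H K \<gamma>) | H K \<gamma>. Q H K \<gamma>}. R z) \<longleftrightarrow>
      (\<forall>H K \<gamma>. Q H K \<gamma> \<longrightarrow> R (H, K, f H K \<gamma>))" for f Q R
    by blast
  have "(\<forall>(H, K, f)\<in>Z. f (x K) = x H) \<longleftrightarrow>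
      (\<forall>H\<in>\<F>. \<forall>K\<in>\<F>. H \<subseteq> K \<longrightarrow> ?pull H K (\<lambda>h. h) (x K) = x H) \<and>
      (\<forall>H\<in>\<F>. \<forall>K\<in>\<F>. \<forall>\<gamma>\<in>carrier \<Gamma>. K = conj_map \<Gamma> \<gamma> ` H \<longrightarrow>
        ?pull H K (conj_map \<Gamma> \<gamma>) (x K) = x H)" for x
    unfolding Z_def ball_Un ball2 ball3 prod.case unfolding Ball_def
    by (intro arg_cong2[of _ _ _ _ "(\<and>)"] iff_allI) blast+
  then have eq: "?L = ?P\<lparr>carrier := ?C\<rparr>" unfolding family_groth_group_def Let_def by (simp only:)
  have "group ?P" by (rule product_group) (rule group_groth_group)
  then have L: "group ?L" "carrier ?L = ?C" "monoid.mult ?L = monoid.mult ?P"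
    using subgroup.subgroup_is_group[OF C] unfolding eq by simp_all
  define cl where "cl H = {conj_map \<Gamma> \<gamma> ` H | \<gamma>. \<gamma> \<in> carrier \<Gamma>}" for H
  have cl_self: "H \<in> cl H" if "H \<in> \<F>" for H
    using \<Gamma>.conj_map_one[OF subgroup.subset[OF sub[OF that]]] unfolding cl_def
    by (intro CollectI exI[of _ "\<one>\<^bsub>\<Gamma>\<^esub>"]) simp
  \<comment> \<open>One subgroup from each conjugacy class met by \<open>\<F>\<close>, chosen inside
    \<open>\<F>\<close> so that the families have components there.\<close>
  define reps where "reps = inv_into \<F> cl ` (cl ` \<F>)"
  have "finite (cl ` \<F>)"
    using assms(2) fin unfolding finitely_many_finite_subgroups_up_to_conj_def cl_def
    by (auto elim!: rev_finite_subset)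
  then have reps: "finite reps" "reps \<subseteq> \<F>" unfolding reps_def by (auto intro: inv_into_into)
  have rep: "\<exists>R\<in>reps. \<exists>\<gamma>\<in>carrier \<Gamma>. R = conj_map \<Gamma> \<gamma> ` H" if H: "H \<in> \<F>" for H
  proof -
    let ?R = "inv_into \<F> cl (cl H)"
    have R: "?R \<in> \<F>" "cl ?R = cl H" using H inv_into_into[of "cl H" cl \<F>] f_inv_into_f[of "cl H" cl \<F>] by simp_all
    \<comment> \<open>The representative lies in its own class, which equals that of
      \<open>H\<close>; this yields a conjugation leading from \<open>H\<close> to the
      representative.\<close>
    have "?R \<in> cl ?R" by (rule cl_self[OF R(1)])
    then show ?thesis using R H unfolding R(2) by (auto simp: cl_def reps_def)
  qed
  let ?emb = "\<lambda>H \<Phi> I. finite I \<and> inj_on \<Phi> (carrier (?G H)) \<and>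
    (\<forall>C\<in>carrier (?G H). Poly_Mapping.keys
      (\<Phi> C :: ('g \<Rightarrow> 'r, (nat \<Rightarrow> 'g \<Rightarrow> 'r) set) module \<Rightarrow>\<^sub>0 int) \<subseteq> I) \<and>
    (\<forall>C\<in>carrier (?G H). \<forall>D\<in>carrier (?G H). \<Phi> (C \<otimes>\<^bsub>?G H\<^esub> D) = \<Phi> C + \<Phi> D)"
  have "\<exists>\<Phi> I. ?emb H \<Phi> I" if H: "H \<in> \<F>" for H
  proof -
    interpret finite_group_ring S "\<Gamma>\<lparr>carrier := H\<rparr>"
      by (rule finite_group_ring_subgroup[OF assms(3,1) fin[OF H]])
    interpret finite_length_ring "subgroup_ring S \<Gamma> H" by (rule finite_length[OF art])
    show ?thesis
    proof (rule groth_group_embedding)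
      fix \<Phi> and I :: "('g \<Rightarrow> 'r, (nat \<Rightarrow> 'g \<Rightarrow> 'r) set) module set"
      assume "finite I" "inj_on \<Phi> (carrier (?G H))"
        "\<And>C. C \<in> carrier (?G H) \<Longrightarrow> Poly_Mapping.keys (\<Phi> C :: _ \<Rightarrow>\<^sub>0 int) \<subseteq> I"
        "\<And>C D. C \<in> carrier (?G H) \<Longrightarrow> D \<in> carrier (?G H) \<Longrightarrow> \<Phi> (C \<otimes>\<^bsub>?G H\<^esub> D) = \<Phi> C + \<Phi> D"
      then show "\<exists>\<Phi> I. ?emb H \<Phi> I" by (intro exI[of _ \<Phi>] exI[of _ I]) simp
    qed
  qed
  then have "\<forall>H\<in>\<F>. \<exists>\<Phi> I. ?emb H \<Phi> I" by (intro ballI)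
  from bchoice[OF this] obtain \<Phi> where "\<forall>H\<in>\<F>. \<exists>I. ?emb H (\<Phi> H) I" by (rule exE)
  from bchoice[OF this] obtain I where emb: "\<forall>H\<in>\<F>. ?emb H (\<Phi> H) (I H)" by (rule exE)
  have I: "finite (I H)" and inj: "inj_on (\<Phi> H) (carrier (?G H))" if "H \<in> \<F>" for H
    using bspec[OF emb that] by simp_all
  have keys: "Poly_Mapping.keys (\<Phi> H C) \<subseteq> I H" if "H \<in> \<F>" "C \<in> carrier (?G H)" for H C
    using bspec[OF emb that(1)] that(2) by simp
  have mult: "\<Phi> H (C \<otimes>\<^bsub>?G H\<^esub> D) = \<Phi> H C + \<Phi> H D"
    if "H \<in> \<F>" "C \<in> carrier (?G H)" "D \<in> carrier (?G H)" for H C D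
    using bspec[OF emb that(1)] that(2,3) by simp
  have cx: "x H \<in> carrier (?G H)" if "x \<in> carrier ?L" "H \<in> \<F>" for x H using that unfolding L(2) by auto
  \<comment> \<open>Only components at the finitely many representatives are recorded, each tagged
    with its subgroup.\<close>
  define \<Psi> where "\<Psi> x = (\<Sum>H\<in>reps. frag_extend (\<lambda>T. frag_of (H, T)) (\<Phi> H (x H)))" for x
  have lookup: "Poly_Mapping.lookup (\<Psi> x) (H, T) = Poly_Mapping.lookup (\<Phi> H (x H)) T" if "H \<in> reps" for x H T
    using reps(1) that by (simp add: \<Psi>_def lookup_sum lookup_frag_extend_Pair)
  show ?thesis
  proof (rule free_abelian_of_finite_rank_if_embeds[OF L(1)])
    show "finite (Sigma reps I)" using reps I by auto
    show "inj_on \<Psi> (carrier ?L)"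
    proof (rule inj_onI)
      fix x y assume x: "x \<in> carrier ?L" and y: "y \<in> carrier ?L" and eq: "\<Psi> x = \<Psi> y"
      have xy: "x R = y R" if R: "R \<in> reps" for R
      proof -
        have "\<Phi> R (x R) = \<Phi> R (y R)" by (rule poly_mapping_eqI) (metis lookup[OF R] eq)
        then show ?thesis using inj cx x y R reps(2) by (meson inj_onD subsetD)
      qed
      have "x H = y H" if H: "H \<in> \<F>" for H
      proof -
        obtain R \<gamma> where R: "R \<in> reps" "\<gamma> \<in> carrier \<Gamma>" "R = conj_map \<Gamma> \<gamma> ` H" using rep[OF H] by blast
        \<comment> \<open>The conjugation condition recovers \<open>x H\<close> from
          \<open>x R\<close>, so agreement at the representative propagates to
          \<open>H\<close>.\<close>
        have "(H, R, ?pull H R (conj_map \<Gamma> \<gamma>)) \<in> Z" using R H reps(2) by (auto simp: Z_def)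
        then have "?pull H R (conj_map \<Gamma> \<gamma>) (x R) = x H" "?pull H R (conj_map \<Gamma> \<gamma>) (y R) = y H"
          using x y unfolding L(2) by auto
        then show ?thesis using xy[OF R(1)] by simp
      qed
      \<comment> \<open>Members of the product are extensional, taking one fixed value outside
        \<open>\<F>\<close>, so agreement on \<open>\<F>\<close> is equality.\<close>
      moreover have "x \<in> (\<Pi>\<^sub>E H\<in>\<F>. carrier (?G H))" "y \<in> (\<Pi>\<^sub>E H\<in>\<F>. carrier (?G H))"
        using x y unfolding L(2) by simp_all
      ultimately show "x = y" by (blast intro: PiE_ext)
    qed
    fix x assume x: "x \<in> carrier ?L"
    show "Poly_Mapping.keys (\<Psi> x) \<subseteq> Sigma reps I"
    proof
      fix p assume p: "p \<in> Poly_Mapping.keys (\<Psi> x)"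
      then obtain H where H: "H \<in> reps" "p \<in> Poly_Mapping.keys (frag_extend (\<lambda>T. frag_of (H, T)) (\<Phi> H (x H)))"
        using keys_sum[of "\<lambda>H. frag_extend (\<lambda>T. frag_of (H, T)) (\<Phi> H (x H))" reps] unfolding \<Psi>_def by blast
      then obtain T where "T \<in> Poly_Mapping.keys (\<Phi> H (x H))" "p = (H, T)"
        using keys_frag_extend[of "\<lambda>T. frag_of (H, T)" "\<Phi> H (x H)"] by auto
      then show "p \<in> Sigma reps I" using keys[of H "x H"] cx[OF x] H(1) reps(2) by auto
    qed
    fix y assume y: "y \<in> carrier ?L"
    show "\<Psi> (x \<otimes>\<^bsub>?L\<^esub> y) = \<Psi> x + \<Psi> y"
      unfolding \<Psi>_def sum.distrib[symmetric]
    proof (rule sum.cong[OF refl])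
      fix H assume "H \<in> reps"
      then have H: "H \<in> \<F>" using reps(2) by blast
      show "frag_extend (\<lambda>T. frag_of (H, T)) (\<Phi> H ((x \<otimes>\<^bsub>?L\<^esub> y) H)) =
        frag_extend (\<lambda>T. frag_of (H, T)) (\<Phi> H (x H)) + frag_extend (\<lambda>T. frag_of (H, T)) (\<Phi> H (y H))"
        unfolding L(3) using H mult[OF H cx[OF x H] cx[OF y H]] by (simp add: frag_extend_add)
    qed
  qed
qed

end
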